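(* Let $M=(S,P)$ be a transient, irreducible Markov chain with countable state space $S$ and transition matrix $P$. Let $\mu$ be an offspring distribution with mean $\bar\mu>1$ satisfying the $L\log L$ condition $\sum_{n=1}^\infty \mu(n)\,n\log n<\infty$. Let $B=(B_n)_{n\ge 0}$ be a branching random walk on $M$ with offspring distribution $\mu$, started with a single particle at some state $o\in S$. Then, almost surely, the measures $(\bar\mu)^{-n}B_n$ converge weakly as $n\to\infty$ to a random measure $\mathbf{W}$ on the Martin compactification $\mathcal{M}$ of $M$. This random measure is supported on the harmonic Martin boundary $\partial\mathcal{M}_{\mathrm{harm}}$ of $M$ and satisfies $$\mathbb{E}_o\,\mathbf{W}(A)=\mathbf{P}_o(X_\infty\in A)$$ for every Borel set $A\subseteq\mathcal{M}$.
   Context: An offspring distribution is a probability measure $\mu$ on the non-negative integers; its mean is $\bar\mu=\sum_n n\mu(n)$. Branching random walk: start at time $0$ with one particle at $o$. At each time step, every particle alive is independently replaced, at its current location, by a random number of offspring with law $\mu$; then all particles alive independently take one step according to the transition kernel $P$. $B_n(x)$ is the number of particles at $x\in S$ at time $n$. Thus $B_n$ is a finitely supported function $S\to\{0,1,2,\dots\}$, identified with the finite measure $\sum_{x\in S}B_n(x)\delta_x$ on $S\subseteq\mathcal{M}$. $\mathbb{P}_x,\mathbb{E}_x$ denote probability and expectation for the branching random walk started with a single particle at $x$; $\mathbf{P}_x,\mathbf{E}_x$ denote those for the underlying Markov chain $(X_n)_{n\ge0}$ with transition matrix $P$ started at $x$. Martin compactification: let $G(x,y)=\sum_{n\ge0}P^n(x,y)$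 be the Green's function and $K(x,y)=G(x,y)/G(o,y)$ the Martin kernel. $\mathcal{M}$ is the unique smallest compactification of the discrete set $S$ to which all the functions $K(x,\cdot)$, $x\in S$, extend continuously. It is a compact metrisable (Polish) space. The Martin boundary is $\partial\mathcal{M}=\mathcal{M}\setminus S$. By a standard theorem, $X_n$ converges in $\mathcal{M}$ almost surely to a random point $X_\infty\in\partial\mathcal{M}$. The harmonic Martin boundary $\partial\mathcal{M}_{\mathrm{harm}}$ is the support of the law of $X_\infty$ under $\mathbf{P}_o$, i.e. the smallest closed subset of $\partial\mathcal{M}$ with $\mathbf{P}_o(X_\infty\in\partial\mathcal{M}_{\mathrm{harm}})=1$. "$\mathbf{W}$ is supported on $\partial\mathcal{M}_{\mathrm{harm}}$" means $\mathbf{W}(\mathcal{M}\setminus\partial\mathcal{M}_{\mathrm{harm}})=0$ almost surely. Weak convergence of finite measures on $\mathcal{M}$ means convergence of integrals against all continuous functions $\mathcal{M}\to\mathbb{R}$. *)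

theory Defs
  imports "HOL-Probability.Probability" "HOL-Library.Multiset"
begin

section \<open>Markov chains\<close>

text \<open>
  The transition matrix of a chain with state space \<open>'s\<close> is \<open>P :: 's \<Rightarrow> 's pmf\<close>, with entries
  \<open>P(x, y) = pmf (P x) y\<close>; thus \<open>pmf (step_pmf P n x) y\<close> is \<open>P\<^sup>n(x, y)\<close>.
\<close>

primrec step_pmf :: "('s \<Rightarrow> 's pmf) \<Rightarrow> nat \<Rightarrow> 's \<Rightarrow> 's pmf" where
  "step_pmf P 0 x = return_pmf x"
| "step_pmf P (Suc n) x = bind_pmf (P x) (step_pmf P n)"

definition irreducible_chain :: "('s \<Rightarrow> 's pmf) \<Rightarrow> bool" where
  "irreducible_chain P \<longleftrightarrow> (\<forall>x y. \<exists>n. pmf (step_pmf P n x) y > 0)"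

definition green :: "('s \<Rightarrow> 's pmf) \<Rightarrow> 's \<Rightarrow> 's \<Rightarrow> real" where
  "green P x y = (\<Sum>n. pmf (step_pmf P n x) y)"

text \<open>Transience is finiteness of the Green's function.\<close>

definition transient_chain :: "('s \<Rightarrow> 's pmf) \<Rightarrow> bool" where
  "transient_chain P \<longleftrightarrow> (\<forall>x y. summable (\<lambda>n. pmf (step_pmf P n x) y))"

definition martin_kernel :: "('s \<Rightarrow> 's pmf) \<Rightarrow> 's \<Rightarrow> 's \<Rightarrow> 's \<Rightarrow> real" where
  "martin_kernel P x\<^sub>0 x y = green P x y / green P x\<^sub>0 y"

text \<open>
  A process on some probability space that is a Markov chain with transition kernel \<open>K\<close> started
  at \<open>x\<close>, expressed through its finite-dimensional distributions.
\<close>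

definition markov_chain :: "'w measure \<Rightarrow> (nat \<Rightarrow> 'w \<Rightarrow> 'b) \<Rightarrow> ('b \<Rightarrow> 'b pmf) \<Rightarrow> 'b \<Rightarrow> bool" where
  "markov_chain M X K x \<longleftrightarrow>
     prob_space M \<and>
     (\<forall>n. X n \<in> measurable M (count_space UNIV)) \<and>
     (\<forall>n xs. measure M {\<omega> \<in> space M. \<forall>i\<le>n. X i \<omega> = xs i} =
        (if xs 0 = x then \<Prod>i<n. pmf (K (xs i)) (xs (Suc i)) else 0))"

section \<open>Branching random walk\<close>

definition offspring_mean :: "nat pmf \<Rightarrow> real" where
  "offspring_mean \<mu> = (\<Sum>n. real n * pmf \<mu> n)"

text \<open>
  A particle configuration (a finitely supported function \<open>'s \<Rightarrow> nat\<close>) is a multiset of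
  locations; the individual particles of \<open>B\<close> are labelled by pairs \<open>(x, i)\<close> with
  \<open>i < count B x\<close>, the particle \<open>(x, i)\<close> being located at \<open>x\<close>.
\<close>

definition particles :: "'s multiset \<Rightarrow> ('s \<times> nat) set" where
  "particles B = {(x, i). i < count B x}"

definition branch_step :: "nat pmf \<Rightarrow> 's multiset \<Rightarrow> 's multiset pmf" where
  "branch_step \<mu> B =
     map_pmf (\<lambda>k. \<Sum>p\<in>particles B. replicate_mset (k p) (fst p))
       (Pi_pmf (particles B) 0 (\<lambda>_. \<mu>))"

definition move_step :: "('s \<Rightarrow> 's pmf) \<Rightarrow> 's multiset \<Rightarrow> 's multiset pmf" where
  "move_step P B =
     map_pmf (\<lambda>y. \<Sum>p\<in>particles B. {#y p#})
       (Pi_pmf (particles B) undefined (\<lambda>p. P (fst p)))"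

definition brw_kernel :: "nat pmf \<Rightarrow> ('s \<Rightarrow> 's pmf) \<Rightarrow> 's multiset \<Rightarrow> 's multiset pmf" where
  "brw_kernel \<mu> P B = bind_pmf (branch_step \<mu> B) (move_step P)"

definition branching_random_walk ::
  "'w measure \<Rightarrow> (nat \<Rightarrow> 'w \<Rightarrow> 's multiset) \<Rightarrow> nat pmf \<Rightarrow> ('s \<Rightarrow> 's pmf) \<Rightarrow> 's \<Rightarrow> bool" where
  "branching_random_walk M B \<mu> P x \<longleftrightarrow> markov_chain M B (brw_kernel \<mu> P) {#x#}"

section \<open>The Martin compactification\<close>

text \<open>Hausdorff compactifications of the discrete space \<open>'s\<close>, with \<open>\<iota>\<close> the inclusion of \<open>'s\<close>.\<close>

definition compactification :: "'m topology \<Rightarrow> ('s \<Rightarrow> 'm) \<Rightarrow> bool" where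
  "compactification T \<iota> \<longleftrightarrow>
     compact_space T \<and> Hausdorff_space T \<and>
     embedding_map (discrete_topology UNIV) T \<iota> \<and>
     T closure_of (range \<iota>) = topspace T"

definition martin_kernel_extends :: "('s \<Rightarrow> 's pmf) \<Rightarrow> 's \<Rightarrow> 'm topology \<Rightarrow> ('s \<Rightarrow> 'm) \<Rightarrow> bool" where
  "martin_kernel_extends P x\<^sub>0 T \<iota> \<longleftrightarrow>
     (\<forall>x. \<exists>g. continuous_map T euclideanreal g \<and> (\<forall>y. g (\<iota> y) = martin_kernel P x\<^sub>0 x y))"

text \<open>
  The smallest compactification to which the functions \<open>K(x, \<cdot>)\<close> extend: every other such
  compactification maps continuously onto it, by a map fixing \<open>'s\<close>.  The competitors
  range over topologies on subsets of the one type \<open>'s set set\<close>.  This is no restriction, because a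
  point of a Hausdorff compactification is determined by the trace of its neighbourhood filter on
  \<open>'s\<close>; see lemmas \<open>compactification_transfer\<close> and \<open>martin_compactification_least\<close> below.
\<close>

definition martin_compactification :: "('s \<Rightarrow> 's pmf) \<Rightarrow> 's \<Rightarrow> 'm topology \<Rightarrow> ('s \<Rightarrow> 'm) \<Rightarrow> bool" where
  "martin_compactification P x\<^sub>0 T \<iota> \<longleftrightarrow>
     compactification T \<iota> \<and> martin_kernel_extends P x\<^sub>0 T \<iota> \<and>
     (\<forall>(T' :: 's set set topology) \<iota>'.
        compactification T' \<iota>' \<and> martin_kernel_extends P x\<^sub>0 T' \<iota>' \<longrightarrow>
        (\<exists>h. continuous_map T' T h \<and> (\<forall>y. h (\<iota>' y) = \<iota> y)))"

lemma compactification_range: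
  assumes "compactification T \<iota>"
  shows "range \<iota> \<subseteq> topspace T"
proof -
  have "homeomorphic_map (discrete_topology UNIV) (subtopology T (range \<iota>)) \<iota>"
    using assms by (simp add: compactification_def embedding_map_def)
  from homeomorphic_imp_surjective_map[OF this] have "range \<iota> = topspace T \<inter> range \<iota>"
    unfolding topspace_discrete_topology topspace_subtopology .
  then show ?thesis by blast
qed

lemma compactification_transfer:
  fixes T :: "'m topology" and \<iota> :: "'s \<Rightarrow> 'm"
  assumes "compactification T \<iota>"
  obtains T' :: "'s set set topology" and j
  where "homeomorphic_map T T' j" "compactification T' (j \<circ> \<iota>)"
proof -
  define j where "j p = {A. \<exists>U. openin T U \<and> p \<in> U \<and> \<iota> -` U \<subseteq> A}" for p
  have cpt: "compact_space T" and haus: "Hausdorff_space T"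
    and emb: "embedding_map (discrete_topology UNIV) T \<iota>"
    and dense: "T closure_of (range \<iota>) = topspace T"
    using assms by (auto simp: compactification_def)
  have inj: "inj_on j (topspace T)"
  proof (rule inj_onI, rule ccontr)
    fix p q assume pq: "p \<in> topspace T" "q \<in> topspace T" "j p = j q" "p \<noteq> q"
    obtain U V where UV: "openin T U" "openin T V" "p \<in> U" "q \<in> V" "disjnt U V"
      using haus pq(1,2,4) unfolding Hausdorff_space_def by blast
    have "\<iota> -` U \<in> j p" using UV by (auto simp: j_def)
    then have "\<iota> -` U \<in> j q" using pq(3) by simp
    then obtain W where W: "openin T W" "q \<in> W" "\<iota> -` W \<subseteq> \<iota> -` U"
      unfolding j_def by blast
    have "openin T (W \<inter> V)" "q \<in> W \<inter> V" using W UV by auto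
    moreover have "q \<in> T closure_of (range \<iota>)" using dense pq by simp
    ultimately obtain y where "\<iota> y \<in> W \<inter> V" by (auto simp: in_closure_of)
    with W UV show False by (auto simp: disjnt_def)
  qed
  define k where "k = inv_into (topspace T) j"
  define T' where "T' = pullback_topology (j ` topspace T) k T"
  have kj: "k (j p) = p" if "p \<in> topspace T" for p using inj that by (simp add: k_def)
  have top': "topspace T' = j ` topspace T"
    by (auto simp: T'_def topspace_pullback_topology kj)
  have open': "openin T' S \<longleftrightarrow> (\<exists>U. openin T U \<and> S = j ` U)" for S
  proof -
    have "k -` U \<inter> j ` topspace T = j ` U" if "openin T U" for U
      using openin_subset[OF that] by (auto simp: kj subset_eq image_iff)
    then show ?thesis unfolding T'_def openin_pullback_topology by metis
  qed
  have hom: "homeomorphic_map T T' j"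
  proof (rule bijective_open_imp_homeomorphic_map)
    show "continuous_map T T' j"
    proof (unfold continuous_map_def, intro conjI allI impI)
      show "j \<in> topspace T \<rightarrow> topspace T'" by (auto simp: top')
      fix S assume "openin T' S"
      then obtain U where U: "openin T U" "S = j ` U" using open' by auto
      have "{x \<in> topspace T. j x \<in> S} = U"
        using openin_subset[OF U(1)] U(2) inj by (auto simp: inj_on_def subset_eq)
      then show "openin T {x \<in> topspace T. j x \<in> S}" using U by simp
    qed
    show "open_map T T' j" by (auto simp: open_map_def open')
  qed (use inj top' in auto)
  have comp: "compactification T' (j \<circ> \<iota>)"
    unfolding compactification_def
  proof (intro conjI)
    have hs: "T homeomorphic_space T'" using hom homeomorphic_map_imp_homeomorphic_space by blast
    show "compact_space T'" using hs cpt homeomorphic_compact_space by blast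
    show "Hausdorff_space T'" using hs haus homeomorphic_Hausdorff_space by blast
    show "embedding_map (discrete_topology UNIV) T' (j \<circ> \<iota>)"
      using embedding_map_compose[OF emb] hom surjective_embedding_map by blast
    have sub: "range \<iota> \<subseteq> topspace T"
      using compactification_range[OF assms] .
    show "T' closure_of range (j \<circ> \<iota>) = topspace T'"
      using homeomorphic_map_closure_of[OF hom sub] dense top' by (simp add: image_comp)
  qed
  show ?thesis using that hom comp by blast
qed

lemma martin_compactification_least:
  fixes T' :: "'n topology" and \<iota>' :: "'s \<Rightarrow> 'n"
  assumes "martin_compactification P x\<^sub>0 T \<iota>" "compactification T' \<iota>'" "martin_kernel_extends P x\<^sub>0 T' \<iota>'"
  obtains h where "continuous_map T' T h" "\<And>y. h (\<iota>' y) = \<iota> y"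
proof -
  obtain T2 :: "'s set set topology" and j where j: "homeomorphic_map T' T2 j" "compactification T2 (j \<circ> \<iota>')"
    using compactification_transfer[OF assms(2)] by blast
  obtain k where k: "homeomorphic_maps T' T2 j k" using j homeomorphic_map_maps by blast
  have sub: "\<iota>' y \<in> topspace T'" for y
    using compactification_range[OF assms(2)] by blast
  have "martin_kernel_extends P x\<^sub>0 T2 (j \<circ> \<iota>')"
    unfolding martin_kernel_extends_def
  proof
    fix x
    obtain g where g: "continuous_map T' euclideanreal g" "\<And>y. g (\<iota>' y) = martin_kernel P x\<^sub>0 x y"
      using assms(3) by (auto simp: martin_kernel_extends_def)
    have "continuous_map T2 euclideanreal (g \<circ> k)"
      using k g continuous_map_compose by (auto simp: homeomorphic_maps_def)
    moreover have "(g \<circ> k) ((j \<circ> \<iota>') y) = martin_kernel P x\<^sub>0 x y" for y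
      using k g sub by (simp add: homeomorphic_maps_def)
    ultimately show "\<exists>g. continuous_map T2 euclideanreal g \<and>
        (\<forall>y. g ((j \<circ> \<iota>') y) = martin_kernel P x\<^sub>0 x y)" by blast
  qed
  with assms(1) j obtain h where h: "continuous_map T2 T h" "\<And>y. h ((j \<circ> \<iota>') y) = \<iota> y"
    unfolding martin_compactification_def by blast
  have "continuous_map T' T (h \<circ> j)"
    using h j continuous_map_compose homeomorphic_imp_continuous_map by blast
  then show ?thesis using that[of "h \<circ> j"] h by simp
qed

section \<open>Measures on the compactification\<close>

definition borel_of :: "'m topology \<Rightarrow> 'm measure" where
  "borel_of T = sigma (topspace T) {U. openin T U}"

definition configuration_measure :: "'m topology \<Rightarrow> ('s \<Rightarrow> 'm) \<Rightarrow> 's multiset \<Rightarrow> 'm measure" where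
  "configuration_measure T \<iota> B =
     distr (density (count_space UNIV) (\<lambda>x. of_nat (count B x))) (borel_of T) \<iota>"

definition weakly_converges :: "'m topology \<Rightarrow> (nat \<Rightarrow> 'm measure) \<Rightarrow> 'm measure \<Rightarrow> bool" where
  "weakly_converges T \<nu> \<nu>' \<longleftrightarrow>
     (\<forall>f. continuous_map T euclideanreal f \<longrightarrow>
        (\<lambda>n. integral\<^sup>L (\<nu> n) f) \<longlonglongrightarrow> integral\<^sup>L \<nu>' f)"

definition random_measure :: "'w measure \<Rightarrow> 'm measure \<Rightarrow> ('w \<Rightarrow> 'm measure) \<Rightarrow> bool" where
  "random_measure M N W \<longleftrightarrow>
     (\<forall>\<omega>\<in>space M. finite_measure (W \<omega>) \<and> sets (W \<omega>) = sets N) \<and>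
     (\<forall>A\<in>sets N. (\<lambda>\<omega>. emeasure (W \<omega>) A) \<in> borel_measurable M)"

text \<open>
  The limit of the path in the compactification.  The value on paths without a limit (a null event
  for a transient irreducible chain) only serves to make this a total random variable.
\<close>

definition limit_point :: "'m topology \<Rightarrow> ('s \<Rightarrow> 'm) \<Rightarrow> (nat \<Rightarrow> 'w \<Rightarrow> 's) \<Rightarrow> 'w \<Rightarrow> 'm" where
  "limit_point T \<iota> X \<omega> =
     (if \<exists>l. limitin T (\<lambda>n. \<iota> (X n \<omega>)) l sequentially
      then THE l. limitin T (\<lambda>n. \<iota> (X n \<omega>)) l sequentially
      else \<iota> (X 0 \<omega>))"

definition martin_boundary :: "'m topology \<Rightarrow> ('s \<Rightarrow> 'm) \<Rightarrow> 'm set" where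
  "martin_boundary T \<iota> = topspace T - range \<iota>"

text \<open>
  The support of the law of the limit point of the chain \<open>X\<close> on the probability space \<open>N\<close>.  The
  outer intersection with the boundary makes this a subset of the boundary by definition, even if
  the family were empty.
\<close>

definition harmonic_boundary ::
  "'m topology \<Rightarrow> ('s \<Rightarrow> 'm) \<Rightarrow> 'w measure \<Rightarrow> (nat \<Rightarrow> 'w \<Rightarrow> 's) \<Rightarrow> 'm set" where
  "harmonic_boundary T \<iota> N X =
     martin_boundary T \<iota> \<inter>
     \<Inter>{F. closedin T F \<and> F \<subseteq> martin_boundary T \<iota> \<and>
         measure N {\<omega> \<in> space N. limit_point T \<iota> X \<omega> \<in> F} = 1}"

end

theory Submission
  imports Defs
begin

text \<open>
  Write \<open>Z\<^sub>n(f) = m\<^sup>-\<^sup>n \<Sum>\<^sub>x B\<^sub>n(x) f(x)\<close>. If \<open>f\<close> is superharmonic and nonnegative, \<open>Z\<^sub>n(f)\<close> is a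
  supermartingale with mean \<open>E f(X\<^sub>n)\<close>. For a continuous \<open>f\<close> on the Martin compactification let \<open>h\<close>
  be the harmonic function \<open>E\<^sub>x f(X\<^sub>\<infinity>)\<close>; then \<open>(f - h)(X\<^sub>n) \<rightarrow> 0\<close> almost surely, so the chain
  eventually leaves \<open>A = {\<bar>f - h\<bar> > \<epsilon>}\<close>, and the hitting probability \<open>q\<close> of \<open>A\<close> is a superharmonic
  majorant of the indicator of \<open>A\<close> with \<open>E q(X\<^sub>n) \<rightarrow> 0\<close>. Hence \<open>Z\<^sub>n(q) \<rightarrow> 0\<close>, and \<open>Z\<^sub>n(f)\<close> has the
  limit of the martingale \<open>Z\<^sub>n(h)\<close>. The \<open>L log L\<close> condition enters only through \<open>E lim Z\<^sub>n(1) = 1\<close>,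
  which makes \<open>E lim Z\<^sub>n(f) = E f(X\<^sub>\<infinity>)\<close>. That \<open>X\<^sub>n\<close> converges is Hunt's argument: the path reversed
  from its last exit from a finite set is a killed Markov chain for which the Martin kernels are
  superharmonic, so Dubins' inequality bounds their upcrossings.
\<close>

section \<open>Upcrossings along weighted paths\<close>

text \<open>The obstacle lies between one path and all particles. If the chain eventually leaves
  \<open>A\<close>, then the mean of \<open>Z_n(1_A)\<close> tends to 0, but this gives convergence
  in mean only. The hitting probability repairs this: because \<open>q\<close> is superharmonic,
  \<open>Z_n(q)\<close> is a nonnegative supermartingale and converges almost surely, so its limit
  must be 0. The walk and the chain live on unrelated probability spaces; the link between them is
  the first moment identity.

  A second obstacle is that one null set has to serve all continuous \<open>f\<close>. The
  compactification is given by a universal property and carries no metric, so it is realised as a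
  compact subset of a countable cube. There countably many monomials in the coordinates decide
  convergence for every continuous function, by the Stone-Weierstrass theorem, and a space-filling
  curve reduces the existence of the limit measure to Helly's theorem on the line.\<close>

text \<open>The flag records whether a value \<open>\<le> a\<close> has been seen since the last completed upcrossing.\<close>

fun upcross :: "'a::linorder \<Rightarrow> 'a \<Rightarrow> bool \<Rightarrow> nat \<Rightarrow> 'a list \<Rightarrow> bool" where
  "upcross a b False 0 xs = True"
| "upcross a b False (Suc k) [] = False"
| "upcross a b False (Suc k) (x # xs) =
     (if x \<le> a then upcross a b True k xs else upcross a b False (Suc k) xs)"
| "upcross a b True k [] = False"
| "upcross a b True k (x # xs) =
     (if b \<le> x then upcross a b False k xs else upcross a b True k xs)"

lemma upcross_Suc: "upcross a b False (Suc k) xs \<Longrightarrow> upcross a b False k xs"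
  and upcross_True_Suc: "upcross a b True (Suc k) xs \<Longrightarrow> upcross a b True k xs"
proof (induction xs arbitrary: k)
  case Nil
  { case 1 then show ?case by simp }
  { case 2 then show ?case by simp }
next
  case (Cons x xs)
  { case 1 then show ?case using Cons by (cases k) (auto split: if_splits) }
  { case 2 then show ?case using Cons by (auto split: if_splits) }
qed

text \<open>Under flag \<open>True\<close> the counter does not include the upcrossing in progress.
  So \<open>True, k\<close> asks for less than \<open>False, Suc k\<close> and for more than
  \<open>False, k\<close>; with this order a change of flag at the head of a list does no
  harm.\<close>

lemma upcross_False_imp_True: "a < b \<Longrightarrow> upcross a b False (Suc k) xs \<Longrightarrow> upcross a b True k xs"
proof (induction xs arbitrary: k)
  case (Cons x xs)
  then show ?case by (auto split: if_splits dest: upcross_Suc)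
qed simp

lemma upcross_True_imp_False: "a < b \<Longrightarrow> upcross a b True k xs \<Longrightarrow> upcross a b False k xs"
proof (induction xs arbitrary: k)
  case (Cons x xs)
  then show ?case
    by (cases k) (auto split: if_splits dest: upcross_Suc upcross_True_Suc)
qed simp

lemma upcross_Cons:
  assumes "a < b" "upcross a b md k xs"
  shows "upcross a b md k (x # xs)"
proof (cases md)
  case True
  with assms show ?thesis by (auto dest: upcross_True_imp_False)
next
  case False
  with assms show ?thesis by (cases k) (auto dest: upcross_False_imp_True)
qed

lemma upcross_append:
  assumes "a < b" "upcross a b md k ys"
  shows "upcross a b md k (xs @ ys)"
  by (induction xs) (auto simp: assms upcross_Cons)

lemma upcross_append_right: "upcross a b md k xs \<Longrightarrow> upcross a b md k (xs @ ys)"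
proof (induction a b md k xs rule: upcross.induct)
  case (1 a b xs)
  then show ?case by simp
qed auto

lemma ex_upcross_map:
  assumes "a < b" "\<And>n. \<exists>i\<ge>n. s i \<le> a" "\<And>n. \<exists>i\<ge>n. b \<le> s i"
  shows "\<exists>n. upcross a b False k (map s [m..<n])"
    and "\<exists>n. upcross a b True k (map s [m..<n])"
proof (induction k arbitrary: m)
  case 0
  { case 1 show ?case by simp }
  { case 2
    obtain i where i: "i \<ge> m" "b \<le> s i" using assms(3) by blast
    have "[m..<Suc i] = [m..<i] @ [i]" using i by simp
    moreover have "upcross a b True 0 (map s [i])" using i by simp
    ultimately have "upcross a b True 0 (map s [m..<Suc i])"
      using upcross_append[OF assms(1)] by (metis map_append)
    then show ?case by blast }
next
  case (Suc k)
  have F: "\<exists>n. upcross a b False (Suc k) (map s [m..<n])" for m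
  proof -
    obtain i where i: "i \<ge> m" "s i \<le> a" using assms(2) by blast
    obtain n where n: "upcross a b True k (map s [Suc i..<n])" using Suc by blast
    have "n > i" using n by (cases "n > i") auto
    then have "[m..<n] = [m..<i] @ i # [Suc i..<n]"
      using i by (metis le_add_diff_inverse less_imp_le upt_add_eq_append upt_conv_Cons)
    moreover have "upcross a b False (Suc k) (map s (i # [Suc i..<n]))" using i n by simp
    ultimately have "upcross a b False (Suc k) (map s [m..<n])"
      using upcross_append[OF assms(1)] by (metis map_append)
    then show ?thesis by blast
  qed
  { case 1 show ?case by (rule F) }
  { case 2
    obtain i where i: "i \<ge> m" "b \<le> s i" using assms(3) by blast
    obtain n where n: "upcross a b False (Suc k) (map s [Suc i..<n])" using F by blast
    have "n > i" using n by (cases "n > i") auto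
    then have "[m..<n] = [m..<i] @ i # [Suc i..<n]"
      using i by (metis le_add_diff_inverse less_imp_le upt_add_eq_append upt_conv_Cons)
    moreover have "upcross a b True (Suc k) (map s (i # [Suc i..<n]))" using i n by simp
    ultimately have "upcross a b True (Suc k) (map s [m..<n])"
      using upcross_append[OF assms(1)] by (metis map_append)
    then show ?case by blast }
qed

lemma upcross_rev_mono:
  assumes "a < b" "upcross a b md k (rev (map s [0..<n]))" "n \<le> m"
  shows "upcross a b md k (rev (map s [0..<m]))"
proof -
  have "rev (map s [0..<m]) = rev (map s [n..<m]) @ rev (map s [0..<n])"
    using upt_add_eq_append[of 0 n "m - n"] assms(3) by (simp flip: rev_append map_append)
  then show ?thesis using upcross_append[OF assms(1,2)] by metis
qed

text \<open>A reversed prefix grows at its head, so a further upcrossing is built backwards: a later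
  index with value \<ge> \<open>b\<close> is put in front, and then a still later one with value
  \<le> \<open>a\<close>.\<close>

lemma ex_upcross_rev_map:
  assumes "a < b" "\<And>n. \<exists>i\<ge>n. s i \<le> a" "\<And>n. \<exists>i\<ge>n. b \<le> s i"
  shows "\<exists>n. upcross a b False k (rev (map s [0..<n]))"
proof (induction k)
  case (Suc k)
  then obtain n where n: "upcross a b False k (rev (map s [0..<n]))" by blast
  obtain i where i: "i \<ge> n" "b \<le> s i" using assms(3) by blast
  have "upcross a b False k (rev (map s [0..<i]))"
    using upcross_rev_mono[OF assms(1) n i(1)] .
  then have "upcross a b True k (rev (map s [0..<Suc i]))" using i by simp
  moreover obtain j where j: "j \<ge> Suc i" "s j \<le> a" using assms(2) by blast
  ultimately have "upcross a b True k (rev (map s [0..<j]))"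
    using upcross_rev_mono[OF assms(1)] by blast
  then have "upcross a b False (Suc k) (rev (map s [0..<Suc j]))" using j by simp
  then show ?case by blast
qed simp

section \<open>Dubins' inequality for weighted lists\<close>

lemma nn_integral_list_count_space:
  fixes f :: "'b list \<Rightarrow> ennreal"
  shows "(\<integral>\<^sup>+l. f l \<partial>count_space UNIV) =
    f [] + (\<integral>\<^sup>+y. \<integral>\<^sup>+ys. f (y # ys) \<partial>count_space UNIV \<partial>count_space UNIV)"
proof -
  have "(\<integral>\<^sup>+l. f l \<partial>count_space UNIV) =
    (\<integral>\<^sup>+l. f l * indicator {[]} l + f l * indicator (- {[]}) l \<partial>count_space UNIV)"
    by (intro nn_integral_cong) (auto split: split_indicator)
  also have "\<dots> = (\<integral>\<^sup>+l. f l * indicator {[]} l \<partial>count_space UNIV) +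
      (\<integral>\<^sup>+l. f l * indicator (- {[]}) l \<partial>count_space UNIV)"
    by (rule nn_integral_add) auto
  also have "(\<integral>\<^sup>+l. f l * indicator {[]} l \<partial>count_space UNIV) = f []"
    by (subst nn_integral_indicator_singleton) auto
  also have "(\<integral>\<^sup>+l. f l * indicator (- {[]}) l \<partial>count_space UNIV) =
     (\<integral>\<^sup>+l. f l \<partial>count_space (- {[]}))"
    by (simp add: nn_integral_count_space_indicator)
  also have "\<dots> = (\<integral>\<^sup>+p. f (case p of (y, ys) \<Rightarrow> y # ys) \<partial>count_space UNIV)"
  proof (rule nn_integral_bij_count_space[symmetric])
    show "bij_betw (\<lambda>p. case p of (y, ys) \<Rightarrow> y # ys) UNIV (- {[]})"
      by (rule bij_betw_byWitness[where f' = "\<lambda>l. (hd l, tl l)"]) auto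
  qed
  also have "\<dots> = (\<integral>\<^sup>+y. \<integral>\<^sup>+ys. f (y # ys) \<partial>count_space UNIV \<partial>count_space UNIV)"
    by (subst nn_integral_fst_count_space[symmetric]) simp
  finally show ?thesis .
qed

text \<open>Mass of the trajectory that starts in \<open>y\<close> at time \<open>n\<close>, runs
  through the list and is killed in its last state. Summing over all lists sums over all lifetimes.
  The time index allows a chain to be stopped at a fixed horizon.\<close>

fun path_weight :: "(nat \<Rightarrow> 'b \<Rightarrow> 'b \<Rightarrow> ennreal) \<Rightarrow> (nat \<Rightarrow> 'b \<Rightarrow> ennreal) \<Rightarrow> nat \<Rightarrow> 'b \<Rightarrow> 'b list \<Rightarrow> ennreal" where
  "path_weight q \<kappa> n y [] = \<kappa> n y"
| "path_weight q \<kappa> n y (z # zs) = q n y z * path_weight q \<kappa> (Suc n) z zs"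

text \<open>The observable may depend on time because the branching walk is normalised by a power of
  the mean.\<close>

fun vals :: "(nat \<Rightarrow> 'b \<Rightarrow> 'c) \<Rightarrow> nat \<Rightarrow> 'b list \<Rightarrow> 'c list" where
  "vals v n [] = []"
| "vals v n (y # ys) = v n y # vals v (Suc n) ys"

lemma vals_const: "vals (\<lambda>_. v) n ys = map v ys"
  by (induction ys arbitrary: n) auto

lemma vals_map_upt: "vals v n (map X [n..<m]) = map (\<lambda>i. v i (X i)) [n..<m]"
proof (induction "m - n" arbitrary: n)
  case (Suc d)
  then have "n < m" by simp
  with Suc show ?case by (simp add: upt_conv_Cons)
qed simp

text \<open>The killing \<open>\<kappa>\<close> has two uses: it stops a forward chain at a fixed time, and it is the genuine
  killing, at the starting point, of a chain reversed from a last exit.\<close>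

lemma dubins_upcrossing:
  fixes q :: "nat \<Rightarrow> 'b \<Rightarrow> 'b \<Rightarrow> ennreal"
  assumes sub: "\<And>n y. \<kappa> n y + (\<integral>\<^sup>+z. q n y z \<partial>count_space UNIV) \<le> 1"
    and super: "\<And>n y. (\<integral>\<^sup>+z. q n y z * v (Suc n) z \<partial>count_space UNIV) \<le> v n y"
    and ab: "a < b" "b < \<infinity>"
  shows "(\<integral>\<^sup>+ys. of_bool (upcross a b False k (vals v n (y # ys))) * path_weight q \<kappa> n y ys \<partial>count_space UNIV)
    \<le> (a / b) ^ k"
proof -
  \<comment> \<open>Truncating the length turns the sum over lists into a recursion in
    \<open>N\<close>, in which \<open>FS\<close> splits off the first state.\<close>
  define F where "F N md k n y = (\<integral>\<^sup>+ys. of_bool (length ys < N \<and> upcross a b md k (vals v n (y # ys))) *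
    path_weight q \<kappa> n y ys \<partial>count_space UNIV)" for N md k n y
  have b0: "b \<noteq> 0" "b \<noteq> \<top>" using ab by auto
  have F0: "F 0 md k n y = 0" for md k n y by (simp add: F_def)
  have FS: "F (Suc N) md k n y = of_bool (upcross a b md' k' []) * \<kappa> n y +
     (\<integral>\<^sup>+z. q n y z * F N md' k' (Suc n) z \<partial>count_space UNIV)"
    if "\<And>xs. upcross a b md k (v n y # xs) = upcross a b md' k' xs" for N md k n y md' k'
  proof -
    have *: "(of_bool P * (c * d) :: ennreal) = c * (of_bool P * d)" for P c d
      by (simp add: ac_simps)
    show ?thesis
      unfolding F_def
      by (subst nn_integral_list_count_space) (simp add: that * nn_integral_cmult)
  qed
  have sub': "of_bool P * \<kappa> n y + (\<integral>\<^sup>+z. q n y z * c z \<partial>count_space UNIV) \<le> d"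
    if "\<And>z. c z \<le> d" "P \<Longrightarrow> d \<ge> 1" for n y c d P
  proof -
    have "of_bool P * \<kappa> n y + (\<integral>\<^sup>+z. q n y z * c z \<partial>count_space UNIV) \<le>
        d * \<kappa> n y + (\<integral>\<^sup>+z. q n y z * d \<partial>count_space UNIV)"
      using that by (intro add_mono mult_mono nn_integral_mono) auto
    also have "\<dots> = d * (\<kappa> n y + (\<integral>\<^sup>+z. q n y z \<partial>count_space UNIV))"
      by (subst nn_integral_multc) (simp_all add: distrib_left mult.commute[of _ d])
    also have "\<dots> \<le> d * 1" by (intro mult_left_mono sub) simp
    finally show ?thesis by simp
  qed
  have super': "(\<integral>\<^sup>+z. q n y z * c z \<partial>count_space UNIV) \<le> v n y / b * d"
    if "\<And>z. c z \<le> v (Suc n) z / b * d" for n y c d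
  proof -
    have "(\<integral>\<^sup>+z. q n y z * c z \<partial>count_space UNIV) \<le>
        (\<integral>\<^sup>+z. (q n y z * v (Suc n) z) * (d / b) \<partial>count_space UNIV)"
    proof (rule nn_integral_mono)
      fix z
      have "q n y z * c z \<le> q n y z * (v (Suc n) z / b * d)" by (intro mult_left_mono that) simp
      then show "q n y z * c z \<le> q n y z * v (Suc n) z * (d / b)"
        by (simp add: divide_ennreal_def ac_simps)
    qed
    also have "\<dots> = (\<integral>\<^sup>+z. q n y z * v (Suc n) z \<partial>count_space UNIV) * (d / b)"
      by (simp add: nn_integral_multc)
    also have "\<dots> \<le> v n y * (d / b)" by (intro mult_right_mono super) simp
    finally show ?thesis by (simp add: divide_ennreal_def ac_simps)
  qed
  \<comment> \<open>From a state with value \<open>v\<close> the level \<open>b\<close> is reached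
    with probability at most \<open>v / b\<close>, and this factor pays for the upcrossing in
    progress. Where the value is at most \<open>a\<close> the factor is at most
    \<open>a / b\<close>, which yields one more power; hence both flags go through one
    induction.\<close>
  have main: "F N False k n y \<le> (a / b) ^ k \<and> F N True k n y \<le> v n y / b * (a / b) ^ k" for N k n y
  proof (induction N arbitrary: k n y)
    case 0
    then show ?case by (simp add: F0)
  next
    case (Suc N)
    have IHF: "F N False k n y \<le> (a / b) ^ k" and IHT: "F N True k n y \<le> v n y / b * (a / b) ^ k"
      for k n y using Suc by auto
    have 1: "F (Suc N) False k n y \<le> (a / b) ^ k"
    proof (cases k)
      case 0
      have "F (Suc N) False k n y = of_bool (upcross a b False 0 []) * \<kappa> n y +
         (\<integral>\<^sup>+z. q n y z * F N False 0 (Suc n) z \<partial>count_space UNIV)"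
        by (rule FS) (simp add: 0)
      also have "\<dots> \<le> 1" using IHF[of 0] by (intro sub') auto
      finally show ?thesis by (simp add: 0)
    next
      case k: (Suc j)
      show ?thesis
      proof (cases "v n y \<le> a")
        case True
        have "F (Suc N) False k n y = of_bool (upcross a b True j []) * \<kappa> n y +
           (\<integral>\<^sup>+z. q n y z * F N True j (Suc n) z \<partial>count_space UNIV)"
          by (rule FS) (simp add: k True)
        also have "\<dots> = (\<integral>\<^sup>+z. q n y z * F N True j (Suc n) z \<partial>count_space UNIV)" by simp
        also have "\<dots> \<le> v n y / b * (a / b) ^ j" by (intro super' IHT)
        also have "\<dots> \<le> a / b * (a / b) ^ j"
          using True by (intro mult_right_mono divide_right_mono_ennreal) auto
        finally show ?thesis by (simp add: k)
      next
        case False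
        have "F (Suc N) False k n y = of_bool (upcross a b False k []) * \<kappa> n y +
           (\<integral>\<^sup>+z. q n y z * F N False k (Suc n) z \<partial>count_space UNIV)"
          by (rule FS) (simp add: k False)
        also have "\<dots> \<le> (a / b) ^ k" by (intro sub' IHF) (simp add: k)
        finally show ?thesis .
      qed
    qed
    have 2: "F (Suc N) True k n y \<le> v n y / b * (a / b) ^ k"
    proof (cases "b \<le> v n y")
      case True
      have "F (Suc N) True k n y = of_bool (upcross a b False k []) * \<kappa> n y +
         (\<integral>\<^sup>+z. q n y z * F N False k (Suc n) z \<partial>count_space UNIV)"
        by (rule FS) (simp add: True)
      \<comment> \<open>A path that ends here has just completed its pending upcrossing. It counts
        only for \<open>k = 0\<close>, and then the bound is 1.\<close>
      also have "\<dots> \<le> (a / b) ^ k" by (intro sub' IHF) (cases k; simp)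
      also have "\<dots> = b / b * (a / b) ^ k" using b0 ennreal_divide_self[of b] by (simp add: less_top)
      also have "\<dots> \<le> v n y / b * (a / b) ^ k"
        using True by (intro mult_right_mono divide_right_mono_ennreal) auto
      finally show ?thesis .
    next
      case False
      have "F (Suc N) True k n y = of_bool (upcross a b True k []) * \<kappa> n y +
         (\<integral>\<^sup>+z. q n y z * F N True k (Suc n) z \<partial>count_space UNIV)"
        by (rule FS) (simp add: False)
      also have "\<dots> = (\<integral>\<^sup>+z. q n y z * F N True k (Suc n) z \<partial>count_space UNIV)" by simp
      also have "\<dots> \<le> v n y / b * (a / b) ^ k" by (intro super' IHT)
      finally show ?thesis .
    qed
    show ?case using 1 2 by blast
  qed
  have "(\<integral>\<^sup>+ys. of_bool (upcross a b False k (vals v n (y # ys))) * path_weight q \<kappa> n y ys \<partial>count_space UNIV) =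
    (\<integral>\<^sup>+ys. (SUP N. of_bool (length ys < N \<and> upcross a b False k (vals v n (y # ys))) * path_weight q \<kappa> n y ys) \<partial>count_space UNIV)"
  proof (rule nn_integral_cong)
    fix ys :: "'b list"
    show "of_bool (upcross a b False k (vals v n (y # ys))) * path_weight q \<kappa> n y ys =
      (SUP N. of_bool (length ys < N \<and> upcross a b False k (vals v n (y # ys))) * path_weight q \<kappa> n y ys)"
    proof (rule antisym)
      show "of_bool (upcross a b False k (vals v n (y # ys))) * path_weight q \<kappa> n y ys \<le>
        (SUP N. of_bool (length ys < N \<and> upcross a b False k (vals v n (y # ys))) * path_weight q \<kappa> n y ys)"
        by (rule SUP_upper2[where i = "Suc (length ys)"]) auto
    qed (auto intro!: SUP_least)
  qed
  also have "\<dots> = (SUP N. F N False k n y)"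
    unfolding F_def
    by (intro nn_integral_monotone_convergence_SUP) (auto simp: incseq_def le_fun_def)
  also have "\<dots> \<le> (a / b) ^ k" by (intro SUP_least) (simp add: main)
  finally show ?thesis .
qed

section \<open>Markov chains on countable state spaces\<close>

lemma ennreal_of_rat_dense:
  fixes u w :: ennreal
  assumes "u < w"
  obtains r :: rat where "0 \<le> r" "u < ennreal (of_rat r)" "ennreal (of_rat r) < w"
proof -
  obtain c where c: "u < c" "c < w" using assms by (meson dense)
  obtain d where d: "c < d" "d < w" using c by (meson dense)
  have "c \<noteq> \<top>" "d \<noteq> \<top>" using c d by (auto simp: less_top[symmetric] intro: less_le_trans order_less_trans)
  then obtain c' d' where cd: "c = ennreal c'" "0 \<le> c'" "d = ennreal d'" "0 \<le> d'"
    by (metis ennreal_cases)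
  then have "c' < d'" using d by (simp add: ennreal_less_iff)
  then obtain r where r: "c' < of_rat r" "of_rat r < d'" using of_rat_dense by blast
  have "(0::real) \<le> of_rat r" using r cd by linarith
  then have "0 \<le> r" by simp
  moreover have "u < ennreal (of_rat r)" using c cd r by (metis ennreal_lessI less_trans order_le_less_trans)
  moreover have "ennreal (of_rat r) < w" using d cd r \<open>(0::real) \<le> of_rat r\<close>
    by (metis ennreal_less_iff less_trans)
  ultimately show ?thesis using that by blast
qed

text \<open>The gap between \<open>liminf\<close> and \<open>limsup\<close> contains two rational
  levels. Rational pairs are countable in number, so the corresponding null sets can be
  united.\<close>

lemma not_convergent_ennreal:
  fixes s :: "nat \<Rightarrow> ennreal"
  assumes "\<nexists>l. s \<longlonglongrightarrow> l"
  obtains p q :: rat where "0 \<le> p" "p < q"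
    "\<And>n. \<exists>i\<ge>n. s i \<le> ennreal (of_rat p)" "\<And>n. \<exists>i\<ge>n. ennreal (of_rat q) \<le> s i"
proof -
  have "liminf s \<noteq> limsup s"
    using assms Liminf_eq_Limsup[of sequentially s "liminf s"] by auto
  then have "liminf s < limsup s" using Liminf_le_Limsup[of sequentially s] by auto
  then obtain p where p: "0 \<le> p" "liminf s < ennreal (of_rat p)" "ennreal (of_rat p) < limsup s"
    by (rule ennreal_of_rat_dense)
  obtain q where q: "0 \<le> q" "ennreal (of_rat p) < ennreal (of_rat q)" "ennreal (of_rat q) < limsup s"
    using p(3) by (rule ennreal_of_rat_dense)
  show ?thesis
  proof
    show "0 \<le> p" by fact
    show "p < q" using p(1) q(2) by (simp add: ennreal_less_iff of_rat_less)
    fix n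
    show "\<exists>i\<ge>n. s i \<le> ennreal (of_rat p)"
    proof (rule ccontr)
      assume "\<not> ?thesis"
      then have "eventually (\<lambda>i. ennreal (of_rat p) \<le> s i) sequentially"
        unfolding eventually_sequentially by (metis linear)
      then have "ennreal (of_rat p) \<le> liminf s" by (rule Liminf_bounded)
      with p show False by simp
    qed
    show "\<exists>i\<ge>n. ennreal (of_rat q) \<le> s i"
    proof (rule ccontr)
      assume "\<not> ?thesis"
      then have "eventually (\<lambda>i. s i \<le> ennreal (of_rat q)) sequentially"
        unfolding eventually_sequentially by (metis linear)
      then have "limsup s \<le> ennreal (of_rat q)" by (rule Limsup_bounded)
      with q show False by simp
    qed
  qed
qed

lemma ennreal_divide_power_tendsto_0:
  fixes a b :: ennreal
  assumes "a < b" "b < \<infinity>"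
  shows "(\<lambda>k. (a / b) ^ k) \<longlonglongrightarrow> 0"
proof -
  obtain a' b' where ab: "a = ennreal a'" "0 \<le> a'" "b = ennreal b'" "0 \<le> b'"
    using assms by (metis ennreal_cases infinity_ennreal_def less_top order_less_trans)
  then have lt: "a' < b'" using assms by (simp add: ennreal_less_iff)
  then have "a / b = ennreal (a' / b')" using ab by (simp add: divide_ennreal)
  moreover have "(\<lambda>k. ennreal ((a' / b') ^ k)) \<longlonglongrightarrow> ennreal 0"
    using ab lt by (intro tendsto_ennrealI LIMSEQ_power_zero) auto
  ultimately show ?thesis using ab lt by (simp add: ennreal_power)
qed

text \<open>Doob's argument for both directions of time: \<open>g = id\<close> for supermartingales,
  \<open>g = rev\<close> for paths read from the end. The bound does not depend on \<open>N\<close>,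
  so it passes to the increasing union over \<open>N\<close>; letting \<open>k\<close> grow then
  excludes infinitely many upcrossings.\<close>

lemma (in prob_space) AE_convergent_upcross:
  fixes s :: "nat \<Rightarrow> 'a \<Rightarrow> ennreal" and g :: "ennreal list \<Rightarrow> ennreal list"
  assumes meas: "\<And>a b k N. a < b \<Longrightarrow> b < \<infinity> \<Longrightarrow>
      {\<omega>\<in>space M. upcross a b False k (g (map (\<lambda>i. s i \<omega>) [0..<Suc N]))} \<in> sets M"
    and le: "\<And>a b k N. a < b \<Longrightarrow> b < \<infinity> \<Longrightarrow>
      emeasure M {\<omega>\<in>space M. upcross a b False k (g (map (\<lambda>i. s i \<omega>) [0..<Suc N]))} \<le> (a / b) ^ k"
    and g: "g = id \<or> g = rev"
  shows "AE \<omega> in M. \<exists>l. (\<lambda>n. s n \<omega>) \<longlonglongrightarrow> l"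
proof -
  have step: "upcross a b False k (g (map t [0..<Suc N]))"
    if "a < b" "upcross a b False k (g (map t [0..<N]))" for a b :: ennreal and k t N
    using g that upcross_Cons[OF that] by (auto intro: upcross_append_right)
  have ex: "\<exists>N. upcross a b False k (g (map t [0..<Suc N]))"
    if "a < b" "\<And>n. \<exists>i\<ge>n. t i \<le> a" "\<And>n. \<exists>i\<ge>n. b \<le> t i" for a b :: ennreal and t k
  proof -
    have "\<exists>N. upcross a b False k (g (map t [0..<N]))"
      using g ex_upcross_map(1)[OF that] ex_upcross_rev_map[OF that] by auto
    then show ?thesis using step[OF that(1)] by blast
  qed
  have cross: "AE \<omega> in M. \<not> (\<forall>k. \<exists>N. upcross a b False k (g (map (\<lambda>i. s i \<omega>) [0..<Suc N])))"
    if ab: "a < b" "b < \<infinity>" for a b :: ennreal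
  proof -
    let ?E = "\<lambda>k N. {\<omega>\<in>space M. upcross a b False k (g (map (\<lambda>i. s i \<omega>) [0..<Suc N]))}"
    have "emeasure M (\<Union>N. ?E k N) \<le> (a / b) ^ k" for k
    proof -
      have "emeasure M (\<Union>N. ?E k N) = (SUP N. emeasure M (?E k N))"
      proof (rule SUP_emeasure_incseq[symmetric])
        show "incseq (?E k)"
          by (rule incseq_SucI) (use step[OF ab(1)] in blast)
      qed (use meas[OF ab] in auto)
      also have "\<dots> \<le> (a / b) ^ k"
        by (intro SUP_least le ab)
      finally show ?thesis .
    qed
    moreover have "emeasure M (\<Inter>k. \<Union>N. ?E k N) \<le> emeasure M (\<Union>N. ?E k N)" for k
      using meas[OF ab] by (intro emeasure_mono) auto
    ultimately have le: "emeasure M (\<Inter>k. \<Union>N. ?E k N) \<le> (a / b) ^ k" for k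
      using order_trans by blast
    have "emeasure M (\<Inter>k. \<Union>N. ?E k N) \<le> 0"
      using le by (intro tendsto_lowerbound[OF ennreal_divide_power_tendsto_0[OF ab]]) auto
    then have "(\<Inter>k. \<Union>N. ?E k N) \<in> null_sets M"
      using meas[OF ab] by (auto simp: null_sets_def)
    then show ?thesis by (rule AE_I') auto
  qed
  have "AE \<omega> in M. \<forall>p q. 0 \<le> p \<longrightarrow> p < q \<longrightarrow>
      \<not> (\<forall>k. \<exists>N. upcross (ennreal (of_rat p)) (ennreal (of_rat q)) False k (g (map (\<lambda>i. s i \<omega>) [0..<Suc N])))"
    unfolding AE_all_countable
    by (intro allI AE_impI cross) (auto simp: ennreal_less_iff of_rat_less)
  then show ?thesis
  proof eventually_elim
    case (elim \<omega>)
    show ?case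
    proof (rule ccontr)
      assume "\<nexists>l. (\<lambda>n. s n \<omega>) \<longlonglongrightarrow> l"
      then obtain p q :: rat where pq: "0 \<le> p" "p < q"
        "\<And>n. \<exists>i\<ge>n. s i \<omega> \<le> ennreal (of_rat p)" "\<And>n. \<exists>i\<ge>n. ennreal (of_rat q) \<le> s i \<omega>"
        by (rule not_convergent_ennreal) blast
      have "ennreal (of_rat p) < ennreal (of_rat q)"
        using pq by (simp add: ennreal_less_iff of_rat_less)
      then have "\<exists>N. upcross (ennreal (of_rat p)) (ennreal (of_rat q)) False k (g (map (\<lambda>i. s i \<omega>) [0..<Suc N]))" for k
        using ex[of _ _ "\<lambda>i. s i \<omega>"] pq by blast
      with elim pq show False by blast
    qed
  qed
qed

section \<open>Discrete histories and the Markov property\<close>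

locale countable_chain =
  fixes M :: "'w measure" and X :: "nat \<Rightarrow> 'w \<Rightarrow> 'b" and K :: "'b \<Rightarrow> 'b pmf" and x :: 'b
  assumes chain: "markov_chain M X K x" and countable_states: "countable (UNIV :: 'b set)"
begin

sublocale prob_space M
  using chain by (simp add: markov_chain_def)

text \<open>On a countable state space the history takes countably many values. Conditioning on it
  becomes a sum over lists, which takes the place of conditional expectations.\<close>

definition path :: "nat \<Rightarrow> 'w \<Rightarrow> 'b list" where
  "path n \<omega> = map (\<lambda>i. X i \<omega>) [0..<Suc n]"

lemma measurable_X [measurable]: "X n \<in> measurable M (count_space UNIV)"
  using chain by (simp add: markov_chain_def)

lemma countable_paths: "countable (UNIV :: 'b list set)"
  using countable_lists[OF countable_states] by simp

lemma path_eq_iff: "path n \<omega> = l \<longleftrightarrow> length l = Suc n \<and> (\<forall>i\<le>n. X i \<omega> = l ! i)"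
  by (auto simp: path_def list_eq_iff_nth_eq less_Suc_eq_le simp del: upt_Suc)

lemma measurable_path [measurable]: "path n \<in> measurable M (count_space UNIV)"
  unfolding measurable_count_space_eq_countable[OF countable_paths]
proof (intro conjI ballI)
  fix l :: "'b list"
  have "path n -` {l} \<inter> space M = {\<omega> \<in> space M. path n \<omega> = l}" by auto
  also have "\<dots> = {\<omega> \<in> space M. length l = Suc n \<and> (\<forall>i\<in>{..n}. X i \<omega> = l ! i)}"
    by (simp add: path_eq_iff Ball_def)
  also have "\<dots> \<in> sets M" by measurable
  finally show "path n -` {l} \<inter> space M \<in> sets M" .
qed simp

lemma measurable_path_comp: "g \<in> measurable (count_space UNIV) N \<Longrightarrow> (\<lambda>\<omega>. g (path n \<omega>)) \<in> measurable M N"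
  by (rule measurable_compose[OF measurable_path])

lemma sets_path: "{\<omega>\<in>space M. Q (path n \<omega>)} \<in> sets M"
  using measurable_path_comp[of Q "count_space UNIV"] by simp

lemma emeasure_path_event: "emeasure M {\<omega>\<in>space M. Q (path n \<omega>)} = (\<integral>\<^sup>+\<omega>. of_bool (Q (path n \<omega>)) \<partial>M)"
proof -
  have "(\<integral>\<^sup>+\<omega>. of_bool (Q (path n \<omega>)) \<partial>M) = (\<integral>\<^sup>+\<omega>. indicator {\<omega>\<in>space M. Q (path n \<omega>)} \<omega> \<partial>M)"
    by (intro nn_integral_cong) (auto split: split_indicator)
  then show ?thesis using sets_path[of Q n] by simp
qed

lemma measurable_X_comp: "g \<in> measurable (count_space UNIV) N \<Longrightarrow> (\<lambda>\<omega>. g (X n \<omega>)) \<in> measurable M N"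
  by (rule measurable_compose[OF measurable_X])

lemma last_path [simp]: "last (path n \<omega>) = X n \<omega>" by (simp add: path_def)
lemma path_Suc: "path (Suc n) \<omega> = path n \<omega> @ [X (Suc n) \<omega>]" by (simp add: path_def)

lemma emeasure_fdd:
  "emeasure M {\<omega>\<in>space M. \<forall>i\<le>n. X i \<omega> = xs i} =
    (if xs 0 = x then \<Prod>i<n. ennreal (pmf (K (xs i)) (xs (Suc i))) else 0)"
  using chain unfolding markov_chain_def
  by (simp add: emeasure_eq_measure prod_ennreal)

lemma emeasure_path_step:
  assumes "length l = Suc n"
  shows "emeasure M {\<omega>\<in>space M. path n \<omega> = l \<and> X (Suc n) \<omega> = y} =
    emeasure M {\<omega>\<in>space M. path n \<omega> = l} * ennreal (pmf (K (last l)) y)"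
proof -
  have l: "(l @ [y]) ! i = l ! i" if "i \<le> n" for i using that assms by (simp add: nth_append)
  have "{\<omega>\<in>space M. path n \<omega> = l \<and> X (Suc n) \<omega> = y} = {\<omega>\<in>space M. \<forall>i\<le>Suc n. X i \<omega> = (l @ [y]) ! i}"
    using assms by (auto simp: path_eq_iff le_Suc_eq nth_append)
  moreover have "{\<omega>\<in>space M. path n \<omega> = l} = {\<omega>\<in>space M. \<forall>i\<le>n. X i \<omega> = (l @ [y]) ! i}"
    using assms by (auto simp: path_eq_iff nth_append)
  moreover have "last l = (l @ [y]) ! n" "y = (l @ [y]) ! Suc n"
    using assms by (cases l rule: rev_cases; auto simp: nth_append)+
  ultimately show ?thesis
    by (simp add: emeasure_fdd[of _ "\<lambda>i. (l @ [y]) ! i"])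
qed

text \<open>The event \<open>E\<close> leaves room for information beyond time \<open>n\<close>,
  such as the next state.\<close>

lemma nn_integral_path:
  fixes f :: "'b list \<Rightarrow> ennreal"
  assumes [measurable]: "E \<in> sets M"
  shows "(\<integral>\<^sup>+\<omega>. f (path n \<omega>) * indicator E \<omega> \<partial>M) = (\<integral>\<^sup>+l. f l * emeasure M {\<omega>\<in>E. path n \<omega> = l} \<partial>count_space UNIV)"
proof -
  have "(\<integral>\<^sup>+\<omega>. f (path n \<omega>) * indicator E \<omega> \<partial>M) =
     (\<integral>\<^sup>+\<omega>. (\<integral>\<^sup>+l. f l * indicator {\<omega>\<in>E. path n \<omega> = l} \<omega> \<partial>count_space UNIV) \<partial>M)"
  proof (rule nn_integral_cong)
    fix \<omega>
    have "(\<integral>\<^sup>+l. f l * indicator {\<omega>\<in>E. path n \<omega> = l} \<omega> \<partial>count_space UNIV) =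
      (\<integral>\<^sup>+l. (f l * indicator E \<omega>) * indicator {path n \<omega>} l \<partial>count_space UNIV)"
      by (intro nn_integral_cong) (auto split: split_indicator)
    also have "\<dots> = f (path n \<omega>) * indicator E \<omega>"
      by (subst nn_integral_indicator_singleton) auto
    finally show "f (path n \<omega>) * indicator E \<omega> = (\<integral>\<^sup>+l. f l * indicator {\<omega>\<in>E. path n \<omega> = l} \<omega> \<partial>count_space UNIV)"
      by simp
  qed
  also have "\<dots> = (\<integral>\<^sup>+l. (\<integral>\<^sup>+\<omega>. f l * indicator {\<omega>\<in>E. path n \<omega> = l} \<omega> \<partial>M) \<partial>count_space UNIV)"
    by (intro nn_integral_count_space_nn_integral countable_paths) measurable
  also have "\<dots> = (\<integral>\<^sup>+l. f l * emeasure M {\<omega>\<in>E. path n \<omega> = l} \<partial>count_space UNIV)"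
    by (intro nn_integral_cong nn_integral_cmult_indicator) measurable
  finally show ?thesis .
qed

lemma nn_integral_path_UNIV:
  fixes f :: "'b list \<Rightarrow> ennreal"
  shows "(\<integral>\<^sup>+\<omega>. f (path n \<omega>) \<partial>M) = (\<integral>\<^sup>+l. f l * emeasure M {\<omega>\<in>space M. path n \<omega> = l} \<partial>count_space UNIV)"
proof -
  have "(\<integral>\<^sup>+\<omega>. f (path n \<omega>) \<partial>M) = (\<integral>\<^sup>+\<omega>. f (path n \<omega>) * indicator (space M) \<omega> \<partial>M)"
    by (intro nn_integral_cong) auto
  then show ?thesis using nn_integral_path[of "space M" f n] by simp
qed

text \<open>Both sides are sums over a history and a next state, and
  \<open>emeasure_path_step\<close> makes the summands equal. \<open>G\<close> sees the whole
  history, so that later inductions can carry along events of the past.\<close>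

lemma markov_property:
  fixes G :: "'b list \<Rightarrow> 'b \<Rightarrow> ennreal"
  shows "(\<integral>\<^sup>+\<omega>. G (path n \<omega>) (X (Suc n) \<omega>) \<partial>M) = (\<integral>\<^sup>+\<omega>. (\<integral>\<^sup>+y. G (path n \<omega>) y \<partial>K (X n \<omega>)) \<partial>M)"
proof -
  have "(\<integral>\<^sup>+\<omega>. G (path n \<omega>) (X (Suc n) \<omega>) \<partial>M) =
     (\<integral>\<^sup>+\<omega>. (\<integral>\<^sup>+y. G (path n \<omega>) y * indicator {\<omega>\<in>space M. X (Suc n) \<omega> = y} \<omega> \<partial>count_space UNIV) \<partial>M)"
  proof (rule nn_integral_cong)
    fix \<omega> assume "\<omega> \<in> space M"
    then have "(\<integral>\<^sup>+y. G (path n \<omega>) y * indicator {\<omega>\<in>space M. X (Suc n) \<omega> = y} \<omega> \<partial>count_space UNIV) =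
      (\<integral>\<^sup>+y. G (path n \<omega>) y * indicator {X (Suc n) \<omega>} y \<partial>count_space UNIV)"
      by (intro nn_integral_cong) (auto split: split_indicator)
    also have "\<dots> = G (path n \<omega>) (X (Suc n) \<omega>)"
      by (subst nn_integral_indicator_singleton) auto
    finally show "G (path n \<omega>) (X (Suc n) \<omega>) = (\<integral>\<^sup>+y. G (path n \<omega>) y * indicator {\<omega>\<in>space M. X (Suc n) \<omega> = y} \<omega> \<partial>count_space UNIV)"
      by simp
  qed
  also have "\<dots> = (\<integral>\<^sup>+y. \<integral>\<^sup>+\<omega>. G (path n \<omega>) y * indicator {\<omega>\<in>space M. X (Suc n) \<omega> = y} \<omega> \<partial>M \<partial>count_space UNIV)"
  proof (rule nn_integral_count_space_nn_integral[OF countable_states])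
    fix y
    have [measurable]: "(\<lambda>\<omega>. G (path n \<omega>) y) \<in> borel_measurable M"
      by (rule measurable_path_comp) simp
    show "(\<lambda>\<omega>. G (path n \<omega>) y * indicator {\<omega>\<in>space M. X (Suc n) \<omega> = y} \<omega>) \<in> borel_measurable M"
      by measurable
  qed
  also have "\<dots> = (\<integral>\<^sup>+y. \<integral>\<^sup>+l. G l y * emeasure M {\<omega>\<in>space M. path n \<omega> = l \<and> X (Suc n) \<omega> = y} \<partial>count_space UNIV \<partial>count_space UNIV)"
  proof (rule nn_integral_cong)
    fix y
    have "{\<omega> \<in> {\<omega> \<in> space M. X (Suc n) \<omega> = y}. path n \<omega> = l} = {\<omega>\<in>space M. path n \<omega> = l \<and> X (Suc n) \<omega> = y}" for l
      by auto
    then show "(\<integral>\<^sup>+\<omega>. G (path n \<omega>) y * indicator {\<omega>\<in>space M. X (Suc n) \<omega> = y} \<omega> \<partial>M) =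
      (\<integral>\<^sup>+l. G l y * emeasure M {\<omega>\<in>space M. path n \<omega> = l \<and> X (Suc n) \<omega> = y} \<partial>count_space UNIV)"
      by (subst nn_integral_path) simp_all
  qed
  also have "\<dots> = (\<integral>\<^sup>+l. \<integral>\<^sup>+y. G l y * emeasure M {\<omega>\<in>space M. path n \<omega> = l \<and> X (Suc n) \<omega> = y} \<partial>count_space UNIV \<partial>count_space UNIV)"
    by (intro nn_integral_count_space_nn_integral countable_paths) simp
  also have "\<dots> = (\<integral>\<^sup>+l. (\<integral>\<^sup>+y. G l y \<partial>K (last l)) * emeasure M {\<omega>\<in>space M. path n \<omega> = l} \<partial>count_space UNIV)"
  proof (rule nn_integral_cong)
    fix l :: "'b list"
    show "(\<integral>\<^sup>+y. G l y * emeasure M {\<omega>\<in>space M. path n \<omega> = l \<and> X (Suc n) \<omega> = y} \<partial>count_space UNIV) =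
      (\<integral>\<^sup>+y. G l y \<partial>K (last l)) * emeasure M {\<omega>\<in>space M. path n \<omega> = l}"
    proof (cases "length l = Suc n")
      case True
      have "(\<integral>\<^sup>+y. G l y * emeasure M {\<omega>\<in>space M. path n \<omega> = l \<and> X (Suc n) \<omega> = y} \<partial>count_space UNIV) =
        (\<integral>\<^sup>+y. (ennreal (pmf (K (last l)) y) * G l y) * emeasure M {\<omega>\<in>space M. path n \<omega> = l} \<partial>count_space UNIV)"
        by (intro nn_integral_cong) (simp add: emeasure_path_step[OF True] mult_ac)
      also have "\<dots> = (\<integral>\<^sup>+y. G l y \<partial>K (last l)) * emeasure M {\<omega>\<in>space M. path n \<omega> = l}"
        by (simp add: nn_integral_multc nn_integral_measure_pmf)
      finally show ?thesis .
    next
      case False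
      then show ?thesis by (simp add: path_eq_iff)
    qed
  qed
  also have "\<dots> = (\<integral>\<^sup>+\<omega>. (\<integral>\<^sup>+y. G (path n \<omega>) y \<partial>K (X n \<omega>)) \<partial>M)"
    using nn_integral_path_UNIV[of "\<lambda>l. \<integral>\<^sup>+y. G l y \<partial>K (last l)" n] by simp
  finally show ?thesis .
qed

lemma nn_integral_next:
  "(\<integral>\<^sup>+\<omega>. f (X (Suc n) \<omega>) \<partial>M) = (\<integral>\<^sup>+\<omega>. (\<integral>\<^sup>+y. f y \<partial>K (X n \<omega>)) \<partial>M)"
  using markov_property[of "\<lambda>_. f" n] .

lemma AE_start: "AE \<omega> in M. X 0 \<omega> = x"
proof (rule AE_I_eq_1)
  show "{\<omega>\<in>space M. X 0 \<omega> = x} \<in> sets M" by measurable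
  show "emeasure M {\<omega>\<in>space M. X 0 \<omega> = x} = 1"
    using emeasure_fdd[of 0 "\<lambda>_. x"] by simp
qed

lemma nn_integral_start: "(\<integral>\<^sup>+\<omega>. f (X 0 \<omega>) \<partial>M) = f x"
proof -
  have "(\<integral>\<^sup>+\<omega>. f (X 0 \<omega>) \<partial>M) = (\<integral>\<^sup>+\<omega>. f x \<partial>M)"
    using AE_start by (intro nn_integral_cong_AE) auto
  then show ?thesis by (simp add: emeasure_space_1)
qed

text \<open>Steps are allowed only before time \<open>N\<close> and killing only at time
  \<open>N\<close>, so the mass sits on the lists that end exactly at \<open>N\<close>.\<close>

lemma path_weight_chain:
  assumes "n \<le> N"
  shows "path_weight (\<lambda>n y z. of_bool (n < N) * ennreal (pmf (K y) z)) (\<lambda>n y. of_bool (n = N)) n y ys =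
    of_bool (n + length ys = N) * (\<Prod>i<length ys. ennreal (pmf (K ((y # ys) ! i)) (ys ! i)))"
  using assms
proof (induction ys arbitrary: n y)
  case (Cons z zs)
  show ?case
  proof (cases "n < N")
    case True
    then show ?thesis using Cons.IH[of "Suc n" z] by (simp add: prod.lessThan_Suc_shift ac_simps del: prod.lessThan_Suc)
  qed simp
qed simp

lemma emeasure_path:
  "emeasure M {\<omega>\<in>space M. path N \<omega> = y # ys} =
     of_bool (y = x) * path_weight (\<lambda>n y z. of_bool (n < N) * ennreal (pmf (K y) z)) (\<lambda>n y. of_bool (n = N)) 0 y ys"
proof (cases "length ys = N")
  case True
  then have "{\<omega>\<in>space M. path N \<omega> = y # ys} = {\<omega>\<in>space M. \<forall>i\<le>N. X i \<omega> = (y # ys) ! i}"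
    by (auto simp: path_eq_iff)
  then show ?thesis by (simp add: emeasure_fdd[of _ "\<lambda>i. (y # ys) ! i"] path_weight_chain True)
qed (simp add: path_weight_chain path_eq_iff)

lemma superharmonic_nn_integral_le:
  fixes v :: "nat \<Rightarrow> 'b \<Rightarrow> ennreal"
  assumes super: "\<And>n y. (\<integral>\<^sup>+z. v (Suc n) z \<partial>K y) \<le> v n y"
  shows "(\<integral>\<^sup>+\<omega>. v n (X n \<omega>) \<partial>M) \<le> v 0 x"
proof (induction n)
  case (Suc n)
  have "(\<integral>\<^sup>+\<omega>. v (Suc n) (X (Suc n) \<omega>) \<partial>M) = (\<integral>\<^sup>+\<omega>. (\<integral>\<^sup>+y. v (Suc n) y \<partial>K (X n \<omega>)) \<partial>M)"
    by (rule nn_integral_next)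
  also have "\<dots> \<le> (\<integral>\<^sup>+\<omega>. v n (X n \<omega>) \<partial>M)" by (intro nn_integral_mono super)
  finally show ?case using Suc by simp
qed (simp add: nn_integral_start)

lemma forward_upcrossing:
  assumes super: "\<And>n y. (\<integral>\<^sup>+z. v (Suc n) z \<partial>K y) \<le> v n y" and ab: "a < b" "b < \<infinity>"
  shows "emeasure M {\<omega>\<in>space M. upcross a b False k (map (\<lambda>i. v i (X i \<omega>)) [0..<Suc N])} \<le> (a / b) ^ k"
proof -
  have eq: "map (\<lambda>i. v i (X i \<omega>)) [0..<Suc N] = vals v 0 (path N \<omega>)" for \<omega>
    unfolding path_def by (rule vals_map_upt[symmetric])
  let ?q = "\<lambda>n y z. of_bool (n < N) * ennreal (pmf (K y) z)" and ?\<kappa> = "\<lambda>n y. of_bool (n = N) :: ennreal"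
  have "emeasure M {\<omega>\<in>space M. upcross a b False k (map (\<lambda>i. v i (X i \<omega>)) [0..<Suc N])} =
     (\<integral>\<^sup>+\<omega>. of_bool (upcross a b False k (vals v 0 (path N \<omega>))) \<partial>M)"
    unfolding eq by (rule emeasure_path_event)
  also have "\<dots> = (\<integral>\<^sup>+l. of_bool (upcross a b False k (vals v 0 l)) * emeasure M {\<omega>\<in>space M. path N \<omega> = l} \<partial>count_space UNIV)"
    by (rule nn_integral_path_UNIV)
  also have "\<dots> = (\<integral>\<^sup>+y. \<integral>\<^sup>+ys. of_bool (upcross a b False k (vals v 0 (y # ys))) * emeasure M {\<omega>\<in>space M. path N \<omega> = y # ys} \<partial>count_space UNIV \<partial>count_space UNIV)"
    by (subst nn_integral_list_count_space) (simp add: path_eq_iff)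
  also have "\<dots> = (\<integral>\<^sup>+y. (\<integral>\<^sup>+ys. of_bool (upcross a b False k (vals v 0 (y # ys))) * path_weight ?q ?\<kappa> 0 y ys \<partial>count_space UNIV) * indicator {x} y \<partial>count_space UNIV)"
    by (intro nn_integral_cong, subst nn_integral_multc[symmetric])
       (auto simp: emeasure_path split: split_indicator intro!: nn_integral_cong)
  also have "\<dots> = (\<integral>\<^sup>+ys. of_bool (upcross a b False k (vals v 0 (x # ys))) * path_weight ?q ?\<kappa> 0 x ys \<partial>count_space UNIV)"
    by (subst nn_integral_indicator_singleton) auto
  also have "\<dots> \<le> (a / b) ^ k"
  proof (rule dubins_upcrossing[OF _ _ ab])
    fix n y
    show "?\<kappa> n y + (\<integral>\<^sup>+z. ?q n y z \<partial>count_space UNIV) \<le> 1"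
      using nn_integral_pmf_eq_1[of "K y"] by simp
    show "(\<integral>\<^sup>+z. ?q n y z * v (Suc n) z \<partial>count_space UNIV) \<le> v n y"
      using super[of y n] by (simp add: nn_integral_measure_pmf)
  qed
  finally show ?thesis .
qed

text \<open>Dubins' inequality gives a limit in \<open>ennreal\<close>. Fatou's lemma, with
  expectations bounded by the value at the start, excludes an infinite one.\<close>

lemma superharmonic_converges:
  assumes super: "\<And>n y. (\<integral>\<^sup>+z. v (Suc n) z \<partial>K y) \<le> v n y" and fin: "v 0 x < \<infinity>"
  shows "AE \<omega> in M. \<exists>l<\<infinity>. (\<lambda>n. v n (X n \<omega>)) \<longlonglongrightarrow> l"
proof -
  have conv: "AE \<omega> in M. \<exists>l. (\<lambda>n. v n (X n \<omega>)) \<longlonglongrightarrow> l"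
  proof (rule AE_convergent_upcross[where g = id])
    fix a b :: ennreal and k N assume ab: "a < b" "b < \<infinity>"
    have eq: "map (\<lambda>i. v i (X i \<omega>)) [0..<Suc N] = vals v 0 (path N \<omega>)" for \<omega>
      unfolding path_def by (rule vals_map_upt[symmetric])
    show "{\<omega>\<in>space M. upcross a b False k (id (map (\<lambda>i. v i (X i \<omega>)) [0..<Suc N]))} \<in> sets M"
      unfolding eq id_def by (rule sets_path)
    show "emeasure M {\<omega>\<in>space M. upcross a b False k (id (map (\<lambda>i. v i (X i \<omega>)) [0..<Suc N]))} \<le> (a / b) ^ k"
      unfolding id_def by (intro forward_upcrossing super ab)
  qed simp
  have [measurable]: "(\<lambda>\<omega>. v n (X n \<omega>)) \<in> borel_measurable M" for n
    by (rule measurable_X_comp) simp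
  have "(\<integral>\<^sup>+\<omega>. liminf (\<lambda>n. v n (X n \<omega>)) \<partial>M) \<le> liminf (\<lambda>n. \<integral>\<^sup>+\<omega>. v n (X n \<omega>) \<partial>M)"
    by (rule nn_integral_liminf) measurable
  also have "\<dots> \<le> v 0 x"
    using superharmonic_nn_integral_le[of v, OF super] 
    by (intro order_trans[OF Liminf_le_Limsup]) (auto intro!: Limsup_bounded)
  also have "\<dots> < \<infinity>" by (rule fin)
  finally have "(\<integral>\<^sup>+\<omega>. liminf (\<lambda>n. v n (X n \<omega>)) \<partial>M) \<noteq> \<infinity>" by simp
  then have "AE \<omega> in M. liminf (\<lambda>n. v n (X n \<omega>)) \<noteq> \<infinity>"
    by (intro nn_integral_noteq_infinite) auto
  with conv show ?thesis
  proof eventually_elim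
    case (elim \<omega>)
    then obtain l where l: "(\<lambda>n. v n (X n \<omega>)) \<longlonglongrightarrow> l" by blast
    then have "liminf (\<lambda>n. v n (X n \<omega>)) = l" by (intro lim_imp_Liminf) auto
    with l elim show ?case by (intro exI[of _ l]) (auto simp: less_top)
  qed
qed

end

section \<open>Hitting probabilities and the Green function\<close>

text \<open>Probability, from \<open>y\<close>, of a visit to \<open>A\<close> at one of the times 0
  to \<open>N\<close>, computed by conditioning on the first step.\<close>

primrec hit :: "('b \<Rightarrow> 'b pmf) \<Rightarrow> 'b set \<Rightarrow> nat \<Rightarrow> 'b \<Rightarrow> ennreal" where
  "hit K A 0 y = indicator A y"
| "hit K A (Suc N) y = (if y \<in> A then 1 else \<integral>\<^sup>+z. hit K A N z \<partial>K y)"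

definition hitting :: "('b \<Rightarrow> 'b pmf) \<Rightarrow> 'b set \<Rightarrow> 'b \<Rightarrow> ennreal" where
  "hitting K A y = (SUP N. hit K A N y)"

lemma hit_Suc_mono: "hit K A N y \<le> hit K A (Suc N) y"
proof (induction N arbitrary: y)
  case (Suc N)
  then show ?case by (auto intro!: nn_integral_mono)
qed (simp split: split_indicator)

lemma incseq_hit: "incseq (\<lambda>N. hit K A N)"
  by (intro incseq_SucI le_funI hit_Suc_mono)

lemma hit_le_1: "hit K A N y \<le> 1"
proof (induction N arbitrary: y)
  case (Suc N)
  have "(\<integral>\<^sup>+z. hit K A N z \<partial>K y) \<le> (\<integral>\<^sup>+z. 1 \<partial>K y)" by (intro nn_integral_mono Suc)
  then show ?case by (simp add: measure_pmf.emeasure_space_1[simplified])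
qed (simp split: split_indicator)

lemma hitting_le_1: "hitting K A y \<le> 1"
  unfolding hitting_def by (intro SUP_least hit_le_1)

lemma hitting_ge_indicator: "indicator A y \<le> hitting K A y"
  unfolding hitting_def by (rule SUP_upper2[of 0]) auto

text \<open>A visit to \<open>A\<close> after the first step is a special case of a visit to
  \<open>A\<close>, and on \<open>A\<close> the right side is already 1.\<close>

lemma nn_integral_hitting:
  fixes K :: "'b \<Rightarrow> 'b pmf"
  shows "(\<integral>\<^sup>+z. hitting K A z \<partial>K y) \<le> hitting K A y"
proof -
  have "(\<integral>\<^sup>+z. hitting K A z \<partial>K y) = (SUP N. \<integral>\<^sup>+z. hit K A N z \<partial>K y)"
    unfolding hitting_def using incseq_hit[of K A]
    by (intro nn_integral_monotone_convergence_SUP) auto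
  also have "\<dots> \<le> hitting K A y"
  proof (rule SUP_least)
    fix N
    have "(\<integral>\<^sup>+z. hit K A N z \<partial>K y) \<le> hit K A (Suc N) y"
    proof (cases "y \<in> A")
      case True
      have "(\<integral>\<^sup>+z. hit K A N z \<partial>K y) \<le> (\<integral>\<^sup>+z. 1 \<partial>K y)" by (intro nn_integral_mono hit_le_1)
      with True show ?thesis by (simp add: measure_pmf.emeasure_space_1[simplified])
    qed simp
    also have "\<dots> \<le> hitting K A y" unfolding hitting_def by (rule SUP_upper) simp
    finally show "(\<integral>\<^sup>+z. hit K A N z \<partial>K y) \<le> hitting K A y" .
  qed
  finally show ?thesis .
qed

lemma step_pmf_Suc': "step_pmf P (Suc n) x = bind_pmf (step_pmf P n x) P"
proof (induction n arbitrary: x)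
  case (Suc n)
  have "step_pmf P (Suc (Suc n)) x = bind_pmf (P x) (\<lambda>y. bind_pmf (step_pmf P n y) P)"
    by (subst step_pmf.simps(2), intro bind_pmf_cong refl Suc)
  also have "\<dots> = bind_pmf (step_pmf P (Suc n) x) P"
    by (simp add: bind_assoc_pmf)
  finally show ?case .
next
  case 0
  have "step_pmf P 0 = return_pmf" by (rule ext) simp
  then show ?case by (simp add: bind_return_pmf bind_return_pmf')
qed

text \<open>The Green function with infinity as a possible value, so that sums can be exchanged
  before finiteness is known.\<close>

definition egreen :: "('s \<Rightarrow> 's pmf) \<Rightarrow> 's \<Rightarrow> 's \<Rightarrow> ennreal" where
  "egreen P x y = (\<Sum>n. ennreal (pmf (step_pmf P n x) y))"

text \<open>The equation \<open>G = I + G P\<close>, with time 0 and the last step split off. It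
  makes the row sums of the reversed chain, killing at \<open>x\<close> included, equal to
  1.\<close>

lemma egreen_step:
  "(\<integral>\<^sup>+z. egreen P x z * ennreal (pmf (P z) y) \<partial>count_space UNIV) + of_bool (x = y) = egreen P x y"
proof -
  have "(\<integral>\<^sup>+z. egreen P x z * ennreal (pmf (P z) y) \<partial>count_space UNIV) =
    (\<integral>\<^sup>+z. (\<Sum>n. ennreal (pmf (step_pmf P n x) z) * ennreal (pmf (P z) y)) \<partial>count_space UNIV)"
    by (simp add: egreen_def)
  also have "\<dots> = (\<Sum>n. \<integral>\<^sup>+z. ennreal (pmf (step_pmf P n x) z) * ennreal (pmf (P z) y) \<partial>count_space UNIV)"
    by (rule nn_integral_suminf) simp
  also have "\<dots> = (\<Sum>n. ennreal (pmf (step_pmf P (Suc n) x) y))"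
    unfolding step_pmf_Suc' ennreal_pmf_bind by (simp add: nn_integral_measure_pmf)
  finally show ?thesis
    unfolding egreen_def
    by (subst (2) suminf_offset[where i = 1]) (auto simp: pmf_return)
qed

lemma egreen_eq_green:
  assumes "transient_chain P"
  shows "egreen P x y = ennreal (green P x y)"
  using assms unfolding egreen_def green_def transient_chain_def
  by (intro suminf_ennreal2) auto

lemma green_nonneg: "transient_chain P \<Longrightarrow> 0 \<le> green P x y"
  unfolding green_def transient_chain_def by (intro suminf_nonneg) auto

lemma green_pos:
  assumes "transient_chain P" "irreducible_chain P"
  shows "0 < green P x y"
proof -
  obtain n where "0 < pmf (step_pmf P n x) y" using assms(2) by (auto simp: irreducible_chain_def)
  then show ?thesis
    unfolding green_def using assms(1) by (intro suminf_pos2) (auto simp: transient_chain_def)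
qed

lemma step_pmf_add: "step_pmf P (m + n) x = bind_pmf (step_pmf P m x) (step_pmf P n)"
proof (induction m arbitrary: x)
  case (Suc m)
  have "step_pmf P (m + n) = (\<lambda>x. bind_pmf (step_pmf P m x) (step_pmf P n))"
    by (rule ext) (rule Suc)
  then show ?case by (simp add: bind_assoc_pmf)
qed (simp add: bind_return_pmf)

lemma pmf_step_add_ge: "pmf (step_pmf P m x) y * pmf (step_pmf P n y) z \<le> pmf (step_pmf P (m + n) x) z"
proof -
  have "ennreal (pmf (step_pmf P m x) y * pmf (step_pmf P n y) z) =
    (\<integral>\<^sup>+w. ennreal (pmf (step_pmf P n w) z) * indicator {y} w \<partial>step_pmf P m x)"
    by (subst nn_integral_indicator_singleton) (auto simp: emeasure_pmf_single ennreal_mult mult.commute)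
  also have "\<dots> \<le> (\<integral>\<^sup>+w. ennreal (pmf (step_pmf P n w) z) \<partial>step_pmf P m x)"
    by (intro nn_integral_mono) (auto split: split_indicator)
  also have "\<dots> = ennreal (pmf (step_pmf P (m + n) x) z)"
    unfolding step_pmf_add ennreal_pmf_bind ..
  finally show ?thesis by simp
qed

text \<open>The visits to \<open>y\<close> include those made after being in \<open>x'\<close> at
  time \<open>k\<close>.\<close>

lemma green_Harnack:
  assumes "transient_chain P"
  shows "pmf (step_pmf P k x) x' * green P x' y \<le> green P x y"
proof -
  have sum: "summable (\<lambda>n. pmf (step_pmf P n z) y)" for z using assms by (simp add: transient_chain_def)
  have "pmf (step_pmf P k x) x' * green P x' y = (\<Sum>n. pmf (step_pmf P k x) x' * pmf (step_pmf P n x') y)"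
    unfolding green_def by (rule suminf_mult[OF sum, symmetric])
  also have "\<dots> \<le> (\<Sum>n. pmf (step_pmf P (n + k) x) y)"
    using pmf_step_add_ge[of P k x x' _ y] 
    by (intro suminf_le summable_mult sum summable_ignore_initial_segment) (auto simp: add.commute)
  also have "\<dots> \<le> green P x y"
    unfolding green_def using suminf_split_initial_segment[OF sum[of x], of k] by (simp add: sum_nonneg)
  finally show ?thesis .
qed

lemma martin_kernel_bound:
  assumes "transient_chain P" "irreducible_chain P"
  obtains c where "0 < c" "\<And>y. 0 \<le> c * martin_kernel P x\<^sub>0 x y" "\<And>y. c * martin_kernel P x\<^sub>0 x y \<le> 1"
proof -
  \<comment> \<open>This positive transition probability serves as \<open>c\<close>: the Harnack
    inequality reads \<open>c * G(x, y) \<le> G(x\<^sub>0, y)\<close>.\<close>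
  obtain k where k: "0 < pmf (step_pmf P k x\<^sub>0) x" using assms(2) by (auto simp: irreducible_chain_def)
  have "0 \<le> pmf (step_pmf P k x\<^sub>0) x * martin_kernel P x\<^sub>0 x y"
    "pmf (step_pmf P k x\<^sub>0) x * martin_kernel P x\<^sub>0 x y \<le> 1" for y
    using green_Harnack[OF assms(1), of k x\<^sub>0 x y] green_pos[OF assms, of x\<^sub>0 y] green_nonneg[OF assms(1), of x y]
    by (auto simp: martin_kernel_def divide_simps)
  with k that show ?thesis by blast
qed

context countable_chain
begin

text \<open>In the induction the weight \<open>\<Phi>\<close> has to absorb the event of being
  outside \<open>A\<close> at time \<open>n\<close>, hence the weight on histories and the
  generalisation over \<open>\<Phi>\<close> and \<open>n\<close>.\<close>

lemma hit_event:
  "(\<integral>\<^sup>+\<omega>. \<Phi> (path n \<omega>) * hit K A N (X n \<omega>) \<partial>M) =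
   (\<integral>\<^sup>+\<omega>. \<Phi> (path n \<omega>) * of_bool (\<exists>k\<in>{n..n+N}. X k \<omega> \<in> A) \<partial>M)"
proof (induction N arbitrary: n \<Phi>)
  case 0
  then show ?case by (intro nn_integral_cong) (auto split: split_indicator)
next
  case (Suc N)
  note [measurable] = measurable_path_comp[of \<Phi> borel]
  have m1 [measurable]: "(\<lambda>\<omega>. f (X n \<omega>)) \<in> borel_measurable M" for f :: "'b \<Rightarrow> ennreal" and n
    by (rule measurable_X_comp) simp
  have m2 [measurable]: "Measurable.pred M (\<lambda>\<omega>. X n \<omega> \<in> A)" for n
    by (rule measurable_X_comp) simp
  have "(\<integral>\<^sup>+\<omega>. \<Phi> (path n \<omega>) * hit K A (Suc N) (X n \<omega>) \<partial>M) =
    (\<integral>\<^sup>+\<omega>. \<Phi> (path n \<omega>) * of_bool (X n \<omega> \<in> A) + (\<integral>\<^sup>+z. \<Phi> (path n \<omega>) * of_bool (X n \<omega> \<notin> A) * hit K A N z \<partial>K (X n \<omega>)) \<partial>M)"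
    by (intro nn_integral_cong) (auto simp: nn_integral_cmult)
  also have "\<dots> = (\<integral>\<^sup>+\<omega>. \<Phi> (path n \<omega>) * of_bool (X n \<omega> \<in> A) \<partial>M) +
     (\<integral>\<^sup>+\<omega>. (\<integral>\<^sup>+z. \<Phi> (path n \<omega>) * of_bool (X n \<omega> \<notin> A) * hit K A N z \<partial>K (X n \<omega>)) \<partial>M)"
  proof (rule nn_integral_add)
    have "(\<lambda>\<omega>. (\<lambda>l. \<integral>\<^sup>+z. \<Phi> l * of_bool (last l \<notin> A) * hit K A N z \<partial>K (last l)) (path n \<omega>)) \<in> borel_measurable M"
      by (rule measurable_path_comp) simp
    then show "(\<lambda>\<omega>. \<integral>\<^sup>+z. \<Phi> (path n \<omega>) * of_bool (X n \<omega> \<notin> A) * hit K A N z \<partial>K (X n \<omega>)) \<in> borel_measurable M"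
      by simp
  qed measurable
  also have "(\<integral>\<^sup>+\<omega>. (\<integral>\<^sup>+z. \<Phi> (path n \<omega>) * of_bool (X n \<omega> \<notin> A) * hit K A N z \<partial>K (X n \<omega>)) \<partial>M) =
    (\<integral>\<^sup>+\<omega>. \<Phi> (path n \<omega>) * of_bool (X n \<omega> \<notin> A) * hit K A N (X (Suc n) \<omega>) \<partial>M)"
    using markov_property[of "\<lambda>l z. \<Phi> l * of_bool (last l \<notin> A) * hit K A N z" n] by simp
  \<comment> \<open>\<open>butlast\<close> recovers the history up to \<open>n\<close> from the one
    up to \<open>Suc n\<close>, at which the induction hypothesis is applied.\<close>
  also have "\<dots> = (\<integral>\<^sup>+\<omega>. \<Phi> (path n \<omega>) * of_bool (X n \<omega> \<notin> A) * of_bool (\<exists>k\<in>{Suc n..Suc n+N}. X k \<omega> \<in> A) \<partial>M)"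
    using Suc[of "\<lambda>l. \<Phi> (butlast l) * of_bool (last (butlast l) \<notin> A)" "Suc n"] by (simp add: path_Suc)
  also have "(\<integral>\<^sup>+\<omega>. \<Phi> (path n \<omega>) * of_bool (X n \<omega> \<in> A) \<partial>M) + \<dots> =
    (\<integral>\<^sup>+\<omega>. \<Phi> (path n \<omega>) * of_bool (X n \<omega> \<in> A) + \<Phi> (path n \<omega>) * of_bool (X n \<omega> \<notin> A) * of_bool (\<exists>k\<in>{Suc n..Suc n+N}. X k \<omega> \<in> A) \<partial>M)"
    by (rule nn_integral_add[symmetric]) measurable
  also have "\<dots> = (\<integral>\<^sup>+\<omega>. \<Phi> (path n \<omega>) * of_bool (\<exists>k\<in>{n..n+Suc N}. X k \<omega> \<in> A) \<partial>M)"
  proof (rule nn_integral_cong)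
    fix \<omega>
    have "{n..n + Suc N} = insert n {Suc n..Suc n + N}" by auto
    then show "\<Phi> (path n \<omega>) * of_bool (X n \<omega> \<in> A) + \<Phi> (path n \<omega>) * of_bool (X n \<omega> \<notin> A) * of_bool (\<exists>k\<in>{Suc n..Suc n+N}. X k \<omega> \<in> A) =
      \<Phi> (path n \<omega>) * of_bool (\<exists>k\<in>{n..n+Suc N}. X k \<omega> \<in> A)"
      by auto
  qed
  finally show ?case .
qed

lemma hitting_event:
  "(\<integral>\<^sup>+\<omega>. \<Phi> (path n \<omega>) * hitting K A (X n \<omega>) \<partial>M) =
   (\<integral>\<^sup>+\<omega>. \<Phi> (path n \<omega>) * of_bool (\<exists>k\<ge>n. X k \<omega> \<in> A) \<partial>M)"
proof -
  note [measurable] = measurable_path_comp[of \<Phi> borel]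
  have [measurable]: "(\<lambda>\<omega>. f (X n \<omega>)) \<in> borel_measurable M" for f :: "'b \<Rightarrow> ennreal" and n
    by (rule measurable_X_comp) simp
  have [measurable]: "Measurable.pred M (\<lambda>\<omega>. X n \<omega> \<in> A)" for n
    by (rule measurable_X_comp) simp
  have "(\<integral>\<^sup>+\<omega>. \<Phi> (path n \<omega>) * hitting K A (X n \<omega>) \<partial>M) =
    (\<integral>\<^sup>+\<omega>. (SUP N. \<Phi> (path n \<omega>) * hit K A N (X n \<omega>)) \<partial>M)"
    by (simp add: hitting_def SUP_mult_left_ennreal)
  also have "\<dots> = (SUP N. \<integral>\<^sup>+\<omega>. \<Phi> (path n \<omega>) * hit K A N (X n \<omega>) \<partial>M)"
    using incseq_hit[of K A]
    by (intro nn_integral_monotone_convergence_SUP) (auto simp: incseq_def le_fun_def intro!: mult_left_mono)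
  also have "\<dots> = (SUP N. \<integral>\<^sup>+\<omega>. \<Phi> (path n \<omega>) * of_bool (\<exists>k\<in>{n..n+N}. X k \<omega> \<in> A) \<partial>M)"
    by (simp only: hit_event)
  also have "\<dots> = (\<integral>\<^sup>+\<omega>. (SUP N. \<Phi> (path n \<omega>) * of_bool (\<exists>k\<in>{n..n+N}. X k \<omega> \<in> A)) \<partial>M)"
  proof (rule nn_integral_monotone_convergence_SUP[symmetric])
    show "incseq (\<lambda>N \<omega>. \<Phi> (path n \<omega>) * of_bool (\<exists>k\<in>{n..n + N}. X k \<omega> \<in> A))"
      unfolding incseq_def le_fun_def by (intro allI impI mult_left_mono) (force simp: le_diff_conv)+
  qed measurable
  also have "\<dots> = (\<integral>\<^sup>+\<omega>. \<Phi> (path n \<omega>) * of_bool (\<exists>k\<ge>n. X k \<omega> \<in> A) \<partial>M)"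
  proof (rule nn_integral_cong)
    fix \<omega>
    have "(SUP N. of_bool (\<exists>k\<in>{n..n+N}. X k \<omega> \<in> A)) = (of_bool (\<exists>k\<ge>n. X k \<omega> \<in> A) :: ennreal)"
    proof (cases "\<exists>k\<ge>n. X k \<omega> \<in> A")
      case True
      then obtain k where "k \<ge> n" "X k \<omega> \<in> A" by blast
      then have "\<exists>j\<in>{n..n+(k-n)}. X j \<omega> \<in> A" by auto
      then have "(SUP N. of_bool (\<exists>k\<in>{n..n+N}. X k \<omega> \<in> A)) \<ge> (1 :: ennreal)"
        by (intro SUP_upper2[of "k - n"]) (simp_all only: of_bool_eq(2) UNIV_I order_refl)
      moreover have "(SUP N. of_bool (\<exists>k\<in>{n..n+N}. X k \<omega> \<in> A)) \<le> (1 :: ennreal)"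
        by (intro SUP_least) simp
      ultimately show ?thesis using True by simp
    qed auto
    then show "(SUP N. \<Phi> (path n \<omega>) * of_bool (\<exists>k\<in>{n..n+N}. X k \<omega> \<in> A)) = \<Phi> (path n \<omega>) * of_bool (\<exists>k\<ge>n. X k \<omega> \<in> A)"
      by (simp add: SUP_mult_left_ennreal[symmetric])
  qed
  finally show ?thesis .
qed

lemma nn_integral_X: "(\<integral>\<^sup>+\<omega>. f (X n \<omega>) \<partial>M) = (\<integral>\<^sup>+y. f y \<partial>step_pmf K n x)"
proof (induction n arbitrary: f)
  case (Suc n)
  have "(\<integral>\<^sup>+\<omega>. f (X (Suc n) \<omega>) \<partial>M) = (\<integral>\<^sup>+y. (\<integral>\<^sup>+z. f z \<partial>K y) \<partial>step_pmf K n x)"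
    using nn_integral_next[of f n] Suc[of "\<lambda>y. \<integral>\<^sup>+z. f z \<partial>K y"] by simp
  also have "\<dots> = (\<integral>\<^sup>+y. f y \<partial>step_pmf K (Suc n) x)"
    unfolding step_pmf_Suc' by (simp add: nn_integral_bind_pmf)
  finally show ?case .
qed (simp add: nn_integral_start)

lemma emeasure_X: "emeasure M {\<omega>\<in>space M. X n \<omega> \<in> A} = emeasure (step_pmf K n x) A"
proof -
  have [measurable]: "Measurable.pred M (\<lambda>\<omega>. X n \<omega> \<in> A)"
    by (rule measurable_X_comp) simp
  have "emeasure M {\<omega>\<in>space M. X n \<omega> \<in> A} = (\<integral>\<^sup>+\<omega>. indicator {\<omega>\<in>space M. X n \<omega> \<in> A} \<omega> \<partial>M)"
    by simp
  also have "\<dots> = (\<integral>\<^sup>+\<omega>. indicator A (X n \<omega>) \<partial>M)"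
    by (intro nn_integral_cong) (auto split: split_indicator)
  finally show ?thesis by (simp add: nn_integral_X)
qed

end

section \<open>Convergence of the Martin kernels along the chain\<close>

context countable_chain
begin

text \<open>Probability of avoiding \<open>V\<close> at all times from 1 on. For \<open>y\<close> in
  \<open>V\<close> it is the probability that the present visit is the last one.\<close>

definition escape :: "'b set \<Rightarrow> 'b \<Rightarrow> ennreal" where
  "escape V y = 1 - (\<integral>\<^sup>+z. hitting K V z \<partial>K y)"

lemma nn_integral_hitting_le_1: "(\<integral>\<^sup>+z. hitting K V z \<partial>K y) \<le> 1"
  by (rule order_trans[OF nn_integral_hitting hitting_le_1])

text \<open>The complement of \<open>hitting_event\<close> one step later. Cancelling in
  \<open>ennreal\<close> needs a finite term, which the bound on \<open>\<Phi>\<close>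
  provides.\<close>

lemma escape_event:
  assumes \<Phi>: "\<And>l. \<Phi> l \<le> (1::ennreal)"
  shows "(\<integral>\<^sup>+\<omega>. \<Phi> (path n \<omega>) * escape V (X n \<omega>) \<partial>M) =
    (\<integral>\<^sup>+\<omega>. \<Phi> (path n \<omega>) * of_bool (\<forall>k>n. X k \<omega> \<notin> V) \<partial>M)"
proof -
  let ?H = "\<lambda>y. \<integral>\<^sup>+z. hitting K V z \<partial>K y"
  note [measurable] = measurable_path_comp[of \<Phi> borel]
  have [measurable]: "(\<lambda>\<omega>. f (X n \<omega>)) \<in> borel_measurable M" for f :: "'b \<Rightarrow> ennreal" and n
    by (rule measurable_X_comp) simp
  have [measurable]: "Measurable.pred M (\<lambda>\<omega>. X n \<omega> \<in> V)" for n
    by (rule measurable_X_comp) simp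
  have h: "(\<integral>\<^sup>+\<omega>. \<Phi> (path n \<omega>) * ?H (X n \<omega>) \<partial>M) = (\<integral>\<^sup>+\<omega>. \<Phi> (path n \<omega>) * of_bool (\<exists>k>n. X k \<omega> \<in> V) \<partial>M)"
  proof -
    have "(\<integral>\<^sup>+\<omega>. \<Phi> (path n \<omega>) * ?H (X n \<omega>) \<partial>M) = (\<integral>\<^sup>+\<omega>. (\<integral>\<^sup>+z. \<Phi> (path n \<omega>) * hitting K V z \<partial>K (X n \<omega>)) \<partial>M)"
      by (simp add: nn_integral_cmult)
    also have "\<dots> = (\<integral>\<^sup>+\<omega>. \<Phi> (path n \<omega>) * hitting K V (X (Suc n) \<omega>) \<partial>M)"
      by (rule markov_property[symmetric])
    also have "\<dots> = (\<integral>\<^sup>+\<omega>. \<Phi> (path n \<omega>) * of_bool (\<exists>k\<ge>Suc n. X k \<omega> \<in> V) \<partial>M)"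
      using hitting_event[of "\<lambda>l. \<Phi> (butlast l)" "Suc n" V] by (simp add: path_Suc)
    finally show ?thesis by (simp add: Suc_le_eq)
  qed
  have 1: "(\<integral>\<^sup>+\<omega>. \<Phi> (path n \<omega>) * ?H (X n \<omega>) \<partial>M) + (\<integral>\<^sup>+\<omega>. \<Phi> (path n \<omega>) * escape V (X n \<omega>) \<partial>M) = (\<integral>\<^sup>+\<omega>. \<Phi> (path n \<omega>) \<partial>M)"
  proof -
    have "?H y + escape V y = 1" for y
      unfolding escape_def by (rule add_diff_inverse_ennreal[OF nn_integral_hitting_le_1])
    then have "\<Phi> (path n \<omega>) * ?H (X n \<omega>) + \<Phi> (path n \<omega>) * escape V (X n \<omega>) = \<Phi> (path n \<omega>)" for \<omega>
      by (metis distrib_left mult.right_neutral)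
    then show ?thesis by (subst nn_integral_add[symmetric]) auto
  qed
  have 2: "(\<integral>\<^sup>+\<omega>. \<Phi> (path n \<omega>) * of_bool (\<exists>k>n. X k \<omega> \<in> V) \<partial>M) + (\<integral>\<^sup>+\<omega>. \<Phi> (path n \<omega>) * of_bool (\<forall>k>n. X k \<omega> \<notin> V) \<partial>M) = (\<integral>\<^sup>+\<omega>. \<Phi> (path n \<omega>) \<partial>M)"
  proof (subst nn_integral_add[symmetric])
    show "(\<integral>\<^sup>+\<omega>. \<Phi> (path n \<omega>) * of_bool (\<exists>k>n. X k \<omega> \<in> V) + \<Phi> (path n \<omega>) * of_bool (\<forall>k>n. X k \<omega> \<notin> V) \<partial>M) = (\<integral>\<^sup>+\<omega>. \<Phi> (path n \<omega>) \<partial>M)"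
      by (intro nn_integral_cong) auto
  qed measurable
  have "(\<integral>\<^sup>+\<omega>. \<Phi> (path n \<omega>) * ?H (X n \<omega>) \<partial>M) \<le> (\<integral>\<^sup>+\<omega>. 1 \<partial>M)"
  proof (rule nn_integral_mono)
    fix \<omega>
    have "\<Phi> (path n \<omega>) * ?H (X n \<omega>) \<le> 1 * 1"
      by (intro mult_mono \<Phi> nn_integral_hitting_le_1) auto
    then show "\<Phi> (path n \<omega>) * ?H (X n \<omega>) \<le> 1" by simp
  qed
  then have "(\<integral>\<^sup>+\<omega>. \<Phi> (path n \<omega>) * ?H (X n \<omega>) \<partial>M) \<noteq> \<top>"
    by (auto simp: emeasure_space_1 top_unique)
  moreover have "(\<integral>\<^sup>+\<omega>. \<Phi> (path n \<omega>) * ?H (X n \<omega>) \<partial>M) + (\<integral>\<^sup>+\<omega>. \<Phi> (path n \<omega>) * escape V (X n \<omega>) \<partial>M) =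
    (\<integral>\<^sup>+\<omega>. \<Phi> (path n \<omega>) * ?H (X n \<omega>) \<partial>M) + (\<integral>\<^sup>+\<omega>. \<Phi> (path n \<omega>) * of_bool (\<forall>k>n. X k \<omega> \<notin> V) \<partial>M)"
    using 1 2 unfolding h by (rule trans[OF _ sym])
  ultimately show ?thesis
    unfolding ennreal_add_left_cancel by simp
qed

text \<open>The expected number of visits is finite, so Borel-Cantelli applies to each of the
  countably many states.\<close>

lemma AE_eventually_neq:
  assumes "\<And>y. egreen K x y < \<infinity>"
  shows "AE \<omega> in M. \<forall>y. eventually (\<lambda>n. X n \<omega> \<noteq> y) sequentially"
proof -
  have "AE \<omega> in M. eventually (\<lambda>n. X n \<omega> \<noteq> y) sequentially" for y
  proof -
    have "AE \<omega> in M. eventually (\<lambda>n. \<omega> \<in> space M - {\<omega>\<in>space M. X n \<omega> \<in> {y}}) sequentially"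
    proof (rule borel_cantelli_AE1)
      show "{\<omega>\<in>space M. X n \<omega> \<in> {y}} \<in> sets M" for n
        using sets_path[of "\<lambda>l. last l \<in> {y}" n] by simp
      show "emeasure M {\<omega>\<in>space M. X n \<omega> \<in> {y}} < \<infinity>" for n by (simp add: less_top[symmetric])
      have "(\<Sum>n. ennreal (pmf (step_pmf K n x) y)) \<noteq> \<top>"
        using assms[of y] by (simp add: egreen_def less_top[symmetric])
      then have "summable (\<lambda>n. pmf (step_pmf K n x) y)"
        by (intro summable_suminf_not_top) auto
      moreover have "measure M {\<omega>\<in>space M. X n \<omega> \<in> {y}} = pmf (step_pmf K n x) y" for n
        using emeasure_X[of n "{y}"] by (simp add: emeasure_eq_measure emeasure_pmf_single measure_pmf.emeasure_eq_measure measure_pmf_single)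
      ultimately show "summable (\<lambda>n. measure M {\<omega>\<in>space M. X n \<omega> \<in> {y}})" by simp
    qed
    then show ?thesis by eventually_elim (auto elim: eventually_mono)
  qed
  then have "AE \<omega> in M. \<forall>y\<in>UNIV. eventually (\<lambda>n. X n \<omega> \<noteq> y) sequentially"
    by (subst AE_ball_countable) (auto simp: countable_states)
  then show ?thesis by simp
qed

section \<open>Hunt's reversal from a last exit\<close>

context
  assumes transient: "\<And>y. egreen K x y < \<infinity>" and irred: "\<And>y. 0 < egreen K x y"
begin

text \<open>Time reversal with respect to the Green measure \<open>G(x, .)\<close>: the mass at
  \<open>y\<close> is distributed over the predecessors \<open>z\<close> in proportion to the
  expected number of steps from \<open>z\<close> to \<open>y\<close>. The share of time 0 becomes
  killing at \<open>x\<close>.\<close>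

definition rev_kernel :: "nat \<Rightarrow> 'b \<Rightarrow> 'b \<Rightarrow> ennreal" where
  "rev_kernel n y z = egreen K x z * ennreal (pmf (K z) y) / egreen K x y"

definition rev_kill :: "nat \<Rightarrow> 'b \<Rightarrow> ennreal" where
  "rev_kill n y = of_bool (x = y) / egreen K x y"

lemma egreen_cancel: "egreen K x y * (c / egreen K x y) = c"
  using transient[of y] irred[of y]
  by (simp add: ennreal_times_divide mult.commute ennreal_mult_divide_eq)

text \<open>The Green factors telescope along the reversed path, and the killing term at
  \<open>x\<close> cancels the last one; what remains is the forward probability.\<close>

lemma rev_path_weight:
  "egreen K x y * path_weight rev_kernel rev_kill n y ys = emeasure M {\<omega>\<in>space M. path (length ys) \<omega> = rev (y # ys)}"
proof (induction ys arbitrary: n y)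
  case Nil
  have "path 0 \<omega> = rev [y] \<longleftrightarrow> (\<forall>i\<le>0. X i \<omega> = y)" for \<omega> by (auto simp: path_def)
  then show ?case
    using emeasure_fdd[of 0 "\<lambda>_. y"] by (auto simp: rev_kill_def egreen_cancel)
next
  case (Cons z zs)
  have "egreen K x y * path_weight rev_kernel rev_kill n y (z # zs) =
     (egreen K x y * (egreen K x z * ennreal (pmf (K z) y) / egreen K x y)) * path_weight rev_kernel rev_kill (Suc n) z zs"
    by (simp add: rev_kernel_def mult.assoc)
  also have "\<dots> = (egreen K x z * path_weight rev_kernel rev_kill (Suc n) z zs) * ennreal (pmf (K z) y)"
    unfolding egreen_cancel by (simp add: ac_simps)
  also have "\<dots> = emeasure M {\<omega>\<in>space M. path (length zs) \<omega> = rev (z # zs)} * ennreal (pmf (K (last (rev (z # zs)))) y)"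
    by (simp add: Cons)
  also have "\<dots> = emeasure M {\<omega>\<in>space M. path (length zs) \<omega> = rev (z # zs) \<and> X (Suc (length zs)) \<omega> = y}"
    by (rule emeasure_path_step[symmetric]) simp
  also have "\<dots> = emeasure M {\<omega>\<in>space M. path (length (z # zs)) \<omega> = rev (y # z # zs)}"
    by (simp add: path_Suc)
  finally show ?case .
qed

lemma rev_kernel_substochastic: "rev_kill n y + (\<integral>\<^sup>+z. rev_kernel n y z \<partial>count_space UNIV) \<le> 1"
proof -
  have "(\<integral>\<^sup>+z. rev_kernel n y z \<partial>count_space UNIV) =
     (\<integral>\<^sup>+z. egreen K x z * ennreal (pmf (K z) y) \<partial>count_space UNIV) / egreen K x y"
    unfolding rev_kernel_def by (rule nn_integral_divide) simp
  then have "rev_kill n y + (\<integral>\<^sup>+z. rev_kernel n y z \<partial>count_space UNIV) =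
      ((\<integral>\<^sup>+z. egreen K x z * ennreal (pmf (K z) y) \<partial>count_space UNIV) + of_bool (x = y)) / egreen K x y"
    unfolding rev_kill_def by (simp add: add_divide_distrib_ennreal add.commute)
  also have "\<dots> = egreen K x y / egreen K x y" by (simp only: egreen_step)
  also have "\<dots> = 1" using irred[of y] transient[of y] by (intro ennreal_divide_self) auto
  finally show ?thesis by simp
qed

text \<open>The summand at \<open>y\<close> is the probability that the last visit to
  \<open>V\<close> takes place in \<open>y\<close>, and last visits at different times are disjoint
  events.\<close>

lemma last_exit_weight:
  "(\<integral>\<^sup>+y. indicator V y * escape V y * egreen K x y \<partial>count_space UNIV) \<le> 1"
proof -
  have [measurable]: "Measurable.pred M (\<lambda>\<omega>. X n \<omega> \<in> V)" for n
    by (rule measurable_X_comp) simp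
  let ?D = "\<lambda>n. {\<omega>\<in>space M. X n \<omega> \<in> V \<and> (\<forall>k>n. X k \<omega> \<notin> V)}"
  have "(\<integral>\<^sup>+y. indicator V y * escape V y * egreen K x y \<partial>count_space UNIV) =
    (\<integral>\<^sup>+y. (\<Sum>n. ennreal (pmf (step_pmf K n x) y) * (indicator V y * escape V y)) \<partial>count_space UNIV)"
    by (simp add: egreen_def mult.commute)
  also have "\<dots> = (\<Sum>n. \<integral>\<^sup>+y. ennreal (pmf (step_pmf K n x) y) * (indicator V y * escape V y) \<partial>count_space UNIV)"
    by (rule nn_integral_suminf) simp
  also have "\<dots> = (\<Sum>n. \<integral>\<^sup>+\<omega>. indicator V (X n \<omega>) * escape V (X n \<omega>) \<partial>M)"
    by (simp add: nn_integral_X[of "\<lambda>y. indicator V y * escape V y"] nn_integral_measure_pmf)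
  also have "\<dots> = (\<Sum>n. emeasure M (?D n))"
  proof (rule suminf_cong)
    fix n
    have "(\<integral>\<^sup>+\<omega>. indicator V (X n \<omega>) * escape V (X n \<omega>) \<partial>M) =
      (\<integral>\<^sup>+\<omega>. indicator V (last (path n \<omega>)) * of_bool (\<forall>k>n. X k \<omega> \<notin> V) \<partial>M)"
      by (subst escape_event[symmetric]) (auto split: split_indicator)
    also have "\<dots> = (\<integral>\<^sup>+\<omega>. indicator (?D n) \<omega> \<partial>M)"
      by (intro nn_integral_cong) (auto split: split_indicator)
    also have "\<dots> = emeasure M (?D n)" by (rule nn_integral_indicator) measurable
    finally show "(\<integral>\<^sup>+\<omega>. indicator V (X n \<omega>) * escape V (X n \<omega>) \<partial>M) = emeasure M (?D n)" .
  qed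
  also have "\<dots> = emeasure M (\<Union>n. ?D n)"
  proof (rule suminf_emeasure)
    show "range ?D \<subseteq> sets M" by auto
    show "disjoint_family ?D" unfolding disjoint_family_on_def
    proof (intro ballI impI)
      fix i j :: nat assume "i \<noteq> j"
      then consider "i < j" | "j < i" by linarith
      then show "?D i \<inter> ?D j = {}" by cases blast+
    qed
  qed
  also have "\<dots> \<le> 1" using measure_le_1 by simp
  finally show ?thesis .
qed

text \<open>A transient path has a last visit to a finite set, and prolonging the path up to that
  visit keeps the upcrossings of the reversed values. Seen backwards from the last exit, the path
  has the weights of \<open>rev_kernel\<close>. Dubins' inequality therefore holds from each exit
  point, and the exit probabilities sum to at most 1.\<close>

lemma reversed_upcrossing:
  fixes u :: "'b \<Rightarrow> ennreal"
  assumes super: "\<And>y. (\<integral>\<^sup>+z. egreen K x z * ennreal (pmf (K z) y) * u z \<partial>count_space UNIV) \<le> egreen K x y * u y"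
    and ab: "a < b" "b < \<infinity>" and V: "finite V"
  shows "emeasure M {\<omega>\<in>space M. X n \<omega> \<in> V \<and> upcross a b False k (rev (map u (path n \<omega>)))} \<le> (a / b) ^ k"
proof -
  have [measurable]: "Measurable.pred M (\<lambda>\<omega>. X n \<omega> \<in> V)" for n
    by (rule measurable_X_comp) simp
  have [measurable]: "Measurable.pred M (\<lambda>\<omega>. Q (path n \<omega>))" for n Q
    by (rule measurable_path_comp) simp
  let ?D = "\<lambda>N. {\<omega>\<in>space M. X N \<omega> \<in> V \<and> upcross a b False k (rev (map u (path N \<omega>))) \<and> (\<forall>j>N. X j \<omega> \<notin> V)}"
  let ?\<Phi> = "\<lambda>l. of_bool (last l \<in> V \<and> upcross a b False k (rev (map u l))) :: ennreal"
  have sub: "AE \<omega> in M. \<omega> \<in> {\<omega>\<in>space M. X n \<omega> \<in> V \<and> upcross a b False k (rev (map u (path n \<omega>)))} \<longrightarrow> \<omega> \<in> (\<Union>N. ?D N)"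
    using AE_eventually_neq[OF transient]
  proof eventually_elim
    case (elim \<omega>)
    show ?case
    proof
      assume \<omega>: "\<omega> \<in> {\<omega>\<in>space M. X n \<omega> \<in> V \<and> upcross a b False k (rev (map u (path n \<omega>)))}"
      have "eventually (\<lambda>m. \<forall>y\<in>V. X m \<omega> \<noteq> y) sequentially"
        using V elim by (simp add: eventually_ball_finite)
      then obtain m where m: "\<And>j. j \<ge> m \<Longrightarrow> X j \<omega> \<notin> V" unfolding eventually_sequentially by blast
      define N where "N = Max {j. j < m \<and> X j \<omega> \<in> V}"
      have fin: "finite {j. j < m \<and> X j \<omega> \<in> V}" by simp
      have "n \<in> {j. j < m \<and> X j \<omega> \<in> V}" using \<omega> m[of n] by (cases "n < m") auto
      then have "N \<in> {j. j < m \<and> X j \<omega> \<in> V}" "n \<le> N"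
        unfolding N_def using Max_in[OF fin] Max_ge[OF fin] by blast+
      moreover have "X j \<omega> \<notin> V" if "j > N" for j
        using Max_ge[OF fin, of j] m[of j] that unfolding N_def[symmetric] by (cases "j < m") auto
      moreover have "upcross a b False k (rev (map u (path N \<omega>)))"
        using upcross_rev_mono[OF ab(1), of False k "\<lambda>i. u (X i \<omega>)" "Suc n" "Suc N"] \<omega> \<open>n \<le> N\<close>
        by (simp add: path_def comp_def del: upt_Suc)
      ultimately show "\<omega> \<in> (\<Union>N. ?D N)" using \<omega> by blast
    qed
  qed
  have D: "emeasure M (?D N) = (\<integral>\<^sup>+l. (?\<Phi> l * escape V (last l)) * emeasure M {\<omega>\<in>space M. path N \<omega> = l} \<partial>count_space UNIV)" for N
  proof -
    have "emeasure M (?D N) = (\<integral>\<^sup>+\<omega>. indicator (?D N) \<omega> \<partial>M)" by (rule nn_integral_indicator[symmetric]) measurable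
    also have "\<dots> = (\<integral>\<^sup>+\<omega>. ?\<Phi> (path N \<omega>) * of_bool (\<forall>j>N. X j \<omega> \<notin> V) \<partial>M)"
      by (intro nn_integral_cong) (auto split: split_indicator)
    also have "\<dots> = (\<integral>\<^sup>+\<omega>. ?\<Phi> (path N \<omega>) * escape V (last (path N \<omega>)) \<partial>M)"
      using escape_event[of ?\<Phi> N V] by simp
    also have "\<dots> = (\<integral>\<^sup>+l. (?\<Phi> l * escape V (last l)) * emeasure M {\<omega>\<in>space M. path N \<omega> = l} \<partial>count_space UNIV)"
      by (rule nn_integral_path_UNIV)
    finally show ?thesis .
  qed
  let ?c = "\<lambda>m. of_bool (hd m \<in> V \<and> upcross a b False k (map u m)) * escape V (hd m) :: ennreal"
  have "emeasure M {\<omega>\<in>space M. X n \<omega> \<in> V \<and> upcross a b False k (rev (map u (path n \<omega>)))} \<le> emeasure M (\<Union>N. ?D N)"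
    by (rule emeasure_mono_AE[OF sub]) measurable
  also have "\<dots> \<le> (\<Sum>N. emeasure M (?D N))"
    by (rule emeasure_subadditive_countably) auto
  also have "\<dots> = (\<integral>\<^sup>+l. (\<Sum>N. (?\<Phi> l * escape V (last l)) * emeasure M {\<omega>\<in>space M. path N \<omega> = l}) \<partial>count_space UNIV)"
    unfolding D by (rule nn_integral_suminf[symmetric]) simp
  also have "\<dots> = (\<integral>\<^sup>+m. (\<Sum>N. (?\<Phi> (rev m) * escape V (last (rev m))) * emeasure M {\<omega>\<in>space M. path N \<omega> = rev m}) \<partial>count_space UNIV)"
    by (rule nn_integral_bij_count_space[symmetric, where g = rev]) (auto intro!: bij_betw_byWitness[where f' = rev])
  also have "\<dots> = (\<integral>\<^sup>+y. \<integral>\<^sup>+ys. ?c (y # ys) * (\<Sum>N. emeasure M {\<omega>\<in>space M. path N \<omega> = rev (y # ys)}) \<partial>count_space UNIV \<partial>count_space UNIV)"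
    by (subst nn_integral_list_count_space) (simp add: path_eq_iff rev_map last_rev del: rev.simps)
  also have "\<dots> = (\<integral>\<^sup>+y. indicator V y * escape V y * egreen K x y * (\<integral>\<^sup>+ys. of_bool (upcross a b False k (map u (y # ys))) * path_weight rev_kernel rev_kill 0 y ys \<partial>count_space UNIV) \<partial>count_space UNIV)"
  proof (rule nn_integral_cong)
    fix y
    have *: "(\<Sum>N. emeasure M {\<omega>\<in>space M. path N \<omega> = rev (y # ys)}) = egreen K x y * path_weight rev_kernel rev_kill 0 y ys" for ys
    proof -
      \<comment> \<open>The sum over all exit times removes the time: a list with
        \<open>Suc N\<close> entries is a possible history only at time \<open>N\<close>.\<close>
      have "(\<Sum>N. emeasure M {\<omega>\<in>space M. path N \<omega> = rev (y # ys)}) = (\<Sum>N\<in>{length ys}. emeasure M {\<omega>\<in>space M. path N \<omega> = rev (y # ys)})"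
        by (rule suminf_finite) (auto simp: path_eq_iff)
      then show ?thesis by (simp only: rev_path_weight) simp
    qed
    show "(\<integral>\<^sup>+ys. ?c (y # ys) * (\<Sum>N. emeasure M {\<omega>\<in>space M. path N \<omega> = rev (y # ys)}) \<partial>count_space UNIV) =
      indicator V y * escape V y * egreen K x y * (\<integral>\<^sup>+ys. of_bool (upcross a b False k (map u (y # ys))) * path_weight rev_kernel rev_kill 0 y ys \<partial>count_space UNIV)"
      unfolding * by (subst nn_integral_cmult[symmetric]) (auto intro!: nn_integral_cong split: split_indicator simp: ac_simps)
  qed
  also have "\<dots> \<le> (\<integral>\<^sup>+y. indicator V y * escape V y * egreen K x y * (a / b) ^ k \<partial>count_space UNIV)"
  proof (intro nn_integral_mono mult_left_mono)
    fix y
    have "(\<integral>\<^sup>+ys. of_bool (upcross a b False k (vals (\<lambda>_. u) 0 (y # ys))) * path_weight rev_kernel rev_kill 0 y ys \<partial>count_space UNIV) \<le> (a / b) ^ k"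
    proof (rule dubins_upcrossing[OF rev_kernel_substochastic _ ab])
      fix n y
      have "(\<integral>\<^sup>+z. rev_kernel n y z * u z \<partial>count_space UNIV) =
        (\<integral>\<^sup>+z. egreen K x z * ennreal (pmf (K z) y) * u z / egreen K x y \<partial>count_space UNIV)"
        by (intro nn_integral_cong) (simp add: rev_kernel_def divide_ennreal_def ac_simps)
      also have "\<dots> = (\<integral>\<^sup>+z. egreen K x z * ennreal (pmf (K z) y) * u z \<partial>count_space UNIV) / egreen K x y"
        by (rule nn_integral_divide) simp
      also have "\<dots> \<le> egreen K x y * u y / egreen K x y"
        by (intro divide_right_mono_ennreal super)
      also have "\<dots> = u y" using egreen_cancel[of y "u y"] by (simp add: ennreal_times_divide)
      finally show "(\<integral>\<^sup>+z. rev_kernel n y z * u z \<partial>count_space UNIV) \<le> u y" .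
    qed
    then show "(\<integral>\<^sup>+ys. of_bool (upcross a b False k (map u (y # ys))) * path_weight rev_kernel rev_kill 0 y ys \<partial>count_space UNIV) \<le> (a / b) ^ k"
      by (simp add: vals_const del: upcross.simps)
  qed simp
  also have "\<dots> = (\<integral>\<^sup>+y. indicator V y * escape V y * egreen K x y \<partial>count_space UNIV) * (a / b) ^ k"
    by (rule nn_integral_multc) simp
  also have "\<dots> \<le> 1 * (a / b) ^ k" by (intro mult_right_mono last_exit_weight) simp
  finally show ?thesis by simp
qed

lemma green_superharmonic_converges:
  fixes u :: "'b \<Rightarrow> ennreal"
  assumes super: "\<And>y. (\<integral>\<^sup>+z. egreen K x z * ennreal (pmf (K z) y) * u z \<partial>count_space UNIV) \<le> egreen K x y * u y"
  shows "AE \<omega> in M. \<exists>l. (\<lambda>n. u (X n \<omega>)) \<longlonglongrightarrow> l"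
proof (rule AE_convergent_upcross[where g = rev])
  fix a b :: ennreal and k N assume ab: "a < b" "b < \<infinity>"
  have eq: "rev (map (\<lambda>i. u (X i \<omega>)) [0..<Suc N]) = rev (map u (path N \<omega>))" for \<omega>
    by (simp add: path_def comp_def del: upt_Suc)
  show "{\<omega>\<in>space M. upcross a b False k (rev (map (\<lambda>i. u (X i \<omega>)) [0..<Suc N]))} \<in> sets M"
    unfolding eq by (rule sets_path)
  \<comment> \<open>A finite exhaustion of the state space; the bound of
    \<open>reversed_upcrossing\<close> does not depend on the finite set.\<close>
  define V where "V j = {y :: 'b. to_nat_on UNIV y \<le> j}" for j
  have fV: "finite (V j)" for j
  proof -
    have "inj (to_nat_on (UNIV :: 'b set))" using inj_on_to_nat_on[OF countable_states] .
    then have "finite (to_nat_on (UNIV :: 'b set) -` {..j})" by (intro finite_vimageI) auto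
    then show ?thesis by (simp add: V_def vimage_def)
  qed
  let ?E = "\<lambda>j. {\<omega>\<in>space M. X N \<omega> \<in> V j \<and> upcross a b False k (rev (map u (path N \<omega>)))}"
  have "{\<omega>\<in>space M. upcross a b False k (rev (map u (path N \<omega>)))} = (\<Union>j. ?E j)"
    by (auto simp: V_def)
  moreover have "emeasure M (\<Union>j. ?E j) = (SUP j. emeasure M (?E j))"
  proof (rule SUP_emeasure_incseq[symmetric])
    show "incseq ?E" by (auto simp: incseq_def V_def)
    show "range ?E \<subseteq> sets M"
      using sets_path[of "\<lambda>l. last l \<in> V j \<and> upcross a b False k (rev (map u l))" N for j] by auto
  qed
  moreover have "\<dots> \<le> (a / b) ^ k"
    by (intro SUP_least reversed_upcrossing super ab fV)
  ultimately show "emeasure M {\<omega>\<in>space M. upcross a b False k (rev (map (\<lambda>i. u (X i \<omega>)) [0..<Suc N]))} \<le> (a / b) ^ k"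
    unfolding eq by simp
qed simp

end

lemma martin_kernel_converges:
  assumes tr: "transient_chain K" and ir: "irreducible_chain K"
  shows "AE \<omega> in M. convergent (\<lambda>n. martin_kernel K x y (X n \<omega>))"
proof -
  have eg: "egreen K z w = ennreal (green K z w)" for z w by (rule egreen_eq_green[OF tr])
  have pos: "0 < green K z w" for z w by (rule green_pos[OF tr ir])
  let ?u = "\<lambda>z. ennreal (martin_kernel K x y z)"
  \<comment> \<open>Multiplication by \<open>G(x, .)\<close> turns the kernel into
    \<open>G(y, .)\<close>, so superharmonicity for the reversed chain becomes
    \<open>G P \<le> G\<close> with starting point \<open>y\<close>.\<close>
  have gu: "egreen K x z * ?u z = egreen K y z" for z
    using pos[of x z] pos[of y z] by (simp add: eg martin_kernel_def flip: ennreal_mult)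
  have "AE \<omega> in M. \<exists>l. (\<lambda>n. ?u (X n \<omega>)) \<longlonglongrightarrow> l"
  proof (rule green_superharmonic_converges)
    show "egreen K x z < \<infinity>" for z by (simp add: eg)
    show "0 < egreen K x z" for z using pos by (simp add: eg)
    fix z
    have "(\<integral>\<^sup>+w. egreen K x w * ennreal (pmf (K w) z) * ?u w \<partial>count_space UNIV) =
      (\<integral>\<^sup>+w. egreen K y w * ennreal (pmf (K w) z) \<partial>count_space UNIV)"
      by (intro nn_integral_cong) (simp add: gu[symmetric] ac_simps)
    also have "\<dots> \<le> egreen K y z" unfolding egreen_step[of K y z, symmetric] by simp
    finally show "(\<integral>\<^sup>+w. egreen K x w * ennreal (pmf (K w) z) * ?u w \<partial>count_space UNIV) \<le> egreen K x z * ?u z"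
      by (simp add: gu)
  qed
  then show ?thesis
  proof eventually_elim
    case (elim \<omega>)
    then obtain l where l: "(\<lambda>n. ?u (X n \<omega>)) \<longlonglongrightarrow> l" by blast
    \<comment> \<open>The Harnack bound keeps the limit finite, so convergence in
      \<open>ennreal\<close> is convergence of reals.\<close>
    obtain c where c: "0 < c" "\<And>z. 0 \<le> c * martin_kernel K x y z" "\<And>z. c * martin_kernel K x y z \<le> 1"
      using martin_kernel_bound[OF tr ir] by blast
    have nn: "0 \<le> martin_kernel K x y z" for z using c(1) c(2)[of z] by (simp add: zero_le_mult_iff)
    have "martin_kernel K x y z \<le> 1 / c" for z using c(1) c(3)[of z] by (simp add: field_simps)
    then have "l \<le> ennreal (1 / c)"
      by (intro LIMSEQ_le_const2[OF l]) (auto intro!: ennreal_leI)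
    then obtain l' where "l = ennreal l'" "0 \<le> l'" by (cases l) (auto simp: top_unique)
    with l nn have "(\<lambda>n. martin_kernel K x y (X n \<omega>)) \<longlonglongrightarrow> l'"
      by (simp add: tendsto_ennreal_iff)
    then show ?case by (auto simp: convergent_def)
  qed
qed

end

section \<open>First moments of the branching random walk\<close>

lemma finite_particles [simp]: "finite (particles B)"
proof -
  have "particles B = (SIGMA x:set_mset B. {..<count B x})"
    by (auto simp: particles_def) (metis count_greater_zero_iff gr_zeroI not_less_zero)
  then show ?thesis by simp
qed

lemma image_mset_fst_particles: "image_mset fst (mset_set (particles B)) = B"
proof (rule multiset_eqI)
  fix x
  have "fst -` {x} \<inter> particles B = (\<lambda>i. (x, i)) ` {..<count B x}"
    by (auto simp: particles_def)
  then have "card (fst -` {x} \<inter> particles B) = count B x"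
    by (simp add: card_image inj_on_def)
  then show "count (image_mset fst (mset_set (particles B))) x = count B x"
    by (simp add: count_image_mset)
qed

lemma sum_particles: "(\<Sum>p\<in>particles B. f (fst p)) = (\<Sum>x\<in>#B. f x)"
proof -
  have "(\<Sum>p\<in>particles B. f (fst p)) = (\<Sum>x\<in>#image_mset fst (mset_set (particles B)). f x)"
    by (simp add: sum_unfold_sum_mset image_mset.compositionality comp_def)
  then show ?thesis by (simp only: image_mset_fst_particles)
qed

lemma card_particles: "card (particles B) = size B"
  using arg_cong[OF image_mset_fst_particles, of size B] by simp

lemma sum_mset_sum_image: "finite A \<Longrightarrow> (\<Sum>x\<in>#(\<Sum>p\<in>A. g p). f x) = (\<Sum>p\<in>A. \<Sum>x\<in>#g p. f x)"
  by (induction A rule: finite_induct) auto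

lemma sum_mset_mult_left: "(\<Sum>x\<in>#B. c * f x) = c * (\<Sum>x\<in>#B. f x :: 'a :: comm_semiring_1)"
  by (induction B) (auto simp: algebra_simps)

lemma nn_integral_Pi_pmf_component:
  assumes "finite A" "p \<in> A"
  shows "(\<integral>\<^sup>+k. f (k p) \<partial>Pi_pmf A d q) = (\<integral>\<^sup>+n. f n \<partial>q p)"
proof -
  have "(\<integral>\<^sup>+k. f (k p) \<partial>Pi_pmf A d q) = (\<integral>\<^sup>+n. f n \<partial>map_pmf (\<lambda>k. k p) (Pi_pmf A d q))"
    by (simp add: nn_integral_map_pmf)
  then show ?thesis using assms by (simp add: Pi_pmf_component)
qed

lemma nn_integral_branch_step:
  fixes f :: "'s \<Rightarrow> ennreal"
  shows "(\<integral>\<^sup>+B'. (\<Sum>x\<in>#B'. f x) \<partial>branch_step \<mu> B) = (\<integral>\<^sup>+n. of_nat n \<partial>\<mu>) * (\<Sum>x\<in>#B. f x)"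
proof -
  have "(\<integral>\<^sup>+B'. (\<Sum>x\<in>#B'. f x) \<partial>branch_step \<mu> B) =
    (\<integral>\<^sup>+k. (\<Sum>p\<in>particles B. of_nat (k p) * f (fst p)) \<partial>Pi_pmf (particles B) 0 (\<lambda>_. \<mu>))"
    unfolding branch_step_def
    by (simp add: nn_integral_map_pmf sum_mset_sum_image)
  also have "\<dots> = (\<Sum>p\<in>particles B. \<integral>\<^sup>+k. of_nat (k p) * f (fst p) \<partial>Pi_pmf (particles B) 0 (\<lambda>_. \<mu>))"
    by (rule nn_integral_sum) simp
  also have "\<dots> = (\<Sum>p\<in>particles B. (\<integral>\<^sup>+n. of_nat n \<partial>\<mu>) * f (fst p))"
  proof (intro sum.cong refl)
    fix p assume "p \<in> particles B"
    then have "(\<integral>\<^sup>+k. of_nat (k p) \<partial>Pi_pmf (particles B) 0 (\<lambda>_. \<mu>)) = (\<integral>\<^sup>+n. of_nat n \<partial>\<mu>)"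
      by (intro nn_integral_Pi_pmf_component) auto
    then show "(\<integral>\<^sup>+k. of_nat (k p) * f (fst p) \<partial>Pi_pmf (particles B) 0 (\<lambda>_. \<mu>)) = (\<integral>\<^sup>+n. of_nat n \<partial>\<mu>) * f (fst p)"
      by (simp add: nn_integral_multc)
  qed
  finally show ?thesis
    by (simp add: sum_particles[where f = "\<lambda>x. c * f x" for c] sum_mset_mult_left)
qed

lemma nn_integral_move_step:
  fixes f :: "'s \<Rightarrow> ennreal"
  shows "(\<integral>\<^sup>+B'. (\<Sum>x\<in>#B'. f x) \<partial>move_step P B) = (\<Sum>x\<in>#B. \<integral>\<^sup>+y. f y \<partial>P x)"
proof -
  have "(\<integral>\<^sup>+B'. (\<Sum>x\<in>#B'. f x) \<partial>move_step P B) =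
    (\<integral>\<^sup>+y. (\<Sum>p\<in>particles B. f (y p)) \<partial>Pi_pmf (particles B) undefined (\<lambda>p. P (fst p)))"
    unfolding move_step_def by (simp add: nn_integral_map_pmf sum_mset_sum_image)
  also have "\<dots> = (\<Sum>p\<in>particles B. \<integral>\<^sup>+y. f (y p) \<partial>Pi_pmf (particles B) undefined (\<lambda>p. P (fst p)))"
    by (rule nn_integral_sum) simp
  also have "\<dots> = (\<Sum>p\<in>particles B. \<integral>\<^sup>+y. f y \<partial>P (fst p))"
    by (intro sum.cong refl) (simp add: nn_integral_Pi_pmf_component)
  finally show ?thesis by (simp add: sum_particles[where f = "\<lambda>x. nn_integral (measure_pmf (P x)) f"])
qed

text \<open>Expectation is linear, so only the marginals of the two product laws enter: each
  particle contributes the mean offspring and one step of \<open>P\<close>.\<close>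

lemma nn_integral_brw_kernel:
  fixes f :: "'s \<Rightarrow> ennreal"
  shows "(\<integral>\<^sup>+B'. (\<Sum>x\<in>#B'. f x) \<partial>brw_kernel \<mu> P B) = (\<integral>\<^sup>+n. of_nat n \<partial>\<mu>) * (\<Sum>x\<in>#B. \<integral>\<^sup>+y. f y \<partial>P x)"
  unfolding brw_kernel_def by (simp add: nn_integral_bind_pmf nn_integral_move_step nn_integral_branch_step)

text \<open>Here independence matters: the product law factorises the generating function over the
  particles, while moving them preserves their number.\<close>

lemma nn_integral_brw_kernel_power:
  fixes s :: real
  assumes "0 \<le> s"
  shows "(\<integral>\<^sup>+B'. ennreal (s ^ size B') \<partial>brw_kernel \<mu> P B) = (\<integral>\<^sup>+n. ennreal (s ^ n) \<partial>\<mu>) ^ size B"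
proof -
  have 1: "(\<integral>\<^sup>+B''. ennreal (s ^ size B'') \<partial>move_step P B') = ennreal (s ^ size B')" for B'
    unfolding move_step_def
    by (simp add: nn_integral_map_pmf card_particles measure_pmf.emeasure_space_1[simplified])
  have "(\<integral>\<^sup>+B'. ennreal (s ^ size B') \<partial>brw_kernel \<mu> P B) =
    (\<integral>\<^sup>+k. ennreal (s ^ (\<Sum>p\<in>particles B. k p)) \<partial>Pi_pmf (particles B) 0 (\<lambda>_. \<mu>))"
    unfolding brw_kernel_def nn_integral_bind_pmf 1
    by (simp add: branch_step_def nn_integral_map_pmf)
  also have "\<dots> = (\<integral>\<^sup>+k. (\<Prod>p\<in>particles B. ennreal (s ^ k p)) \<partial>Pi_pmf (particles B) 0 (\<lambda>_. \<mu>))"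
    using assms by (simp add: power_sum prod_ennreal)
  also have "\<dots> = (\<Prod>p\<in>particles B. \<integral>\<^sup>+n. ennreal (s ^ n) \<partial>\<mu>)"
    by (rule nn_integral_prod_Pi_pmf) simp
  finally show ?thesis by (simp add: card_particles)
qed

lemma convergent_if_tendsto_ennreal:
  assumes "\<exists>l<\<infinity>. (\<lambda>n. ennreal (s n)) \<longlonglongrightarrow> l" "\<And>n. 0 \<le> s n"
  shows "convergent s"
proof -
  obtain l where l: "l < \<infinity>" "(\<lambda>n. ennreal (s n)) \<longlonglongrightarrow> l" using assms(1) by blast
  then obtain l' where "l = ennreal l'" "0 \<le> l'" by (cases l) auto
  with l have "s \<longlonglongrightarrow> l'" using assms(2) by (simp add: tendsto_ennreal_iff)
  then show ?thesis by (auto simp: convergent_def)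
qed

lemma countable_multiset: "countable (UNIV :: 's::countable multiset set)"
proof -
  have "(UNIV :: 's multiset set) = range mset" by (rule surj_mset[symmetric])
  then show ?thesis by (metis countable_image uncountable_def countableI_type)
qed

lemma (in countable_chain) markov_multi_step:
  fixes G :: "'b \<Rightarrow> 'b \<Rightarrow> ennreal"
  shows "(\<integral>\<^sup>+\<omega>. G (X n \<omega>) (X (n + k) \<omega>) \<partial>M) = (\<integral>\<^sup>+\<omega>. (\<integral>\<^sup>+y. G (X n \<omega>) y \<partial>step_pmf K k (X n \<omega>)) \<partial>M)"
proof (induction k arbitrary: G)
  case (Suc k)
  have nth: "path (n + k) \<omega> ! n = X n \<omega>" for \<omega> by (simp add: path_def nth_append del: upt_Suc)
  have "(\<integral>\<^sup>+\<omega>. G (X n \<omega>) (X (n + Suc k) \<omega>) \<partial>M) = (\<integral>\<^sup>+\<omega>. (\<integral>\<^sup>+z. G (X n \<omega>) z \<partial>K (X (n + k) \<omega>)) \<partial>M)"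
    using markov_property[of "\<lambda>l. G (l ! n)" "n + k"] by (simp add: nth)
  also have "\<dots> = (\<integral>\<^sup>+\<omega>. (\<integral>\<^sup>+y. (\<integral>\<^sup>+z. G (X n \<omega>) z \<partial>K y) \<partial>step_pmf K k (X n \<omega>)) \<partial>M)"
    by (rule Suc)
  also have "\<dots> = (\<integral>\<^sup>+\<omega>. (\<integral>\<^sup>+y. G (X n \<omega>) y \<partial>step_pmf K (Suc k) (X n \<omega>)) \<partial>M)"
    unfolding step_pmf_Suc' nn_integral_bind_pmf ..
  finally show ?case .
qed simp

text \<open>The mean is an \<open>ennreal\<close> integral equal to a real, which includes its
  finiteness; a real \<open>suminf\<close> would denote a number even for a divergent
  series.\<close>

locale brw =
  fixes M :: "'w measure" and B :: "nat \<Rightarrow> 'w \<Rightarrow> 's::countable multiset" and \<mu> :: "nat pmf" and P :: "'s \<Rightarrow> 's pmf"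
    and x\<^sub>0 :: 's and m :: real
  assumes walk: "branching_random_walk M B \<mu> P x\<^sub>0"
    and mean: "(\<integral>\<^sup>+n. of_nat n \<partial>\<mu>) = ennreal m" and m1: "m > 1"
begin

text \<open>The walk is itself a chain on the countable set of configurations, so the convergence
  theorem for superharmonic functions applies to \<open>Z\<close> as a time-dependent function of
  the configuration.\<close>

sublocale countable_chain M B "brw_kernel \<mu> P" "{#x\<^sub>0#}"
  using walk by unfold_locales (simp_all add: branching_random_walk_def countable_multiset)

definition Z :: "nat \<Rightarrow> ('s \<Rightarrow> real) \<Rightarrow> 'w \<Rightarrow> real" where
  "Z n f \<omega> = (\<Sum>x\<in>#B n \<omega>. f x) / m ^ n"

lemma measurable_Z [measurable]: "Z n f \<in> borel_measurable M"
  unfolding Z_def by (rule measurable_X_comp) simp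

lemma Z_add: "Z n (\<lambda>x. f x + g x) \<omega> = Z n f \<omega> + Z n g \<omega>"
  by (simp add: Z_def sum_mset.distrib add_divide_distrib)

lemma Z_cmult: "Z n (\<lambda>x. c * f x) \<omega> = c * Z n f \<omega>"
  by (simp add: Z_def sum_mset_mult_left)

lemma Z_mono: "(\<And>x. f x \<le> g x) \<Longrightarrow> Z n f \<omega> \<le> Z n g \<omega>"
  unfolding Z_def using m1 by (intro divide_right_mono sum_mset_mono) auto

lemma Z_nonneg: "(\<And>x. 0 \<le> f x) \<Longrightarrow> 0 \<le> Z n f \<omega>"
  using Z_mono[of "\<lambda>_. 0" f n \<omega>] by (simp add: Z_def)

lemma ennreal_Z:
  assumes "\<And>x. 0 \<le> f x"
  shows "ennreal (Z n f \<omega>) = (\<Sum>x\<in>#B n \<omega>. ennreal (f x)) / ennreal m ^ n"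
proof -
  have "(\<Sum>x\<in>#b. ennreal (f x)) = ennreal (\<Sum>x\<in>#b. f x) \<and> 0 \<le> (\<Sum>x\<in>#b. f x)" for b
    by (induction b) (auto simp: assms)
  then show ?thesis using m1 by (simp add: Z_def ennreal_power divide_ennreal)
qed

lemma nn_integral_Z_Suc:
  fixes f :: "'s \<Rightarrow> ennreal"
  shows "(\<integral>\<^sup>+b'. (\<Sum>x\<in>#b'. f x) / ennreal m ^ Suc n \<partial>brw_kernel \<mu> P b) = (\<Sum>x\<in>#b. \<integral>\<^sup>+y. f y \<partial>P x) / ennreal m ^ n"
proof -
  have pos: "0 < m" using m1 by simp
  have eq: "ennreal m * c / ennreal m ^ Suc n = c / ennreal m ^ n" for c
  proof -
    have inv: "d / ennreal m ^ k = d * ennreal (inverse (m ^ k))" for d k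
      using pos by (simp add: divide_ennreal_def ennreal_power inverse_ennreal)
    have "ennreal m * ennreal (inverse (m ^ Suc n)) = ennreal (inverse (m ^ n))"
      using pos by (simp flip: ennreal_mult)
    then show ?thesis unfolding inv by (metis mult.assoc mult.commute)
  qed
  have "(\<integral>\<^sup>+b'. (\<Sum>x\<in>#b'. f x) / ennreal m ^ Suc n \<partial>brw_kernel \<mu> P b) =
      (\<integral>\<^sup>+b'. (\<Sum>x\<in>#b'. f x) \<partial>brw_kernel \<mu> P b) / ennreal m ^ Suc n"
    by (rule nn_integral_divide) simp
  then show ?thesis by (simp only: nn_integral_brw_kernel mean eq)
qed

text \<open>The many-to-one formula, through which expectations of the walk become expectations of
  the single chain.\<close>

lemma nn_integral_Z:
  fixes f :: "'s \<Rightarrow> ennreal"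
  shows "(\<integral>\<^sup>+\<omega>. (\<Sum>x\<in>#B n \<omega>. f x) / ennreal m ^ n \<partial>M) = (\<integral>\<^sup>+y. f y \<partial>step_pmf P n x\<^sub>0)"
proof (induction n arbitrary: f)
  case 0
  show ?case using nn_integral_start[of "\<lambda>b. \<Sum>x\<in>#b. f x"] by (simp add: divide_ennreal_def)
next
  case (Suc n)
  have "(\<integral>\<^sup>+\<omega>. (\<Sum>x\<in>#B (Suc n) \<omega>. f x) / ennreal m ^ Suc n \<partial>M) =
    (\<integral>\<^sup>+\<omega>. (\<Sum>x\<in>#B n \<omega>. \<integral>\<^sup>+y. f y \<partial>P x) / ennreal m ^ n \<partial>M)"
    by (subst nn_integral_next[of "\<lambda>b. (\<Sum>x\<in>#b. f x) / ennreal m ^ Suc n"]) (simp only: nn_integral_Z_Suc)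
  also have "\<dots> = (\<integral>\<^sup>+y. f y \<partial>step_pmf P (Suc n) x\<^sub>0)"
    unfolding step_pmf_Suc' nn_integral_bind_pmf by (rule Suc)
  finally show ?case .
qed

lemma Z_superharmonic_converges:
  assumes f: "\<And>x. 0 \<le> f x" and super: "\<And>x. (\<integral>\<^sup>+y. ennreal (f y) \<partial>P x) \<le> ennreal (f x)"
  shows "AE \<omega> in M. convergent (\<lambda>n. Z n f \<omega>)"
proof -
  have "AE \<omega> in M. \<exists>l<\<infinity>. (\<lambda>n. (\<Sum>x\<in>#B n \<omega>. ennreal (f x)) / ennreal m ^ n) \<longlonglongrightarrow> l"
  proof (rule superharmonic_converges)
    fix n b
    show "(\<integral>\<^sup>+b'. (\<Sum>x\<in>#b'. ennreal (f x)) / ennreal m ^ Suc n \<partial>brw_kernel \<mu> P b) \<le> (\<Sum>x\<in>#b. ennreal (f x)) / ennreal m ^ n"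
      unfolding nn_integral_Z_Suc by (intro divide_right_mono_ennreal sum_mset_mono super)
  qed (simp add: divide_ennreal_def less_top[symmetric])
  then show ?thesis
  proof eventually_elim
    case (elim \<omega>)
    then show ?case
      by (intro convergent_if_tendsto_ennreal Z_nonneg f) (simp add: ennreal_Z[OF f])
  qed
qed

lemma Z_one_converges: "AE \<omega> in M. convergent (\<lambda>n. Z n (\<lambda>_. 1) \<omega>)"
  by (rule Z_superharmonic_converges) (simp_all add: measure_pmf.emeasure_space_1[simplified])

text \<open>The supermartingale converges almost surely; Fatou's lemma and the vanishing means
  identify its limit.\<close>

lemma Z_tendsto_0:
  assumes f: "\<And>x. 0 \<le> f x" and super: "\<And>x. (\<integral>\<^sup>+y. ennreal (f y) \<partial>P x) \<le> ennreal (f x)"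
    and lim: "(\<lambda>n. \<integral>\<^sup>+y. ennreal (f y) \<partial>step_pmf P n x\<^sub>0) \<longlonglongrightarrow> 0"
  shows "AE \<omega> in M. (\<lambda>n. Z n f \<omega>) \<longlonglongrightarrow> 0"
proof -
  have "(\<integral>\<^sup>+\<omega>. liminf (\<lambda>n. ennreal (Z n f \<omega>)) \<partial>M) \<le> liminf (\<lambda>n. \<integral>\<^sup>+\<omega>. ennreal (Z n f \<omega>) \<partial>M)"
    by (rule nn_integral_liminf) measurable
  also have "\<dots> = 0"
    unfolding ennreal_Z[OF f] nn_integral_Z using lim by (intro lim_imp_Liminf) auto
  finally have "(\<integral>\<^sup>+\<omega>. liminf (\<lambda>n. ennreal (Z n f \<omega>)) \<partial>M) = 0" by simp
  then have "AE \<omega> in M. liminf (\<lambda>n. ennreal (Z n f \<omega>)) = 0"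
    by (subst (asm) nn_integral_0_iff_AE) auto
  with Z_superharmonic_converges[OF f super] show ?thesis
  proof eventually_elim
    case (elim \<omega>)
    then obtain l where l: "(\<lambda>n. Z n f \<omega>) \<longlonglongrightarrow> l" by (auto simp: convergent_def)
    have "0 \<le> l" using LIMSEQ_le_const[OF l, of 0] Z_nonneg[OF f] by auto
    have "(\<lambda>n. ennreal (Z n f \<omega>)) \<longlonglongrightarrow> ennreal l" using l by (rule tendsto_ennrealI)
    then have "liminf (\<lambda>n. ennreal (Z n f \<omega>)) = ennreal l" by (intro lim_imp_Liminf) auto
    with elim have "ennreal l = 0" by simp
    with \<open>0 \<le> l\<close> have "l = 0" by simp
    with l show ?case by simp
  qed
qed

end

section \<open>Bounded observables of the branching random walk\<close>

context countable_chain
begin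

text \<open>The law started at \<open>y\<close> is the law started at \<open>x\<close> conditioned on a visit to \<open>y\<close> at a time when that
  has positive probability, so no second chain is needed.\<close>

lemma step_pmf_expectation_converges:
  fixes f :: "'b \<Rightarrow> real"
  assumes f: "\<And>y. 0 \<le> f y" "\<And>y. f y \<le> C"
    and conv: "AE \<omega> in M. convergent (\<lambda>n. f (X n \<omega>))"
    and reach: "\<And>y. \<exists>k. 0 < pmf (step_pmf K k x) y"
  shows "\<exists>l. (\<lambda>n. \<integral>\<^sup>+z. ennreal (f z) \<partial>step_pmf K n y) \<longlonglongrightarrow> l"
proof -
  have [measurable]: "(\<lambda>\<omega>. f (X n \<omega>)) \<in> borel_measurable M" for n
    by (rule measurable_X_comp) simp
  obtain k where k: "0 < pmf (step_pmf K k x) y" using reach by blast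
  define p where "p = pmf (step_pmf K k x) y"
  have p: "0 < p" using k by (simp add: p_def)
  have eq: "(\<integral>\<^sup>+\<omega>. of_bool (X k \<omega> = y) * ennreal (f (X (k + n) \<omega>)) \<partial>M) = ennreal p * (\<integral>\<^sup>+z. ennreal (f z) \<partial>step_pmf K n y)" for n
  proof -
    have "(\<integral>\<^sup>+\<omega>. of_bool (X k \<omega> = y) * ennreal (f (X (k + n) \<omega>)) \<partial>M) =
      (\<integral>\<^sup>+\<omega>. (\<integral>\<^sup>+z. of_bool (X k \<omega> = y) * ennreal (f z) \<partial>step_pmf K n (X k \<omega>)) \<partial>M)"
      using markov_multi_step[of "\<lambda>w z. of_bool (w = y) * ennreal (f z)" k n] .
    also have "\<dots> = (\<integral>\<^sup>+\<omega>. (\<integral>\<^sup>+z. ennreal (f z) \<partial>step_pmf K n y) * indicator {\<omega>\<in>space M. X k \<omega> \<in> {y}} \<omega> \<partial>M)"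
      by (intro nn_integral_cong) (auto simp: nn_integral_cmult split: split_indicator)
    also have "\<dots> = (\<integral>\<^sup>+z. ennreal (f z) \<partial>step_pmf K n y) * emeasure M {\<omega>\<in>space M. X k \<omega> \<in> {y}}"
      using sets_path[of "\<lambda>l. last l \<in> {y}" k] by (intro nn_integral_cmult_indicator) simp
    also have "emeasure M {\<omega>\<in>space M. X k \<omega> \<in> {y}} = ennreal p"
      unfolding emeasure_X p_def by (simp add: emeasure_pmf_single)
    finally show ?thesis by (simp add: mult.commute)
  qed
  have "(\<lambda>n. \<integral>\<^sup>+\<omega>. of_bool (X k \<omega> = y) * ennreal (f (X (k + n) \<omega>)) \<partial>M) \<longlonglongrightarrow>
    (\<integral>\<^sup>+\<omega>. of_bool (X k \<omega> = y) * ennreal (lim (\<lambda>n. f (X n \<omega>))) \<partial>M)"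
  proof (rule nn_integral_dominated_convergence[where w = "\<lambda>_. ennreal C"])
    have [measurable]: "Measurable.pred M (\<lambda>\<omega>. X k \<omega> = y)"
      by (rule measurable_X_comp) simp
    show "(\<lambda>\<omega>. of_bool (X k \<omega> = y) * ennreal (f (X (k + n) \<omega>))) \<in> borel_measurable M" for n by measurable
    show "(\<lambda>\<omega>. of_bool (X k \<omega> = y) * ennreal (lim (\<lambda>n. f (X n \<omega>)))) \<in> borel_measurable M" by measurable
    show "AE \<omega> in M. of_bool (X k \<omega> = y) * ennreal (f (X (k + n) \<omega>)) \<le> ennreal C" for n
      using f(2) by (auto intro!: ennreal_leI)
    show "(\<integral>\<^sup>+\<omega>. ennreal C \<partial>M) < \<infinity>" by (simp add: emeasure_space_1)
    show "AE \<omega> in M. (\<lambda>n. of_bool (X k \<omega> = y) * ennreal (f (X (k + n) \<omega>))) \<longlonglongrightarrow> of_bool (X k \<omega> = y) * ennreal (lim (\<lambda>n. f (X n \<omega>)))"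
      using conv
    proof eventually_elim
      case (elim \<omega>)
      then have "(\<lambda>n. f (X n \<omega>)) \<longlonglongrightarrow> lim (\<lambda>n. f (X n \<omega>))" by (simp add: convergent_LIMSEQ_iff)
      then have "(\<lambda>n. f (X (k + n) \<omega>)) \<longlonglongrightarrow> lim (\<lambda>n. f (X n \<omega>))"
        using LIMSEQ_ignore_initial_segment[of "\<lambda>n. f (X n \<omega>)" _ k] by (simp add: add.commute)
      then have "(\<lambda>n. ennreal (f (X (k + n) \<omega>))) \<longlonglongrightarrow> ennreal (lim (\<lambda>n. f (X n \<omega>)))" by (rule tendsto_ennrealI)
      then show ?case by (cases "X k \<omega> = y") auto
    qed
  qed simp
  then have "(\<lambda>n. ennreal (1 / p) * (ennreal p * (\<integral>\<^sup>+z. ennreal (f z) \<partial>step_pmf K n y))) \<longlonglongrightarrow>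
    ennreal (1 / p) * (\<integral>\<^sup>+\<omega>. of_bool (X k \<omega> = y) * ennreal (lim (\<lambda>n. f (X n \<omega>))) \<partial>M)"
    unfolding eq by (intro ennreal_tendsto_cmult) auto
  moreover have "ennreal (1 / p) * (ennreal p * c) = c" for c
    using p by (simp add: mult.assoc[symmetric] flip: ennreal_mult)
  ultimately show ?thesis by auto
qed

text \<open>The function is \<open>h y = lim E_y f(X_n)\<close>. Since \<open>|f(y) - h(y)|\<close>
  is at most the \<open>liminf\<close> over \<open>k\<close> of \<open>E_y |f(y) - f(X_k)|\<close>,
  the Markov property bounds \<open>E |f - h|(X_n)\<close> by the mean distance of
  \<open>f(X_n)\<close> from its almost sure limit, which tends to 0.\<close>

lemma ex_harmonic_asymptotic:
  fixes f :: "'b \<Rightarrow> real"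
  assumes f: "\<And>y. 0 \<le> f y" "\<And>y. f y \<le> C"
    and conv: "AE \<omega> in M. convergent (\<lambda>n. f (X n \<omega>))"
    and reach: "\<And>y. \<exists>k. 0 < pmf (step_pmf K k x) y"
  obtains h where "\<And>y. 0 \<le> h y" "\<And>y. h y \<le> C"
    "\<And>y. (\<integral>\<^sup>+z. ennreal (h z) \<partial>K y) = ennreal (h y)"
    "AE \<omega> in M. (\<lambda>n. \<bar>f (X n \<omega>) - h (X n \<omega>)\<bar>) \<longlonglongrightarrow> 0"
proof -
  have [measurable]: "(\<lambda>\<omega>. g (X n \<omega>)) \<in> borel_measurable M" for n and g :: "'b \<Rightarrow> real"
    by (rule measurable_X_comp) simp
  have C: "0 \<le> C" using f(1)[of x] f(2)[of x] by simp
  define F where "F n y = (\<integral>\<^sup>+z. ennreal (f z) \<partial>step_pmf K n y)" for n y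
  have F_le: "F n y \<le> ennreal C" for n y
  proof -
    have "F n y \<le> (\<integral>\<^sup>+z. ennreal C \<partial>step_pmf K n y)"
      unfolding F_def using f(2) by (intro nn_integral_mono ennreal_leI)
    then show ?thesis by (simp add: measure_pmf.emeasure_space_1[simplified])
  qed
  define h where "h y = enn2real (lim (\<lambda>n. F n y))" for y
  have F_lim: "(\<lambda>n. F n y) \<longlonglongrightarrow> ennreal (h y)" and h_le: "h y \<le> C" for y
  proof -
    obtain l where l: "(\<lambda>n. F n y) \<longlonglongrightarrow> l"
      using step_pmf_expectation_converges[OF f conv reach, of y] unfolding F_def by blast
    have "l \<le> ennreal C" by (rule LIMSEQ_le_const2[OF l]) (auto simp: F_le)
    moreover have "lim (\<lambda>n. F n y) = l" using l by (rule limI)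
    ultimately have "l = ennreal (h y)" by (cases l) (auto simp: h_def top_unique)
    with l \<open>l \<le> ennreal C\<close> C show "(\<lambda>n. F n y) \<longlonglongrightarrow> ennreal (h y)" "h y \<le> C"
      by (auto simp: ennreal_le_iff)
  qed
  have h0: "0 \<le> h y" for y by (simp add: h_def)
  have harm: "(\<integral>\<^sup>+z. ennreal (h z) \<partial>K y) = ennreal (h y)" for y
  proof (rule LIMSEQ_unique)
    have "(\<lambda>n. \<integral>\<^sup>+z. F n z \<partial>K y) \<longlonglongrightarrow> (\<integral>\<^sup>+z. ennreal (h z) \<partial>K y)"
      by (rule nn_integral_dominated_convergence[where w = "\<lambda>_. ennreal C"])
         (auto simp: F_le F_lim measure_pmf.emeasure_space_1[simplified])
    then show "(\<lambda>n. F (Suc n) y) \<longlonglongrightarrow> (\<integral>\<^sup>+z. ennreal (h z) \<partial>K y)"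
      by (simp add: F_def nn_integral_bind_pmf)
    show "(\<lambda>n. F (Suc n) y) \<longlonglongrightarrow> ennreal (h y)"
      using F_lim by (rule LIMSEQ_Suc)
  qed
  have diff: "ennreal \<bar>f y - h y\<bar> \<le> liminf (\<lambda>k. \<integral>\<^sup>+z. ennreal \<bar>f y - f z\<bar> \<partial>step_pmf K k y)" for y
  proof -
    have F_real: "F k y = ennreal (\<integral>z. f z \<partial>step_pmf K k y)" for k
      unfolding F_def using f
      by (intro nn_integral_eq_integral measure_pmf.integrable_const_bound[where B = C]) auto
    have lim: "(\<lambda>k. \<integral>z. f z \<partial>step_pmf K k y) \<longlonglongrightarrow> h y"
      using F_lim[of y] h0 f(1) unfolding F_real by (subst (asm) tendsto_ennreal_iff) (auto intro!: Bochner_Integration.integral_nonneg)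
    have "ennreal \<bar>f y - (\<integral>z. f z \<partial>step_pmf K k y)\<bar> \<le> (\<integral>\<^sup>+z. ennreal \<bar>f y - f z\<bar> \<partial>step_pmf K k y)" for k
    proof -
      have int: "integrable (step_pmf K k y) f"
        using f by (intro measure_pmf.integrable_const_bound[where B = C]) auto
      have "\<bar>\<integral>z. f y - f z \<partial>step_pmf K k y\<bar> \<le> (\<integral>z. \<bar>f y - f z\<bar> \<partial>step_pmf K k y)"
        by (rule integral_abs_bound)
      moreover have "(\<integral>z. f y - f z \<partial>step_pmf K k y) = f y - (\<integral>z. f z \<partial>step_pmf K k y)"
        using int by (subst Bochner_Integration.integral_diff) auto
      moreover have "(\<integral>\<^sup>+z. ennreal \<bar>f y - f z\<bar> \<partial>step_pmf K k y) = ennreal (\<integral>z. \<bar>f y - f z\<bar> \<partial>step_pmf K k y)"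
        using int by (intro nn_integral_eq_integral) auto
      ultimately show ?thesis by (auto intro: ennreal_leI)
    qed
    then have "liminf (\<lambda>k. ennreal \<bar>f y - (\<integral>z. f z \<partial>step_pmf K k y)\<bar>) \<le> liminf (\<lambda>k. \<integral>\<^sup>+z. ennreal \<bar>f y - f z\<bar> \<partial>step_pmf K k y)"
      by (intro Liminf_mono always_eventually) auto
    moreover have "(\<lambda>k. ennreal \<bar>f y - (\<integral>z. f z \<partial>step_pmf K k y)\<bar>) \<longlonglongrightarrow> ennreal \<bar>f y - h y\<bar>"
      by (intro tendsto_ennrealI tendsto_rabs tendsto_diff tendsto_const lim)
    then have "liminf (\<lambda>k. ennreal \<bar>f y - (\<integral>z. f z \<partial>step_pmf K k y)\<bar>) = ennreal \<bar>f y - h y\<bar>"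
      by (intro lim_imp_Liminf) auto
    ultimately show ?thesis by simp
  qed
  define Y where "Y \<omega> = lim (\<lambda>n. f (X n \<omega>))" for \<omega>
  have [measurable]: "Y \<in> borel_measurable M" unfolding Y_def by measurable
  have Ylim: "AE \<omega> in M. (\<lambda>n. f (X n \<omega>)) \<longlonglongrightarrow> Y \<omega>"
    using conv by (simp add: Y_def convergent_LIMSEQ_iff)
  define a where "a n = (\<integral>\<^sup>+\<omega>. ennreal \<bar>f (X n \<omega>) - Y \<omega>\<bar> \<partial>M)" for n
  have Yb: "AE \<omega> in M. 0 \<le> Y \<omega> \<and> Y \<omega> \<le> C"
    using Ylim
  proof eventually_elim
    case (elim \<omega>)
    then show ?case using f LIMSEQ_le_const[OF elim, of 0] LIMSEQ_le_const2[OF elim, of C] by auto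
  qed
  have a0: "a \<longlonglongrightarrow> 0"
  proof -
    have "(\<lambda>n. \<integral>\<^sup>+\<omega>. ennreal \<bar>f (X n \<omega>) - Y \<omega>\<bar> \<partial>M) \<longlonglongrightarrow> (\<integral>\<^sup>+\<omega>. 0 \<partial>M)"
    proof (rule nn_integral_dominated_convergence[where w = "\<lambda>_. ennreal C"])
      show "AE \<omega> in M. ennreal \<bar>f (X n \<omega>) - Y \<omega>\<bar> \<le> ennreal C" for n
        using Yb
      proof eventually_elim
        case (elim \<omega>)
        then show ?case using f(1)[of "X n \<omega>"] f(2)[of "X n \<omega>"] by (intro ennreal_leI) auto
      qed
      show "AE \<omega> in M. (\<lambda>n. ennreal \<bar>f (X n \<omega>) - Y \<omega>\<bar>) \<longlonglongrightarrow> 0"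
        using Ylim
      proof eventually_elim
        case (elim \<omega>)
        then have "(\<lambda>n. \<bar>f (X n \<omega>) - Y \<omega>\<bar>) \<longlonglongrightarrow> \<bar>Y \<omega> - Y \<omega>\<bar>" by (intro tendsto_intros)
        then show ?case using tendsto_ennrealI by fastforce
      qed
    qed (auto simp: emeasure_space_1)
    then show ?thesis by (simp add: a_def[abs_def])
  qed
  \<comment> \<open>Comparison through the limit \<open>Y\<close>; the term \<open>a (n + k)\<close>
    disappears as \<open>k\<close> grows.\<close>
  have tri: "(\<integral>\<^sup>+\<omega>. ennreal \<bar>f (X n \<omega>) - f (X (n + k) \<omega>)\<bar> \<partial>M) \<le> a n + a (n + k)" for n k
  proof -
    have "(\<integral>\<^sup>+\<omega>. ennreal \<bar>f (X n \<omega>) - f (X (n + k) \<omega>)\<bar> \<partial>M) \<le>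
      (\<integral>\<^sup>+\<omega>. ennreal \<bar>f (X n \<omega>) - Y \<omega>\<bar> + ennreal \<bar>f (X (n + k) \<omega>) - Y \<omega>\<bar> \<partial>M)"
      by (intro nn_integral_mono) (auto simp flip: ennreal_plus intro!: ennreal_leI)
    also have "\<dots> = a n + a (n + k)" unfolding a_def by (intro nn_integral_add) auto
    finally show ?thesis .
  qed
  have le: "(\<integral>\<^sup>+\<omega>. ennreal \<bar>f (X n \<omega>) - h (X n \<omega>)\<bar> \<partial>M) \<le> a n" for n
  proof -
    have m: "(\<lambda>\<omega>. \<integral>\<^sup>+z. ennreal \<bar>f (X n \<omega>) - f z\<bar> \<partial>step_pmf K k (X n \<omega>)) \<in> borel_measurable M" for k
      by (rule measurable_X_comp) simp
    have "(\<integral>\<^sup>+\<omega>. ennreal \<bar>f (X n \<omega>) - h (X n \<omega>)\<bar> \<partial>M) \<le>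
      (\<integral>\<^sup>+\<omega>. liminf (\<lambda>k. \<integral>\<^sup>+z. ennreal \<bar>f (X n \<omega>) - f z\<bar> \<partial>step_pmf K k (X n \<omega>)) \<partial>M)"
      by (intro nn_integral_mono diff)
    also have "\<dots> \<le> liminf (\<lambda>k. \<integral>\<^sup>+\<omega>. (\<integral>\<^sup>+z. ennreal \<bar>f (X n \<omega>) - f z\<bar> \<partial>step_pmf K k (X n \<omega>)) \<partial>M)"
      by (rule nn_integral_liminf) (rule m)
    also have "\<dots> = liminf (\<lambda>k. \<integral>\<^sup>+\<omega>. ennreal \<bar>f (X n \<omega>) - f (X (n + k) \<omega>)\<bar> \<partial>M)"
      using markov_multi_step[of "\<lambda>w z. ennreal \<bar>f w - f z\<bar>" n] by simp
    also have "\<dots> \<le> liminf (\<lambda>k. a n + a (n + k))"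
      by (intro Liminf_mono always_eventually) (simp add: tri)
    also have "\<dots> = a n + 0"
    proof (intro lim_imp_Liminf tendsto_add tendsto_const)
      show "(\<lambda>k. a (n + k)) \<longlonglongrightarrow> 0"
        using LIMSEQ_ignore_initial_segment[OF a0, of n] by (simp add: add.commute)
    qed simp
    finally show ?thesis by simp
  qed
  \<comment> \<open>Convergence in mean only identifies the limit of the difference; that the limit
    exists almost surely comes from the martingale \<open>h(X_n)\<close>.\<close>
  have "AE \<omega> in M. \<exists>l<\<infinity>. (\<lambda>n. ennreal (h (X n \<omega>))) \<longlonglongrightarrow> l"
    by (rule superharmonic_converges) (simp_all add: harm)
  then have hconv: "AE \<omega> in M. convergent (\<lambda>n. h (X n \<omega>))"
  proof eventually_elim
    case (elim \<omega>)
    then show ?case by (rule convergent_if_tendsto_ennreal) (rule h0)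
  qed
  have "(\<integral>\<^sup>+\<omega>. liminf (\<lambda>n. ennreal \<bar>f (X n \<omega>) - h (X n \<omega>)\<bar>) \<partial>M) \<le> liminf (\<lambda>n. \<integral>\<^sup>+\<omega>. ennreal \<bar>f (X n \<omega>) - h (X n \<omega>)\<bar> \<partial>M)"
    by (rule nn_integral_liminf) measurable
  also have "\<dots> \<le> liminf a" by (intro Liminf_mono always_eventually) (simp add: le)
  also have "\<dots> = 0" using a0 by (intro lim_imp_Liminf) auto
  finally have "(\<integral>\<^sup>+\<omega>. liminf (\<lambda>n. ennreal \<bar>f (X n \<omega>) - h (X n \<omega>)\<bar>) \<partial>M) = 0" by simp
  then have "AE \<omega> in M. liminf (\<lambda>n. ennreal \<bar>f (X n \<omega>) - h (X n \<omega>)\<bar>) = 0"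
    by (subst (asm) nn_integral_0_iff_AE) auto
  with hconv Ylim have "AE \<omega> in M. (\<lambda>n. \<bar>f (X n \<omega>) - h (X n \<omega>)\<bar>) \<longlonglongrightarrow> 0"
  proof eventually_elim
    case (elim \<omega>)
    then obtain l where l: "(\<lambda>n. h (X n \<omega>)) \<longlonglongrightarrow> l" by (auto simp: convergent_def)
    have d: "(\<lambda>n. \<bar>f (X n \<omega>) - h (X n \<omega>)\<bar>) \<longlonglongrightarrow> \<bar>Y \<omega> - l\<bar>"
      using elim l by (intro tendsto_intros) auto
    then have "(\<lambda>n. ennreal \<bar>f (X n \<omega>) - h (X n \<omega>)\<bar>) \<longlonglongrightarrow> ennreal \<bar>Y \<omega> - l\<bar>" by (rule tendsto_ennrealI)
    then have "liminf (\<lambda>n. ennreal \<bar>f (X n \<omega>) - h (X n \<omega>)\<bar>) = ennreal \<bar>Y \<omega> - l\<bar>" by (intro lim_imp_Liminf) auto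
    with elim have "\<bar>Y \<omega> - l\<bar> = 0" by simp
    with d show ?case by simp
  qed
  with h0 h_le harm that show ?thesis by blast
qed

text \<open>The mean of \<open>hitting\<close> at time \<open>n\<close> is the probability of a
  visit to \<open>A\<close> at time \<open>n\<close> or later, and these events decrease to a null
  event.\<close>

lemma hitting_tendsto_0:
  assumes "AE \<omega> in M. eventually (\<lambda>n. X n \<omega> \<notin> A) sequentially"
  shows "(\<lambda>n. \<integral>\<^sup>+y. hitting K A y \<partial>step_pmf K n x) \<longlonglongrightarrow> 0"
proof -
  have [measurable]: "Measurable.pred M (\<lambda>\<omega>. X n \<omega> \<in> A)" for n
    by (rule measurable_X_comp) simp
  have "(\<integral>\<^sup>+y. hitting K A y \<partial>step_pmf K n x) = (\<integral>\<^sup>+\<omega>. of_bool (\<exists>k\<ge>n. X k \<omega> \<in> A) \<partial>M)" for n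
    using hitting_event[of "\<lambda>_. 1" n A] by (simp add: nn_integral_X)
  moreover have "(\<lambda>n. \<integral>\<^sup>+\<omega>. of_bool (\<exists>k\<ge>n. X k \<omega> \<in> A) \<partial>M) \<longlonglongrightarrow> (\<integral>\<^sup>+\<omega>. 0 \<partial>M)"
  proof (rule nn_integral_dominated_convergence[where w = "\<lambda>_. 1"])
    show "(\<lambda>\<omega>. of_bool (\<exists>k\<ge>n. X k \<omega> \<in> A)) \<in> borel_measurable M" for n by measurable
    show "AE \<omega> in M. (\<lambda>n. of_bool (\<exists>k\<ge>n. X k \<omega> \<in> A)) \<longlonglongrightarrow> (0 :: ennreal)"
      using assms
    proof eventually_elim
      case (elim \<omega>)
      then obtain n where "\<And>k. k \<ge> n \<Longrightarrow> X k \<omega> \<notin> A" unfolding eventually_sequentially by blast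
      then have "eventually (\<lambda>j. of_bool (\<exists>k\<ge>j. X k \<omega> \<in> A) = (0 :: ennreal)) sequentially"
        unfolding eventually_sequentially by (intro exI[of _ n]) auto
      then show ?case by (rule tendsto_eventually)
    qed
  qed (auto simp: emeasure_space_1)
  ultimately show ?thesis by simp
qed

end

text \<open>The walk on \<open>M\<close> and the chain on \<open>N\<close> are not coupled; they
  share the kernel \<open>P\<close> and the starting point.\<close>

locale brw_chain = brw M B \<mu> P x\<^sub>0 m + X: countable_chain N X P x\<^sub>0
  for M :: "'w measure" and B :: "nat \<Rightarrow> 'w \<Rightarrow> 's::countable multiset" and \<mu> P x\<^sub>0 m
    and N :: "'v measure" and X :: "nat \<Rightarrow> 'v \<Rightarrow> 's" +
  assumes reach: "\<And>y. \<exists>k. 0 < pmf (step_pmf P k x\<^sub>0) y"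
begin

lemma Z_converges_nonneg:
  assumes f: "\<And>y. 0 \<le> f y" "\<And>y. f y \<le> C"
    and conv: "AE \<omega> in N. convergent (\<lambda>n. f (X n \<omega>))"
  shows "AE \<omega> in M. convergent (\<lambda>n. Z n f \<omega>)"
proof -
  have C: "0 \<le> C" using f(1)[of x\<^sub>0] f(2)[of x\<^sub>0] by simp
  obtain h where h: "\<And>y. 0 \<le> h y" "\<And>y. h y \<le> C"
    and harm: "\<And>y. (\<integral>\<^sup>+z. ennreal (h z) \<partial>P y) = ennreal (h y)"
    and fh: "AE \<omega> in N. (\<lambda>n. \<bar>f (X n \<omega>) - h (X n \<omega>)\<bar>) \<longlonglongrightarrow> 0"
    using X.ex_harmonic_asymptotic[OF f conv reach] by blast
  \<comment> \<open>Countably many tolerances. Off \<open>A j\<close> the difference of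
    \<open>f\<close> and \<open>h\<close> is at most \<open>1 / Suc j\<close>; on \<open>A j\<close>
    it is at most \<open>C\<close>, while \<open>q j\<close> is at least 1 there.\<close>
  define A where "A j = {y. \<bar>f y - h y\<bar> > 1 / real (Suc j)}" for j
  define q where "q j y = enn2real (hitting P (A j) y)" for j y
  have fin: "hitting P (A j) y \<noteq> \<top>" for j y
    using hitting_le_1[of P "A j" y] by (auto simp: top_unique)
  have eq: "ennreal (q j y) = hitting P (A j) y" for j y
    using fin by (simp add: q_def less_top)
  have q0: "0 \<le> q j y" for j y by (simp add: q_def)
  have qA: "indicator (A j) y \<le> q j y" for j y
  proof -
    have "ennreal (indicator (A j) y) \<le> ennreal (q j y)"
      using hitting_ge_indicator[of "A j" y P] unfolding eq by (simp add: ennreal_indicator)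
    then show ?thesis using q0 by (simp add: ennreal_le_iff)
  qed
  have "AE \<omega> in M. (\<lambda>n. Z n (q j) \<omega>) \<longlonglongrightarrow> 0" for j
  proof (rule Z_tendsto_0[OF q0])
    show "(\<integral>\<^sup>+y. ennreal (q j y) \<partial>P x) \<le> ennreal (q j x)" for x
      unfolding eq by (rule nn_integral_hitting)
    have "AE \<omega> in N. eventually (\<lambda>n. X n \<omega> \<notin> A j) sequentially"
      using fh
    proof eventually_elim
      case (elim \<omega>)
      then have "eventually (\<lambda>n. \<bar>f (X n \<omega>) - h (X n \<omega>)\<bar> < 1 / real (Suc j)) sequentially"
        by (rule order_tendstoD) simp
      then show ?case by eventually_elim (simp add: A_def)
    qed
    then show "(\<lambda>n. \<integral>\<^sup>+y. ennreal (q j y) \<partial>step_pmf P n x\<^sub>0) \<longlonglongrightarrow> 0"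
      unfolding eq by (rule X.hitting_tendsto_0)
  qed
  then have "AE \<omega> in M. \<forall>j. (\<lambda>n. Z n (q j) \<omega>) \<longlonglongrightarrow> 0"
    by (simp add: AE_all_countable)
  moreover have "AE \<omega> in M. convergent (\<lambda>n. Z n h \<omega>)"
    by (rule Z_superharmonic_converges[OF h(1)]) (simp add: harm)
  ultimately show ?thesis using Z_one_converges
  proof eventually_elim
    case (elim \<omega>)
    obtain W where W: "(\<lambda>n. Z n (\<lambda>_. 1) \<omega>) \<longlonglongrightarrow> W" using elim by (auto simp: convergent_def)
    obtain H where H: "(\<lambda>n. Z n h \<omega>) \<longlonglongrightarrow> H" using elim by (auto simp: convergent_def)
    have W0: "0 \<le> W" by (rule LIMSEQ_le_const[OF W]) (auto intro!: exI[of _ 0] Z_nonneg)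
    have bound: "\<bar>Z n f \<omega> - Z n h \<omega>\<bar> \<le> (1 / real (Suc j)) * Z n (\<lambda>_. 1) \<omega> + C * Z n (q j) \<omega>" for n j
    proof -
      have le: "\<bar>f y - h y\<bar> \<le> (1 / real (Suc j)) * 1 + C * q j y" for y
      proof (cases "y \<in> A j")
        case True
        have "\<bar>f y - h y\<bar> \<le> C * 1" using f(1)[of y] f(2)[of y] h(1)[of y] h(2)[of y] by auto
        also have "\<dots> \<le> C * q j y" using qA[of j y] True C by (intro mult_left_mono) auto
        also have "\<dots> \<le> (1 / real (Suc j)) * 1 + C * q j y" by simp
        finally show ?thesis .
      next
        case False
        then have "\<bar>f y - h y\<bar> \<le> 1 / real (Suc j)" by (simp add: A_def)
        then show ?thesis using C q0[of j y] by (simp add: add_increasing2)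
      qed
      have up: "f y \<le> h y + ((1 / real (Suc j)) * 1 + C * q j y)"
        and lo: "h y \<le> f y + ((1 / real (Suc j)) * 1 + C * q j y)" for y
        using le[of y] by auto
      show ?thesis
        using Z_mono[of f _ n \<omega>, OF up] Z_mono[of h _ n \<omega>, OF lo] unfolding Z_add Z_cmult by auto
    qed
    have "(\<lambda>n. Z n f \<omega> - Z n h \<omega>) \<longlonglongrightarrow> 0"
    proof (rule LIMSEQ_I)
      fix r :: real assume r: "0 < r"
      \<comment> \<open>First \<open>j\<close> is chosen to make the tolerance times the limiting
        mass \<open>W\<close> smaller than \<open>r\<close>; for this fixed \<open>j\<close> the
        remaining term tends to 0 in \<open>n\<close>.\<close>
      obtain j where "W < real j * r" using reals_Archimedean3[OF r] by blast
      also have "real j * r \<le> real (Suc j) * r" using r by (intro mult_right_mono) auto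
      finally have j: "W < real (Suc j) * r" .
      have "(\<lambda>n. (1 / real (Suc j)) * Z n (\<lambda>_. 1) \<omega> + C * Z n (q j) \<omega>) \<longlonglongrightarrow> (1 / real (Suc j)) * W + C * 0"
        using elim W by (intro tendsto_intros) auto
      moreover have "(1 / real (Suc j)) * W + C * 0 < r" using j by (simp add: field_simps)
      ultimately have "eventually (\<lambda>n. (1 / real (Suc j)) * Z n (\<lambda>_. 1) \<omega> + C * Z n (q j) \<omega> < r) sequentially"
        by (rule order_tendstoD)
      then have "eventually (\<lambda>n. norm (Z n f \<omega> - Z n h \<omega> - 0) < r) sequentially"
        by eventually_elim (use bound in \<open>auto intro: le_less_trans\<close>)
      then show "\<exists>no. \<forall>n\<ge>no. norm (Z n f \<omega> - Z n h \<omega> - 0) < r" by (simp add: eventually_sequentially)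
    qed
    then have "(\<lambda>n. (Z n f \<omega> - Z n h \<omega>) + Z n h \<omega>) \<longlonglongrightarrow> 0 + H" using H by (rule tendsto_add)
    then show ?case by (auto simp: convergent_def)
  qed
qed

lemma Z_converges:
  assumes f: "\<And>y. \<bar>f y\<bar> \<le> C"
    and conv: "AE \<omega> in N. convergent (\<lambda>n. f (X n \<omega>))"
  shows "AE \<omega> in M. convergent (\<lambda>n. Z n f \<omega>)"
proof -
  have "AE \<omega> in M. convergent (\<lambda>n. Z n (\<lambda>y. f y + C * 1) \<omega>)"
  proof (rule Z_converges_nonneg)
    show "0 \<le> f y + C * 1" "f y + C * 1 \<le> 2 * C" for y using f[of y] by auto
    show "AE \<omega> in N. convergent (\<lambda>n. f (X n \<omega>) + C * 1)"
      using conv by eventually_elim (intro convergent_add convergent_const)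
  qed
  with Z_one_converges show ?thesis
  proof eventually_elim
    case (elim \<omega>)
    then have "convergent (\<lambda>n. (Z n f \<omega> + C * Z n (\<lambda>_. 1) \<omega>) - C * Z n (\<lambda>_. 1) \<omega>)"
      unfolding Z_add Z_cmult by (intro convergent_diff convergent_mult convergent_const) auto
    then show ?case by simp
  qed
qed

end

section \<open>The Kesten--Stigum theorem\<close>

lemma exp_minus_le:
  fixes x :: real
  assumes "0 \<le> x"
  shows "exp (- x) \<le> 1 - x + x\<^sup>2"
proof -
  have "exp (- x) \<le> 1 / (1 + x)"
    using assms exp_ge_add_one_self[of x] by (simp add: exp_minus field_simps)
  also have "\<dots> \<le> 1 - x + x\<^sup>2"
  proof -
    have "1 \<le> (1 - x + x\<^sup>2) * (1 + x)" using assms by (simp add: algebra_simps power2_eq_square)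
    then show ?thesis using assms by (simp add: divide_le_eq)
  qed
  finally show ?thesis .
qed

text \<open>Quadratic expansion while \<open>k * s \<le> 1\<close>. Beyond that the minimum is 1 and
  the right side equals 1, so the error grows only linearly in \<open>k\<close> and is integrable
  with a first moment.\<close>

lemma one_minus_power_le:
  fixes s :: real
  assumes "0 \<le> s" "s \<le> 1"
  shows "(1 - s) ^ k \<le> 1 - real k * s + s * (real k * min 1 (real k * s))"
proof (cases "real k * s \<le> 1")
  case True
  have "(1 - s) ^ k \<le> exp (- s) ^ k"
    using assms exp_ge_add_one_self[of "- s"] by (intro power_mono) auto
  also have "\<dots> = exp (- (real k * s))" by (simp add: exp_of_nat_mult[symmetric])
  also have "\<dots> \<le> 1 - real k * s + (real k * s)\<^sup>2" using assms by (intro exp_minus_le) auto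
  finally show ?thesis using True by (simp add: power2_eq_square ac_simps)
next
  case False
  have "(1 - s) ^ k \<le> 1" using assms by (intro power_le_one) auto
  with False show ?thesis by (simp add: mult.commute)
qed

text \<open>About \<open>ln n / ln m\<close> terms have \<open>m ^ k < n\<close> and are bounded by
  1; the others are dominated by a geometric series. This is the origin of the logarithm in
  \<open>L log L\<close>.\<close>

lemma suminf_min_geometric_le:
  fixes m :: real
  assumes "1 < m"
  shows "(\<Sum>k. ennreal (min 1 (real n / m ^ k))) \<le> ennreal (2 + ln (real n) / ln m + 1 / (1 - 1 / m))"
proof (cases "n = 0")
  case True
  have "0 \<le> 1 / (1 - 1 / m)" using assms by simp
  then show ?thesis using True by simp
next
  case False
  then have n: "1 \<le> real n" by simp
  have lm: "0 < ln m" using assms by simp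
  define K where "K = nat \<lceil>ln (real n) / ln m\<rceil>"
  have q: "0 \<le> ln (real n) / ln m" using n lm by simp
  have K1: "ln (real n) / ln m \<le> real K" unfolding K_def by (simp add: real_nat_ceiling_ge)
  have K2: "real K \<le> ln (real n) / ln m + 1" unfolding K_def using q by linarith
  have "ln (real n) \<le> real K * ln m" using K1 lm by (simp add: field_simps)
  also have "\<dots> = ln (m ^ K)" using assms by (simp add: ln_realpow)
  finally have nK: "real n \<le> m ^ K" using n assms by (subst (asm) ln_le_cancel_iff) auto
  have "(\<Sum>k. ennreal (min 1 (real n / m ^ k))) = (\<Sum>k. ennreal (min 1 (real n / m ^ (k + K)))) + (\<Sum>k<K. ennreal (min 1 (real n / m ^ k)))"
    by (rule suminf_offset) simp
  also have "\<dots> \<le> (\<Sum>k. ennreal ((1 / m) ^ k)) + (\<Sum>k<K. 1)"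
  proof (intro add_mono suminf_le sum_mono)
    fix k
    have "real n / m ^ (k + K) \<le> m ^ K / m ^ (k + K)" using nK assms by (intro divide_right_mono) auto
    also have "\<dots> = (1 / m) ^ k" using assms by (simp add: power_add power_one_over)
    finally show "ennreal (min 1 (real n / m ^ (k + K))) \<le> ennreal ((1 / m) ^ k)"
      by (intro ennreal_leI) simp
    show "ennreal (min 1 (real n / m ^ k)) \<le> 1" by (simp add: ennreal_le_1)
  qed auto
  also have "(\<Sum>k. ennreal ((1 / m) ^ k)) = ennreal (1 / (1 - 1 / m))"
    using assms by (subst suminf_ennreal2) (auto simp: suminf_geometric intro!: summable_geometric)
  also have "(\<Sum>k<K. 1 :: ennreal) = ennreal (real K)" by (simp add: ennreal_of_nat_eq_real_of_nat)
  also have "ennreal (1 / (1 - 1 / m)) + ennreal (real K) = ennreal (1 / (1 - 1 / m) + real K)"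
    using assms by (intro ennreal_plus[symmetric]) auto
  also have "\<dots> \<le> ennreal (2 + ln (real n) / ln m + 1 / (1 - 1 / m))"
    using K2 by (intro ennreal_leI) simp
  finally show ?thesis .
qed

section \<open>Generating function and Laplace transform of the population size\<close>

context brw
begin

definition pgf :: "real \<Rightarrow> real" where
  "pgf s = (\<integral>k. s ^ k \<partial>\<mu>)"

text \<open>A bound for the defect \<open>m - (1 - pgf (1 - s)) / s\<close>; the \<open>L log L\<close> condition is its summability
  along \<open>s = m\<^sup>-\<^sup>k\<close>.\<close>

definition \<eta> :: "real \<Rightarrow> real" where
  "\<eta> s = (\<integral>k. real k * min 1 (real k * s) \<partial>\<mu>)"

lemma integrable_of_nat: "integrable \<mu> real"
  using mean by (intro integrableI_bounded) (auto simp: ennreal_of_nat_eq_real_of_nat)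

lemma integral_of_nat: "(\<integral>k. real k \<partial>\<mu>) = m"
proof -
  have "ennreal (\<integral>k. real k \<partial>\<mu>) = (\<integral>\<^sup>+k. ennreal (real k) \<partial>\<mu>)"
    by (rule nn_integral_eq_integral[symmetric, OF integrable_of_nat]) simp
  also have "\<dots> = ennreal m" using mean by (simp add: ennreal_of_nat_eq_real_of_nat)
  finally show ?thesis using m1 by (subst (asm) ennreal_inj) (auto intro: Bochner_Integration.integral_nonneg)
qed

lemma integrable_eta: "0 \<le> s \<Longrightarrow> integrable \<mu> (\<lambda>k. real k * min 1 (real k * s))"
  by (rule Bochner_Integration.integrable_bound[OF integrable_of_nat]) (auto intro!: AE_I2 mult_left_le)

lemma eta_mono: "0 \<le> s \<Longrightarrow> s \<le> t \<Longrightarrow> \<eta> s \<le> \<eta> t"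
  unfolding \<eta>_def
  by (intro integral_mono integrable_eta mult_left_mono min.mono) (auto intro: mult_left_mono)

lemma eta_nonneg: "0 \<le> s \<Longrightarrow> 0 \<le> \<eta> s"
  unfolding \<eta>_def by (intro Bochner_Integration.integral_nonneg) auto

lemma integrable_power:
  fixes s :: real
  assumes "0 \<le> s" "s \<le> 1"
  shows "integrable \<mu> (\<lambda>k. s ^ k)"
  by (rule Bochner_Integration.integrable_bound[where f = "\<lambda>_. 1 :: real"]) (use assms in \<open>auto simp: power_le_one\<close>)

lemma pgf_bounds:
  assumes "0 \<le> s" "s \<le> 1"
  shows "0 \<le> pgf s" "pgf s \<le> 1"
proof -
  show "0 \<le> pgf s" unfolding pgf_def using assms by (intro Bochner_Integration.integral_nonneg) auto
  have "pgf s \<le> (\<integral>k. 1 \<partial>\<mu>)"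
    unfolding pgf_def using assms by (intro integral_mono integrable_power) (auto simp: power_le_one)
  then show "pgf s \<le> 1" by simp
qed

lemma pgf_ge:
  assumes "0 \<le> s" "s \<le> 1"
  shows "1 - m * s \<le> pgf (1 - s)"
proof -
  have "1 - m * s = (\<integral>k. 1 - real k * s \<partial>\<mu>)"
    using integrable_of_nat by (simp add: integral_of_nat Bochner_Integration.integral_diff)
  also have "\<dots> \<le> pgf (1 - s)"
    unfolding pgf_def using assms integrable_of_nat Bernoulli_inequality[of "- s"]
    by (intro integral_mono integrable_power) auto
  finally show ?thesis .
qed

lemma pgf_le:
  assumes "0 \<le> s" "s \<le> 1"
  shows "pgf (1 - s) \<le> 1 - m * s + s * \<eta> s"
proof -
  have "pgf (1 - s) \<le> (\<integral>k. 1 - real k * s + s * (real k * min 1 (real k * s)) \<partial>\<mu>)"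
    unfolding pgf_def using assms integrable_of_nat integrable_eta[of s]
    by (intro integral_mono integrable_power one_minus_power_le) auto
  also have "\<dots> = 1 - m * s + s * \<eta> s"
    using integrable_of_nat integrable_eta[of s] assms
    by (subst Bochner_Integration.integral_add)
      (auto simp: integral_of_nat Bochner_Integration.integral_diff \<eta>_def)
  finally show ?thesis .
qed

lemma pgf_iterate_bounds:
  assumes "0 \<le> s" "s \<le> 1"
  shows "0 \<le> (pgf ^^ n) s \<and> (pgf ^^ n) s \<le> 1"
  by (induction n) (auto simp: assms intro: pgf_bounds)

lemma nn_integral_power_size:
  assumes "0 \<le> s" "s \<le> 1"
  shows "(\<integral>\<^sup>+\<omega>. ennreal (s ^ size (B n \<omega>)) \<partial>M) = ennreal ((pgf ^^ n) s)"
  using assms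
proof (induction n arbitrary: s)
  case 0
  show ?case using nn_integral_start[of "\<lambda>b. ennreal (s ^ size b)"] by simp
next
  case (Suc n)
  have p: "(\<integral>\<^sup>+k. ennreal (s ^ k) \<partial>\<mu>) = ennreal (pgf s)"
    unfolding pgf_def using Suc.prems by (intro nn_integral_eq_integral integrable_power) auto
  have "(\<integral>\<^sup>+\<omega>. ennreal (s ^ size (B (Suc n) \<omega>)) \<partial>M) =
    (\<integral>\<^sup>+\<omega>. ennreal (pgf s) ^ size (B n \<omega>) \<partial>M)"
    using Suc.prems
    by (subst nn_integral_next[of "\<lambda>b. ennreal (s ^ size b)"]) (simp add: nn_integral_brw_kernel_power p)
  also have "\<dots> = (\<integral>\<^sup>+\<omega>. ennreal (pgf s ^ size (B n \<omega>)) \<partial>M)"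
    using pgf_bounds[OF Suc.prems] by (simp add: ennreal_power)
  also have "\<dots> = ennreal ((pgf ^^ n) (pgf s))" by (intro Suc.IH pgf_bounds Suc.prems)
  finally show ?case by (simp add: funpow_swap1)
qed

text \<open>This is \<open>1 - E exp (- t Z_n(1))\<close>. The complement keeps the recursion near
  0, where \<open>1 - pgf (1 - s)\<close> is compared with \<open>m * s\<close>.\<close>

definition lapl :: "nat \<Rightarrow> real \<Rightarrow> real" where
  "lapl n t = 1 - (pgf ^^ n) (exp (- (t / m ^ n)))"

lemma lapl_Suc: "lapl (Suc n) t = 1 - pgf (1 - lapl n (t / m))"
  by (simp add: lapl_def)

lemma lapl_eq:
  assumes "0 \<le> t"
  shows "expectation (\<lambda>\<omega>. exp (- (t * Z n (\<lambda>_. 1) \<omega>))) = 1 - lapl n t"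
proof -
  let ?s = "exp (- (t / m ^ n))"
  have s: "0 \<le> ?s" "?s \<le> 1" using assms m1 by auto
  have eq: "exp (- (t * Z n (\<lambda>_. 1) \<omega>)) = ?s ^ size (B n \<omega>)" for \<omega>
    by (simp add: Z_def exp_of_nat_mult[symmetric] field_simps)
  have "expectation (\<lambda>\<omega>. ?s ^ size (B n \<omega>)) = enn2real (\<integral>\<^sup>+\<omega>. ennreal (?s ^ size (B n \<omega>)) \<partial>M)"
    using measurable_X_comp[of "\<lambda>b. ?s ^ size b" borel n] by (intro integral_eq_nn_integral) auto
  also have "\<dots> = (pgf ^^ n) ?s"
    using pgf_iterate_bounds[OF s] by (simp add: nn_integral_power_size[OF s])
  finally show ?thesis unfolding eq by (simp add: lapl_def)
qed

lemma lapl_bounds: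
  assumes "0 \<le> t"
  shows "0 \<le> lapl n t" "lapl n t \<le> 1" "lapl n t \<le> t"
proof -
  have b: "0 \<le> lapl n t \<and> lapl n t \<le> 1" if "0 \<le> t" for n t
    using pgf_iterate_bounds[of "exp (- (t / m ^ n))" n] that m1 by (auto simp: lapl_def)
  show "0 \<le> lapl n t" "lapl n t \<le> 1" using b assms by auto
  show "lapl n t \<le> t"
    using assms
  proof (induction n arbitrary: t)
    case 0
    show ?case using exp_ge_add_one_self[of "- t"] by (simp add: lapl_def)
  next
    case (Suc n)
    have t: "0 \<le> t / m" using Suc.prems m1 by simp
    have "lapl (Suc n) t \<le> m * lapl n (t / m)"
      unfolding lapl_Suc using pgf_ge[of "lapl n (t / m)"] b[OF t, of n] by simp
    also have "\<dots> \<le> m * (t / m)" using m1 by (intro mult_left_mono Suc.IH t) auto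
    finally show ?case using m1 by simp
  qed
qed

text \<open>Each generation loses at most \<open>a * \<eta> a\<close> against the linear recursion
  \<open>m * a\<close>, where \<open>a\<close> is controlled by \<open>lapl_bounds\<close>. After
  rescaling the losses add up to the sum, and \<open>t\<^sup>2 / m ^ n\<close> is the rescaled error
  of the initial term \<open>1 - exp (- t / m ^ n)\<close>.\<close>

lemma lapl_lower:
  assumes "0 \<le> t"
  shows "t - t\<^sup>2 / m ^ n - t / m * (\<Sum>k<n. \<eta> (t / m ^ Suc k)) \<le> lapl n t"
  using assms
proof (induction n arbitrary: t)
  case 0
  show ?case using exp_minus_le[OF 0] by (simp add: lapl_def)
next
  case (Suc n)
  have t: "0 \<le> t / m" using Suc.prems m1 by simp
  let ?a = "lapl n (t / m)"
  have "t - t\<^sup>2 / m ^ Suc n - t / m * (\<Sum>k<Suc n. \<eta> (t / m ^ Suc k)) =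
    m * (t / m - (t / m)\<^sup>2 / m ^ n - t / m / m * (\<Sum>k<n. \<eta> (t / m / m ^ Suc k))) - t / m * \<eta> (t / m)"
    using m1 by (simp add: sum.lessThan_Suc_shift field_simps power2_eq_square del: sum.lessThan_Suc)
  also have "\<dots> \<le> m * ?a - ?a * \<eta> ?a"
  proof (rule diff_mono)
    show "m * (t / m - (t / m)\<^sup>2 / m ^ n - t / m / m * (\<Sum>k<n. \<eta> (t / m / m ^ Suc k))) \<le> m * ?a"
      using m1 by (intro mult_left_mono Suc.IH t) auto
    show "?a * \<eta> ?a \<le> t / m * \<eta> (t / m)"
      using lapl_bounds[OF t, of n] t by (intro mult_mono eta_mono eta_nonneg) auto
  qed
  also have "\<dots> \<le> lapl (Suc n) t"
    unfolding lapl_Suc using pgf_le[of ?a] lapl_bounds[OF t, of n] by simp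
  finally show ?case .
qed

text \<open>The sum over \<open>k\<close> is taken inside the integral, where
  \<open>suminf_min_geometric_le\<close> leaves a multiple of \<open>n\<close> plus a multiple of
  \<open>n * ln n\<close>.\<close>

lemma summable_eta:
  assumes "summable (\<lambda>n. pmf \<mu> n * (real n * ln (real n)))"
  shows "summable (\<lambda>k. \<eta> (1 / m ^ k))"
proof -
  have eta_nn: "ennreal (\<eta> (1 / m ^ k)) = (\<integral>\<^sup>+n. ennreal (real n * min 1 (real n / m ^ k)) \<partial>\<mu>)" for k
    unfolding \<eta>_def using m1 integrable_eta[of "1 / m ^ k"] by (subst nn_integral_eq_integral) auto
  let ?c = "2 + 1 / (1 - 1 / m)"
  have c: "0 \<le> ?c" using m1 by simp
  have lm: "0 < ln m" using m1 by simp
  have log: "(\<integral>\<^sup>+n. ennreal (real n * ln (real n)) \<partial>\<mu>) \<noteq> \<top>"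
  proof -
    have nn: "0 \<le> real n * ln (real n)" for n by (cases "n = 0") auto
    have "(\<integral>\<^sup>+n. ennreal (real n * ln (real n)) \<partial>\<mu>) = (\<Sum>n. ennreal (pmf \<mu> n * (real n * ln (real n))))"
      unfolding nn_integral_measure_pmf nn_integral_count_space_nat
      by (intro suminf_cong ennreal_mult[symmetric] nn) simp
    also have "\<dots> \<noteq> \<top>" by (intro ennreal_suminf_neq_top assms mult_nonneg_nonneg[OF pmf_nonneg nn])
    finally show ?thesis .
  qed
  have "(\<Sum>k. ennreal (\<eta> (1 / m ^ k))) = (\<integral>\<^sup>+n. (\<Sum>k. ennreal (real n * min 1 (real n / m ^ k))) \<partial>\<mu>)"
    unfolding eta_nn by (rule nn_integral_suminf[symmetric]) simp
  also have "\<dots> \<le> (\<integral>\<^sup>+n. ennreal ?c * of_nat n + ennreal (1 / ln m) * ennreal (real n * ln (real n)) \<partial>\<mu>)"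
  proof (rule nn_integral_mono)
    fix n
    have "(\<Sum>k. ennreal (real n * min 1 (real n / m ^ k))) = ennreal (real n) * (\<Sum>k. ennreal (min 1 (real n / m ^ k)))"
      using m1 by (simp add: ennreal_mult)
    also have "\<dots> \<le> ennreal (real n) * ennreal (2 + ln (real n) / ln m + 1 / (1 - 1 / m))"
      by (intro mult_left_mono suminf_min_geometric_le m1) simp
    also have "\<dots> = ennreal (?c * real n + 1 / ln m * (real n * ln (real n)))"
    proof -
      have "real n * (2 + ln (real n) / ln m + 1 / (1 - 1 / m)) = ?c * real n + 1 / ln m * (real n * ln (real n))"
        by (simp add: algebra_simps)
      then show ?thesis by (simp flip: ennreal_mult')
    qed
    also have "\<dots> = ennreal ?c * of_nat n + ennreal (1 / ln m) * ennreal (real n * ln (real n))"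
    proof -
      have nn: "0 \<le> real n * ln (real n)" by (cases "n = 0") auto
      have "ennreal (?c * real n + 1 / ln m * (real n * ln (real n))) = ennreal (?c * real n) + ennreal (1 / ln m * (real n * ln (real n)))"
        using c lm by (intro ennreal_plus mult_nonneg_nonneg[OF _ nn] mult_nonneg_nonneg[OF c]) auto
      also have "\<dots> = ennreal ?c * of_nat n + ennreal (1 / ln m) * ennreal (real n * ln (real n))"
        using ennreal_mult[OF c, of "real n"] ennreal_mult[OF _ nn, of "1 / ln m"] lm
        by (simp only: ennreal_of_nat_eq_real_of_nat) simp
      finally show ?thesis .
    qed
    finally show "(\<Sum>k. ennreal (real n * min 1 (real n / m ^ k))) \<le> ennreal ?c * of_nat n + ennreal (1 / ln m) * ennreal (real n * ln (real n))" .
  qed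
  also have "\<dots> = ennreal ?c * ennreal m + ennreal (1 / ln m) * (\<integral>\<^sup>+n. ennreal (real n * ln (real n)) \<partial>\<mu>)"
    by (simp add: nn_integral_add nn_integral_cmult mean)
  also have "\<dots> < \<top>"
    using log by (simp add: ennreal_mult_less_top less_top)
  finally show ?thesis
    using m1 by (intro summable_suminf_not_top) (auto intro: eta_nonneg)
qed

text \<open>Fatou's lemma gives at most 1. For the converse, \<open>lapl n t\<close> tends to
  \<open>E (1 - exp (- t W)) \<le> t * E W\<close>, while \<open>lapl_lower\<close> keeps it close
  to \<open>t\<close>. With \<open>t = 1 / m ^ j\<close> the relative loss is a tail of the series
  of \<open>\<eta>\<close>, which vanishes as \<open>j\<close> grows.\<close>

lemma nn_integral_lim_Z_one:
  assumes log: "summable (\<lambda>n. pmf \<mu> n * (real n * ln (real n)))"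
  shows "(\<integral>\<^sup>+\<omega>. ennreal (lim (\<lambda>n. Z n (\<lambda>_. 1) \<omega>)) \<partial>M) = 1"
proof -
  define W where "W \<omega> = lim (\<lambda>n. Z n (\<lambda>_. 1) \<omega>)" for \<omega>
  have [measurable]: "W \<in> borel_measurable M" unfolding W_def by measurable
  have Wlim: "AE \<omega> in M. (\<lambda>n. Z n (\<lambda>_. 1) \<omega>) \<longlonglongrightarrow> W \<omega>"
    using Z_one_converges by (simp add: W_def convergent_LIMSEQ_iff)
  have Z0: "0 \<le> Z n (\<lambda>_. 1) \<omega>" for n \<omega> by (rule Z_nonneg) simp
  have W0: "AE \<omega> in M. 0 \<le> W \<omega>"
    using Wlim
  proof eventually_elim
    case (elim \<omega>)
    then show ?case using Z0 by (intro LIMSEQ_le_const[OF elim]) auto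
  qed
  have le1: "(\<integral>\<^sup>+\<omega>. ennreal (W \<omega>) \<partial>M) \<le> 1"
  proof -
    have "(\<integral>\<^sup>+\<omega>. ennreal (W \<omega>) \<partial>M) = (\<integral>\<^sup>+\<omega>. liminf (\<lambda>n. ennreal (Z n (\<lambda>_. 1) \<omega>)) \<partial>M)"
    proof (rule nn_integral_cong_AE)
      show "AE \<omega> in M. ennreal (W \<omega>) = liminf (\<lambda>n. ennreal (Z n (\<lambda>_. 1) \<omega>))"
        using Wlim by eventually_elim (intro lim_imp_Liminf[symmetric] tendsto_ennrealI; simp)
    qed
    also have "\<dots> \<le> liminf (\<lambda>n. \<integral>\<^sup>+\<omega>. ennreal (Z n (\<lambda>_. 1) \<omega>) \<partial>M)"
      by (rule nn_integral_liminf) measurable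
    also have "\<dots> = 1"
      using nn_integral_Z[where f = "\<lambda>_. 1"] by (simp add: ennreal_Z measure_pmf.emeasure_space_1[simplified] Liminf_const)
    finally show ?thesis .
  qed
  then have fin: "(\<integral>\<^sup>+\<omega>. ennreal (W \<omega>) \<partial>M) < \<infinity>" by (auto intro: le_less_trans)
  have intW: "integrable M W"
    using W0 fin by (intro integrableI_nonneg) auto
  have EW: "(\<integral>\<^sup>+\<omega>. ennreal (W \<omega>) \<partial>M) = ennreal (expectation W)"
    by (rule nn_integral_eq_integral[OF intW W0])
  have sum: "summable (\<lambda>k. \<eta> (1 / m ^ k))" by (rule summable_eta[OF log])
  have lower: "1 - (1 / m) * (\<Sum>k. \<eta> (1 / m ^ (k + Suc j))) \<le> expectation W" for j
  proof -
    define t where "t = 1 / m ^ j"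
    have t: "0 < t" using m1 by (simp add: t_def)
    let ?S = "\<Sum>k. \<eta> (1 / m ^ (k + Suc j))"
    have sum': "summable (\<lambda>k. \<eta> (1 / m ^ (k + Suc j)))"
      using sum by (rule summable_ignore_initial_segment)
    \<comment> \<open>Here \<open>n\<close> tends to infinity with \<open>t\<close> fixed, which
      removes the initial error; \<open>t\<close> becomes small only afterwards.\<close>
    have "(\<lambda>n. t - t\<^sup>2 / m ^ n - t / m * ?S) \<longlonglongrightarrow> t - 0 - t / m * ?S"
      using m1 by (intro tendsto_diff tendsto_const LIMSEQ_divide_realpow_zero)
    moreover have "(\<lambda>n. lapl n t) \<longlonglongrightarrow> 1 - expectation (\<lambda>\<omega>. exp (- (t * W \<omega>)))"
    proof -
      have "(\<lambda>n. expectation (\<lambda>\<omega>. exp (- (t * Z n (\<lambda>_. 1) \<omega>)))) \<longlonglongrightarrow> expectation (\<lambda>\<omega>. exp (- (t * W \<omega>)))"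
      proof (rule integral_dominated_convergence[where w = "\<lambda>_. 1"])
        show "AE \<omega> in M. (\<lambda>n. exp (- (t * Z n (\<lambda>_. 1) \<omega>))) \<longlonglongrightarrow> exp (- (t * W \<omega>))"
          using Wlim by eventually_elim (intro tendsto_intros)
        show "AE \<omega> in M. norm (exp (- (t * Z n (\<lambda>_. 1) \<omega>))) \<le> 1" for n
          using t Z0 by auto
      qed auto
      then have "(\<lambda>n. 1 - lapl n t) \<longlonglongrightarrow> expectation (\<lambda>\<omega>. exp (- (t * W \<omega>)))"
        using t by (simp add: lapl_eq)
      then have "(\<lambda>n. 1 - (1 - lapl n t)) \<longlonglongrightarrow> 1 - expectation (\<lambda>\<omega>. exp (- (t * W \<omega>)))"
        by (intro tendsto_diff tendsto_const)
      then show ?thesis by simp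
    qed
    moreover have "t - t\<^sup>2 / m ^ n - t / m * ?S \<le> lapl n t" for n
    proof -
      have "(\<Sum>k<n. \<eta> (t / m ^ Suc k)) = (\<Sum>k<n. \<eta> (1 / m ^ (k + Suc j)))"
        by (simp add: t_def power_add ac_simps)
      also have "\<dots> \<le> ?S" using m1 by (intro sum_le_suminf sum') (auto intro: eta_nonneg)
      finally have "t / m * (\<Sum>k<n. \<eta> (t / m ^ Suc k)) \<le> t / m * ?S"
        using t m1 by (intro mult_left_mono) auto
      then show ?thesis using lapl_lower[of t n] t by simp
    qed
    ultimately have "t - t / m * ?S \<le> 1 - expectation (\<lambda>\<omega>. exp (- (t * W \<omega>)))"
      by (intro LIMSEQ_le) auto
    also have "\<dots> \<le> t * expectation W"
    proof -
      have i: "integrable M (\<lambda>\<omega>. exp (- (t * W \<omega>)))"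
        by (rule integrable_const_bound[where B = 1]) (use W0 t in auto)
      have "expectation (\<lambda>\<omega>. 1 - t * W \<omega>) \<le> expectation (\<lambda>\<omega>. exp (- (t * W \<omega>)))"
        using intW i exp_ge_add_one_self[of "- (t * W \<omega>)" for \<omega>] by (intro integral_mono) auto
      moreover have "expectation (\<lambda>\<omega>. 1 - t * W \<omega>) = 1 - t * expectation W"
        using intW by (simp add: Bochner_Integration.integral_diff prob_space)
      ultimately show ?thesis by simp
    qed
    finally have "t * (1 - (1 / m) * ?S) \<le> t * expectation W" by (simp add: algebra_simps)
    then show ?thesis using t by simp
  qed
  have "(\<lambda>j. 1 - (1 / m) * (\<Sum>k. \<eta> (1 / m ^ (k + Suc j)))) \<longlonglongrightarrow> 1 - (1 / m) * 0"
    using LIMSEQ_Suc[OF suminf_exist_split2[OF sum]] by (intro tendsto_intros)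
  then have "1 \<le> expectation W"
    using lower by (intro LIMSEQ_le_const2[of _ 1]) auto
  then show ?thesis using le1 EW unfolding W_def[symmetric] by (simp add: antisym)
qed

end

section \<open>Compactness of laws on a countable cube\<close>

text \<open>A continuous function of period 2 that is 0 on \<open>[0, 1/3]\<close> and 1 on
  \<open>[2/3, 1]\<close>. It reads off the first ternary digit of a number with digits 0 and 2; the
  cosine makes continuity and periodicity immediate.\<close>

definition sawtooth :: "real \<Rightarrow> real" where
  "sawtooth t = max 0 (min 1 (1 / 2 - cos (pi * t)))"

text \<open>For a 0-1 sequence this is the Cantor number with ternary digits
  \<open>2 * a k\<close>.\<close>

definition ternary :: "(nat \<Rightarrow> real) \<Rightarrow> real" where
  "ternary a = (\<Sum>k. 2 * a k / 3 ^ Suc k)"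

lemma sawtooth_bounds: "0 \<le> sawtooth t" "sawtooth t \<le> 1"
  by (simp_all add: sawtooth_def)

lemma continuous_sawtooth: "continuous_on UNIV sawtooth"
  unfolding sawtooth_def by (intro continuous_intros)

lemma sawtooth_add_even: "sawtooth (2 * real n + r) = sawtooth r"
proof -
  have "pi * (2 * real n + r) = 2 * real n * pi + pi * r" by (simp add: algebra_simps)
  then have "cos (pi * (2 * real n + r)) = cos (pi * r)"
    by (simp add: cos_add cos_2npi sin_2npi)
  then show ?thesis by (simp add: sawtooth_def)
qed

lemma sawtooth_0:
  assumes "0 \<le> r" "r \<le> 1 / 3"
  shows "sawtooth r = 0"
proof -
  have "cos (pi / 3) \<le> cos (pi * r)"
    using assms by (intro cos_monotone_0_pi_le) (auto simp: field_simps)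
  then show ?thesis by (simp add: sawtooth_def cos_60)
qed

lemma sawtooth_1:
  assumes "2 / 3 \<le> r" "r \<le> 1"
  shows "sawtooth r = 1"
proof -
  have "cos (pi / 3) \<le> cos (pi * (1 - r))"
    using assms by (intro cos_monotone_0_pi_le) (auto simp: field_simps)
  moreover have "cos (pi * r) = - cos (pi * (1 - r))"
    by (simp add: algebra_simps cos_diff)
  ultimately show ?thesis by (simp add: sawtooth_def cos_60)
qed

lemma ternary_props:
  assumes "\<And>k. 0 \<le> a k" "\<And>k. a k \<le> 1"
  shows "summable (\<lambda>k. 2 * a k / 3 ^ Suc k)" "0 \<le> ternary a" "ternary a \<le> 1"
proof -
  have g: "(\<lambda>k. 2 / 3 * (1 / 3) ^ k) sums (2 / 3 * (1 / (1 - 1 / 3)) :: real)"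
    by (intro sums_mult geometric_sums) auto
  have le: "2 * a k / 3 ^ Suc k \<le> 2 / 3 * (1 / 3) ^ k" for k
    using assms(2)[of k] by (simp add: power_one_over field_simps)
  show s: "summable (\<lambda>k. 2 * a k / 3 ^ Suc k)"
    using sums_summable[OF g] le assms(1) by (intro summable_comparison_test'[OF sums_summable[OF g]]) (auto simp: abs_of_nonneg)
  show "0 \<le> ternary a" unfolding ternary_def using assms by (intro suminf_nonneg s) auto
  have "ternary a \<le> (\<Sum>k. 2 / 3 * (1 / 3) ^ k)"
    unfolding ternary_def using le by (intro suminf_le s sums_summable[OF g])
  also have "\<dots> = 1" using sums_unique[OF g] by simp
  finally show "ternary a \<le> 1" .
qed

lemma ternary_Suc:
  assumes "\<And>k. 0 \<le> a k" "\<And>k. a k \<le> 1"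
  shows "3 * ternary a = 2 * a 0 + ternary (\<lambda>k. a (Suc k))"
proof -
  have s: "summable (\<lambda>k. 2 * a k / 3 ^ Suc k)" by (rule ternary_props[OF assms])
  have "3 * ternary a = (\<Sum>k. 3 * (2 * a k / 3 ^ Suc k))"
    unfolding ternary_def by (rule suminf_mult[OF s, symmetric])
  also have "\<dots> = (\<Sum>k. 3 * (2 * a (Suc k) / 3 ^ Suc (Suc k))) + 3 * (2 * a 0 / 3 ^ Suc 0)"
    using suminf_split_head[OF summable_mult[OF s, of 3]] by simp
  finally show ?thesis by (simp add: ternary_def)
qed

text \<open>Multiplication by 3 shifts the digits. The digit pushed in front of the point is 0 or 2;
  it stays an even integer under further multiplication and disappears by periodicity.\<close>

lemma sawtooth_ternary:
  assumes "\<And>k. a k = 0 \<or> a k = 1"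
  shows "sawtooth (3 ^ k * ternary a) = a k"
  using assms
proof (induction k arbitrary: a)
  case 0
  have a: "0 \<le> a k" "a k \<le> 1" for k using 0[of k] by auto
  have t: "0 \<le> ternary (\<lambda>k. a (Suc k))" "ternary (\<lambda>k. a (Suc k)) \<le> 1"
    using a by (auto intro: ternary_props)
  have "3 * ternary a = 2 * a 0 + ternary (\<lambda>k. a (Suc k))" by (rule ternary_Suc[OF a])
  then have e: "ternary a = (2 * a 0 + ternary (\<lambda>k. a (Suc k))) / 3" by simp
  consider "a 0 = 0" | "a 0 = 1" using 0 by blast
  then show ?case
  proof cases
    case 1
    then have "sawtooth (ternary a) = 0" using e t by (intro sawtooth_0) auto
    with 1 show ?thesis by simp
  next
    case 2
    then have "sawtooth (ternary a) = 1" using e t by (intro sawtooth_1) auto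
    with 2 show ?thesis by simp
  qed
next
  case (Suc k)
  have a: "0 \<le> a k" "a k \<le> 1" for k using Suc.prems[of k] by auto
  obtain n :: nat where n: "a 0 = real n" using Suc.prems[of 0] by (metis of_nat_0 of_nat_1)
  have "3 ^ Suc k * ternary a = 3 ^ k * (3 * ternary a)" by simp
  also have "\<dots> = 2 * real (3 ^ k * n) + 3 ^ k * ternary (\<lambda>k. a (Suc k))"
    unfolding ternary_Suc[OF a] n by (simp add: algebra_simps)
  finally have "sawtooth (3 ^ Suc k * ternary a) = sawtooth (3 ^ k * ternary (\<lambda>k. a (Suc k)))"
    by (simp only: sawtooth_add_even)
  also have "\<dots> = a (Suc k)" using Suc.prems by (intro Suc.IH)
  finally show ?case .
qed

text \<open>Schoenberg's space-filling curve: one Cantor number stores the binary digits of all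
  coordinates, digit \<open>j\<close> of coordinate \<open>i\<close> at place
  \<open>prod_encode (to_nat i, j)\<close>.\<close>

definition schoenberg :: "real \<Rightarrow> 'i::countable \<Rightarrow> real" where
  "schoenberg t i = (\<Sum>j. (1 / 2) ^ Suc j * sawtooth (3 ^ prod_encode (to_nat i, j) * t))"

lemma continuous_schoenberg: "continuous_on UNIV (schoenberg :: real \<Rightarrow> 'i::countable \<Rightarrow> real)"
proof (rule continuous_on_coordinatewise_then_product)
  fix i :: 'i
  have "uniform_limit UNIV (\<lambda>n t. \<Sum>j<n. (1 / 2) ^ Suc j * sawtooth (3 ^ prod_encode (to_nat i, j) * t)) (\<lambda>t. schoenberg t i) sequentially"
    unfolding schoenberg_def
  proof (rule Weierstrass_m_test)
    show "norm ((1 / 2) ^ Suc j * sawtooth (3 ^ prod_encode (to_nat i, j) * t)) \<le> (1 / 2) ^ Suc j" for j t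
      using sawtooth_bounds[of "3 ^ prod_encode (to_nat i, j) * t"] by (simp add: abs_mult mult_left_le)
    show "summable (\<lambda>j. (1 / 2 :: real) ^ Suc j)"
      by (intro summable_Suc_iff[THEN iffD2] summable_geometric) simp
  qed
  then show "continuous_on UNIV (\<lambda>t. schoenberg t i)"
  proof (rule uniform_limit_theorem[rotated])
    show "\<forall>\<^sub>F n in sequentially. continuous_on UNIV (\<lambda>t. \<Sum>j<n. (1 / 2) ^ Suc j * sawtooth (3 ^ prod_encode (to_nat i, j) * t))"
      by (intro always_eventually allI continuous_intros continuous_on_compose2[OF continuous_sawtooth]) auto
  qed simp
qed

lemma binary_expansion:
  fixes z :: real
  assumes "0 \<le> z" "z < 1"
  obtains d :: "nat \<Rightarrow> real" where "\<And>j. d j = 0 \<or> d j = 1" "(\<lambda>j. (1 / 2) ^ Suc j * d j) sums z"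
proof
  \<comment> \<open>Truncation to \<open>n\<close> binary places, whose rescaled increments are the
    digits. The condition \<open>z < 1\<close> gives \<open>g 0 = 0\<close>, which is why points of
    the cube have coordinates below 1.\<close>
  define g where "g n = of_int \<lfloor>2 ^ n * z\<rfloor> / (2 ^ n :: real)" for n :: nat
  define d where "d j = (of_int (\<lfloor>2 ^ Suc j * z\<rfloor> - 2 * \<lfloor>2 ^ j * z\<rfloor>) :: real)" for j
  show "d j = 0 \<or> d j = 1" for j
  proof -
    have "2 * \<lfloor>2 ^ j * z\<rfloor> \<le> \<lfloor>2 ^ Suc j * z\<rfloor>" "\<lfloor>2 ^ Suc j * z\<rfloor> < 2 * \<lfloor>2 ^ j * z\<rfloor> + 2"
      by (simp_all add: le_floor_iff floor_less_iff mult.assoc) linarith+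
    then have "\<lfloor>2 ^ Suc j * z\<rfloor> - 2 * \<lfloor>2 ^ j * z\<rfloor> = 0 \<or> \<lfloor>2 ^ Suc j * z\<rfloor> - 2 * \<lfloor>2 ^ j * z\<rfloor> = 1" by linarith
    then show ?thesis unfolding d_def by auto
  qed
  have g: "g \<longlonglongrightarrow> z"
  proof (rule tendsto_sandwich[of "\<lambda>n. z - (1 / 2) ^ n" _ _ "\<lambda>_. z"])
    show "\<forall>\<^sub>F n in sequentially. z - (1 / 2) ^ n \<le> g n"
    proof (intro always_eventually allI)
      fix n
      have "z - (1 / 2) ^ n = (2 ^ n * z - 1) / 2 ^ n" by (simp add: power_one_over diff_divide_distrib)
      also have "\<dots> \<le> g n" unfolding g_def by (intro divide_right_mono) (linarith, simp)
      finally show "z - (1 / 2) ^ n \<le> g n" .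
    qed
    show "\<forall>\<^sub>F n in sequentially. g n \<le> z"
    proof (intro always_eventually allI)
      fix n
      have "of_int \<lfloor>2 ^ n * z\<rfloor> \<le> 2 ^ n * z" by linarith
      then show "g n \<le> z" by (simp add: g_def field_simps)
    qed
    have "(\<lambda>n. z - (1 / 2) ^ n) \<longlonglongrightarrow> z - 0" by (intro tendsto_diff tendsto_const LIMSEQ_power_zero) auto
    then show "(\<lambda>n. z - (1 / 2) ^ n) \<longlonglongrightarrow> z" by simp
  qed simp
  have g0: "g 0 = 0" using assms by (simp add: g_def floor_eq_iff)
  have "(\<lambda>n. g (Suc n) - g n) sums (z - g 0)" by (rule telescope_sums[OF g])
  moreover have "g (Suc n) - g n = (1 / 2) ^ Suc n * d n" for n
    by (simp add: g_def d_def power_one_over field_simps)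
  ultimately show "(\<lambda>j. (1 / 2) ^ Suc j * d j) sums z" using g0 by simp
qed

lemma schoenberg_surj:
  fixes z :: "'i::countable \<Rightarrow> real"
  assumes "\<And>i. 0 \<le> z i" "\<And>i. z i < 1"
  obtains t where "0 \<le> t" "t \<le> 1" "schoenberg t = z"
proof -
  have "\<exists>d. \<forall>i. (\<forall>j. d i j = (0::real) \<or> d i j = 1) \<and> (\<lambda>j. (1 / 2) ^ Suc j * d i j) sums z i"
    by (rule choice) (use binary_expansion[OF assms] in metis)
  then obtain d :: "'i \<Rightarrow> nat \<Rightarrow> real" where d: "\<And>i j. d i j = 0 \<or> d i j = 1"
    "\<And>i. (\<lambda>j. (1 / 2) ^ Suc j * d i j) sums z i" by blast
  define a where "a k = d (from_nat (fst (prod_decode k))) (snd (prod_decode k))" for k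
  have a: "a k = 0 \<or> a k = 1" for k by (simp add: a_def d)
  have a': "0 \<le> a k" "a k \<le> 1" for k using a[of k] by auto
  have "schoenberg (ternary a) i = z i" for i
    using sums_unique[OF d(2)[of i]] unfolding schoenberg_def sawtooth_ternary[OF a] by (simp add: a_def)
  then have "schoenberg (ternary a) = z" by (rule ext)
  then show ?thesis using that[of "ternary a"] ternary_props(2,3)[of a, OF a'] by blast
qed

text \<open>Schoenberg's curve reduces compactness of laws on a countable power of an interval to
  Helly's theorem on the line.\<close>

lemma convergent_laws_have_limit:
  fixes p :: "nat \<Rightarrow> ('i::countable \<Rightarrow> real) pmf"
  assumes cube: "\<And>n z i. z \<in> set_pmf (p n) \<Longrightarrow> 0 \<le> z i \<and> z i < 1"
    and conv: "\<And>f. continuous_on UNIV f \<Longrightarrow> bounded (range f) \<Longrightarrow> convergent (\<lambda>n. measure_pmf.expectation (p n) (f :: _ \<Rightarrow> real))"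
  obtains \<nu> where "prob_space \<nu>" "sets \<nu> = sets borel"
    "\<And>f. continuous_on UNIV f \<Longrightarrow> bounded (range f) \<Longrightarrow> (\<lambda>n. measure_pmf.expectation (p n) f) \<longlonglongrightarrow> (\<integral>z. f z \<partial>\<nu> :: real)"
proof -
  \<comment> \<open>A right inverse of the curve on the points that carry mass. Measurability is
    automatic, since every set is measurable for a \<open>pmf\<close>.\<close>
  define s where "s z = (SOME t. 0 \<le> t \<and> t \<le> 1 \<and> schoenberg t = z)" for z :: "'i \<Rightarrow> real"
  have s: "0 \<le> s z" "s z \<le> 1" "schoenberg (s z) = z" if "z \<in> set_pmf (p n)" for z n
  proof -
    have "\<exists>t. 0 \<le> t \<and> t \<le> 1 \<and> schoenberg t = z" using schoenberg_surj[of z] cube[OF that] by metis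
    from someI_ex[OF this] show "0 \<le> s z" "s z \<le> 1" "schoenberg (s z) = z" unfolding s_def by auto
  qed
  define \<rho> where "\<rho> n = distr (measure_pmf (p n)) borel s" for n
  have rd: "real_distribution (\<rho> n)" for n
    unfolding \<rho>_def by (rule prob_space.real_distribution_distr[OF measure_pmf.prob_space_axioms]) simp
  have "tight \<rho>"
    unfolding tight_def
  proof (intro conjI allI impI)
    show "real_distribution (\<rho> n)" for n by (rule rd)
    fix \<epsilon> :: real assume "0 < \<epsilon>"
    have "measure (\<rho> n) {-1<..2} = 1" for n
    proof -
      have "measure (\<rho> n) {-1<..2} = measure (p n) (s -` {-1<..2})"
        unfolding \<rho>_def by (subst measure_distr) auto
      also have "\<dots> = 1"
        unfolding measure_pmf.prob_eq_1[simplified]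
        by (auto simp: AE_measure_pmf_iff intro: less_le_trans[OF _ s(1)] order_trans[OF s(2)])
      finally show ?thesis .
    qed
    then show "\<exists>a b. a < b \<and> (\<forall>n. 1 - \<epsilon> < measure (\<rho> n) {a<..b})"
      using \<open>0 < \<epsilon>\<close> by (intro exI[of _ "-1"] exI[of _ 2]) auto
  qed
  then obtain r \<nu>' where r: "strict_mono r" "real_distribution \<nu>'" "weak_conv_m (\<rho> \<circ> id \<circ> r) \<nu>'"
    using tight_imp_convergent_subsubsequence[of \<rho> id] by (auto simp: strict_mono_def)
  interpret \<nu>': real_distribution \<nu>' by fact
  have mc [measurable]: "(schoenberg :: real \<Rightarrow> 'i \<Rightarrow> real) \<in> measurable borel borel"
    using continuous_schoenberg by (rule borel_measurable_continuous_onI)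
  have mc' [measurable]: "(schoenberg :: real \<Rightarrow> 'i \<Rightarrow> real) \<in> measurable \<nu>' borel"
    using mc by (simp add: measurable_cong_sets[OF \<nu>'.events_eq_borel refl])
  define \<nu> where "\<nu> = distr \<nu>' borel (schoenberg :: real \<Rightarrow> 'i \<Rightarrow> real)"
  show ?thesis
  proof
    show "prob_space \<nu>" unfolding \<nu>_def by (rule \<nu>'.prob_space_distr) (rule mc')
    show "sets \<nu> = sets borel" by (simp add: \<nu>_def)
    fix f :: "('i \<Rightarrow> real) \<Rightarrow> real" assume f: "continuous_on UNIV f" "bounded (range f)"
    have [measurable]: "f \<in> borel_measurable borel" using f(1) by (rule borel_measurable_continuous_onI)
    obtain C where C: "\<And>z. norm (f z) \<le> C" using f(2) by (auto simp: bounded_iff)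
    have e: "(\<integral>t. f (schoenberg t) \<partial>\<rho> n) = measure_pmf.expectation (p n) f" for n
    proof -
      have "(\<integral>t. f (schoenberg t) \<partial>\<rho> n) = (\<integral>z. f (schoenberg (s z)) \<partial>p n)"
        unfolding \<rho>_def by (subst integral_distr) auto
      also have "\<dots> = measure_pmf.expectation (p n) f"
        by (intro integral_cong_AE) (auto simp: AE_measure_pmf_iff s)
      finally show ?thesis .
    qed
    have "(\<lambda>k. \<integral>t. f (schoenberg t) \<partial>(\<rho> \<circ> id \<circ> r) k) \<longlonglongrightarrow> (\<integral>t. f (schoenberg t) \<partial>\<nu>')"
    proof (rule weak_conv_imp_integral_bdd_continuous_conv)
      have "continuous_on UNIV (\<lambda>t. f (schoenberg t))"
        using continuous_on_compose2[OF f(1) continuous_schoenberg] by simp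
      then show "isCont (\<lambda>t. f (schoenberg t)) t" for t by (simp add: continuous_on_eq_continuous_at)
    qed (use r rd C in \<open>auto simp: comp_def\<close>)
    then have "(\<lambda>k. measure_pmf.expectation (p (r k)) f) \<longlonglongrightarrow> (\<integral>z. f z \<partial>\<nu>)"
      unfolding \<nu>_def by (subst integral_distr) (auto simp: e)
    \<comment> \<open>Helly's theorem yields a limit along a subsequence; the hypothesis that the
      whole sequence of expectations converges makes it the full limit.\<close>
    moreover obtain l where l: "(\<lambda>n. measure_pmf.expectation (p n) f) \<longlonglongrightarrow> l"
      using conv[OF f] by (auto simp: convergent_def)
    moreover have "(\<lambda>k. measure_pmf.expectation (p (r k)) f) \<longlonglongrightarrow> l"
      using LIMSEQ_subseq_LIMSEQ[OF l r(1)] by (simp add: comp_def)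
    ultimately show "(\<lambda>n. measure_pmf.expectation (p n) f) \<longlonglongrightarrow> (\<integral>z. f z \<partial>\<nu>)"
      using LIMSEQ_unique by blast
  qed
qed

text \<open>Monomials are indexed by lists of coordinates, so a countable index type gives countably
  many of them; the empty list gives the constants.\<close>

inductive_set coordinate_polys :: "(('i \<Rightarrow> real) \<Rightarrow> real) set" where
  monomial: "(\<lambda>z. c * prod_list (map z l)) \<in> coordinate_polys"
| add: "f \<in> coordinate_polys \<Longrightarrow> g \<in> coordinate_polys \<Longrightarrow> (\<lambda>z. f z + g z) \<in> coordinate_polys"

lemma coordinate_polys_mult:
  assumes "f \<in> coordinate_polys" "g \<in> coordinate_polys"
  shows "(\<lambda>z. f z * g z) \<in> coordinate_polys"
  using assms(1)
proof induction
  case (monomial c l)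
  show ?case using assms(2)
  proof induction
    case (monomial c' l')
    have "(\<lambda>z. c * prod_list (map z l) * (c' * prod_list (map z l'))) = (\<lambda>z. (c * c') * prod_list (map z (l @ l')))"
      by (auto simp: ac_simps)
    then show ?case using coordinate_polys.monomial by metis
  next
    case (add f g)
    then show ?case using coordinate_polys.add by (simp add: distrib_left)
  qed
next
  case (add f g)
  then show ?case using coordinate_polys.add by (simp add: distrib_right)
qed

lemma continuous_on_monomial: "continuous_on S (\<lambda>z :: 'i \<Rightarrow> real. prod_list (map z l))"
  by (induction l) (auto intro!: continuous_intros intro: continuous_on_subset[OF continuous_on_product_coordinates])

lemma function_ring_coordinate_polys:
  fixes S :: "('i::countable \<Rightarrow> real) set"
  assumes "compact S"
  shows "function_ring_on coordinate_polys S"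
proof
  show "compact S" by fact
  show "continuous_on S f" if "f \<in> coordinate_polys" for f :: "('i \<Rightarrow> real) \<Rightarrow> real"
    using that by induction (auto intro!: continuous_intros continuous_on_monomial)
  show "(\<lambda>_. c) \<in> coordinate_polys" for c using coordinate_polys.monomial[of c "[]"] by simp
  show "\<exists>f\<in>coordinate_polys. f x \<noteq> f y" if xy: "x \<noteq> y" for x y :: "'i \<Rightarrow> real"
  proof -
    obtain i where "x i \<noteq> y i" using xy by blast
    then show ?thesis using coordinate_polys.monomial[of 1 "[i]"] by (intro bexI[of _ "\<lambda>z. 1 * prod_list (map z [i])"]) auto
  qed
qed (auto intro: coordinate_polys.add coordinate_polys_mult)

section \<open>Limit measures\<close>

lemma sum_mset_eq_sum_count:
  fixes f :: "'s \<Rightarrow> real"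
  shows "(\<Sum>x\<in>#b. f x) = (\<Sum>x\<in>set_mset b. real (count b x) * f x)"
proof -
  have "(\<Sum>x\<in>#b. f x) = (\<Sum>p\<in>particles b. f (fst p))" by (simp add: sum_particles)
  also have "particles b = (SIGMA x:set_mset b. {..<count b x})"
    by (auto simp: particles_def) (metis count_greater_zero_iff gr_zeroI not_less_zero)
  also have "(\<Sum>p\<in>\<dots>. f (fst p)) = (\<Sum>x\<in>set_mset b. \<Sum>i<count b x. f x)"
    by (subst sum.Sigma) (auto simp: case_prod_beta)
  finally show ?thesis by simp
qed

lemma integral_pmf_of_multiset:
  fixes f :: "'s \<Rightarrow> real"
  assumes "b \<noteq> {#}"
  shows "(\<integral>x. f x \<partial>pmf_of_multiset b) = (\<Sum>x\<in>#b. f x) / real (size b)"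
  using assms by (subst integral_measure_pmf_real[of "set_mset b"])
    (auto simp: sum_mset_eq_sum_count sum_divide_distrib ac_simps)

text \<open>Continuous functions that increase to the indicator of an open set. \<open>UNIV\<close>
  is treated apart because \<open>infdist\<close> to the empty set is 0.\<close>

definition open_approx :: "'a::metric_space set \<Rightarrow> nat \<Rightarrow> 'a \<Rightarrow> real" where
  "open_approx U k z = (if U = UNIV then 1 else min 1 (real k * infdist z (- U)))"

lemma open_approx_bounds: "0 \<le> open_approx U k z" "open_approx U k z \<le> 1"
  by (auto simp: open_approx_def infdist_nonneg)

lemma continuous_open_approx: "continuous_on S (open_approx U k)"
proof (cases "U = UNIV")
  case False
  then have "open_approx U k = (\<lambda>z. min 1 (real k * infdist z (- U)))"
    by (simp add: open_approx_def[abs_def])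
  then show ?thesis by (auto intro!: continuous_intros)
qed (auto simp: open_approx_def[abs_def])

lemma open_approx_mono: "i \<le> j \<Longrightarrow> open_approx U i z \<le> open_approx U j z"
  unfolding open_approx_def using infdist_nonneg[of z "- U"]
  by (cases "U = UNIV") (simp_all add: min.mono mult_right_mono del: min.bounded_iff)

lemma open_approx_SUP:
  assumes "open U"
  shows "(SUP k. ennreal (open_approx U k z)) = indicator U z"
proof (cases "U = UNIV")
  case False
  have cl: "closed (- U)" "- U \<noteq> {}" using assms False by auto
  show ?thesis
  proof (cases "z \<in> U")
    case True
    have "infdist z (- U) \<noteq> 0" using in_closed_iff_infdist_zero[OF cl, of z] True by auto
    then have d: "0 < infdist z (- U)" using infdist_nonneg[of z "- U"] by simp
    obtain k where k: "1 < real k * infdist z (- U)" using reals_Archimedean3[OF d] by blast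
    then have "open_approx U k z = 1" using False by (simp add: open_approx_def)
    then have "1 \<le> (SUP k. ennreal (open_approx U k z))" by (intro SUP_upper2[of k]) simp_all
    moreover have "(SUP k. ennreal (open_approx U k z)) \<le> 1"
      using open_approx_bounds by (intro SUP_least) (simp add: ennreal_le_1)
    ultimately have "(SUP k. ennreal (open_approx U k z)) = 1" by (intro antisym)
    then show ?thesis using True by simp
  next
    case z: False
    then have "open_approx U k z = 0" for k using False by (simp add: open_approx_def)
    then show ?thesis using z by simp
  qed
qed (simp add: open_approx_def)

text \<open>Expresses the mass of an open set by countably many integrals of bounded continuous
  functions, which for the limit measure are limits of \<open>Z\<close>. Its support, measurability
  and intensity are all derived from this.\<close>

lemma emeasure_open_SUP:
  fixes \<nu> :: "'a::metric_space measure"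
  assumes "finite_measure \<nu>" "sets \<nu> = sets borel" "open U"
  shows "emeasure \<nu> U = (SUP k. ennreal (\<integral>z. open_approx U k z \<partial>\<nu>))"
proof -
  interpret finite_measure \<nu> by fact
  have [measurable]: "open_approx U k \<in> borel_measurable \<nu>" for k
    using borel_measurable_continuous_onI[OF continuous_open_approx] by (simp add: measurable_cong_sets[OF assms(2) refl])
  have "emeasure \<nu> U = (\<integral>\<^sup>+z. (SUP k. ennreal (open_approx U k z)) \<partial>\<nu>)"
    using assms by (simp add: open_approx_SUP)
  also have "\<dots> = (SUP k. \<integral>\<^sup>+z. ennreal (open_approx U k z) \<partial>\<nu>)"
    by (rule nn_integral_monotone_convergence_SUP)
       (auto simp: incseq_def le_fun_def intro!: ennreal_leI open_approx_mono)
  also have "\<dots> = (SUP k. ennreal (\<integral>z. open_approx U k z \<partial>\<nu>))"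
  proof (rule SUP_cong[OF refl])
    fix k
    have "integrable \<nu> (open_approx U k)"
      by (rule integrable_const_bound[where B = 1]) (auto simp: open_approx_bounds)
    then show "(\<integral>\<^sup>+z. ennreal (open_approx U k z) \<partial>\<nu>) = ennreal (\<integral>z. open_approx U k z \<partial>\<nu>)"
      by (rule nn_integral_eq_integral) (simp add: open_approx_bounds)
  qed
  finally show ?thesis .
qed

lemma bounded_continuous_integrable:
  fixes f :: "'a::metric_space \<Rightarrow> real"
  assumes "finite_measure \<nu>" "sets \<nu> = sets borel" "continuous_on UNIV f" "bounded (range f)"
  shows "integrable \<nu> f"
proof -
  interpret finite_measure \<nu> by fact
  obtain C where "\<And>z. norm (f z) \<le> C" using assms(4) by (auto simp: bounded_iff)
  then show ?thesis
    using borel_measurable_continuous_onI[OF assms(3)]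
    by (intro integrable_const_bound[where B = C]) (auto simp: measurable_cong_sets[OF assms(2) refl])
qed

context brw
begin

lemma Z_abs_le:
  assumes "\<And>x. \<bar>f x\<bar> \<le> C"
  shows "\<bar>Z n f \<omega>\<bar> \<le> C * Z n (\<lambda>_. 1) \<omega>"
proof -
  have 1: "f x \<le> C * 1" and 2: "- C * 1 \<le> f x" for x using assms[of x] by auto
  show ?thesis
    using Z_mono[of f "\<lambda>_. C * 1" n \<omega>, OF 1] Z_mono[of "\<lambda>_. - C * 1" f n \<omega>, OF 2]
    unfolding Z_cmult by auto
qed

text \<open>A statement about one outcome \<open>\<omega>\<close>: polynomials approximate
  \<open>f\<close> uniformly on \<open>K\<close>, and the total mass stays bounded. Countably many
  almost sure statements about monomials thus cover all continuous functions.\<close>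

lemma Z_converges_continuous:
  fixes e :: "'s \<Rightarrow> 'i::countable \<Rightarrow> real"
  assumes K: "compact K" "\<And>x. e x \<in> K"
    and mono: "\<And>l. convergent (\<lambda>n. Z n (\<lambda>x. prod_list (map (e x) l)) \<omega>)"
    and f: "continuous_on K f"
  shows "convergent (\<lambda>n. Z n (\<lambda>x. f (e x)) \<omega>)"
proof -
  interpret function_ring_on coordinate_polys K by (rule function_ring_coordinate_polys[OF K(1)])
  have poly: "convergent (\<lambda>n. Z n (\<lambda>x. g (e x)) \<omega>)" if "g \<in> coordinate_polys" for g
    using that
  proof induction
    case (monomial c l)
    show ?case unfolding Z_cmult by (intro convergent_mult convergent_const mono)
  next
    case (add f g)
    then show ?case unfolding Z_add by (intro convergent_add)
  qed
  have "convergent (\<lambda>n. Z n (\<lambda>_. 1) \<omega>)" using mono[of "[]"] by simp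
  then have "Bseq (\<lambda>n. Z n (\<lambda>_. 1) \<omega>)" by (rule convergent_imp_Bseq)
  then obtain D where D: "0 < D" "\<And>n. norm (Z n (\<lambda>_. 1) \<omega>) \<le> D" by (auto simp: Bseq_def)
  have "Cauchy (\<lambda>n. Z n (\<lambda>x. f (e x)) \<omega>)"
  proof (rule metric_CauchyI)
    fix \<epsilon> :: real assume \<epsilon>: "0 < \<epsilon>"
    define \<delta> where "\<delta> = \<epsilon> / (3 * D)"
    have \<delta>: "0 < \<delta>" "\<delta> * D = \<epsilon> / 3" using \<epsilon> D by (auto simp: \<delta>_def)
    obtain g where g: "g \<in> coordinate_polys" "\<And>z. z \<in> K \<Longrightarrow> \<bar>f z - g z\<bar> < \<delta>"
      using Stone_Weierstrass_basic[OF f \<delta>(1)] by blast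
    have close: "\<bar>Z n (\<lambda>x. f (e x)) \<omega> - Z n (\<lambda>x. g (e x)) \<omega>\<bar> \<le> \<epsilon> / 3" for n
    proof -
      have "Z n (\<lambda>x. f (e x)) \<omega> - Z n (\<lambda>x. g (e x)) \<omega> = Z n (\<lambda>x. f (e x) + (- 1) * g (e x)) \<omega>"
        unfolding Z_add Z_cmult by simp
      then have "\<bar>Z n (\<lambda>x. f (e x)) \<omega> - Z n (\<lambda>x. g (e x)) \<omega>\<bar> \<le> \<delta> * Z n (\<lambda>_. 1) \<omega>"
      proof (simp only:, intro Z_abs_le)
        show "\<bar>f (e x) + - 1 * g (e x)\<bar> \<le> \<delta>" for x using g(2)[OF K(2), of x] by simp
      qed
      also have "\<dots> \<le> \<delta> * D" using D(2)[of n] \<delta> by (intro mult_left_mono) auto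
      finally show ?thesis using \<delta> by simp
    qed
    have "Cauchy (\<lambda>n. Z n (\<lambda>x. g (e x)) \<omega>)" using poly[OF g(1)] by (simp add: Cauchy_convergent_iff)
    then obtain N where N: "\<And>n n'. n \<ge> N \<Longrightarrow> n' \<ge> N \<Longrightarrow> dist (Z n (\<lambda>x. g (e x)) \<omega>) (Z n' (\<lambda>x. g (e x)) \<omega>) < \<epsilon> / 3"
      using metric_CauchyD[of _ "\<epsilon> / 3"] \<epsilon> by (metis divide_pos_pos zero_less_numeral)
    show "\<exists>N. \<forall>n\<ge>N. \<forall>n'\<ge>N. dist (Z n (\<lambda>x. f (e x)) \<omega>) (Z n' (\<lambda>x. f (e x)) \<omega>) < \<epsilon>"
    proof (intro exI[of _ N] allI impI)
      fix n n' assume "n \<ge> N" "n' \<ge> N"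
      then show "dist (Z n (\<lambda>x. f (e x)) \<omega>) (Z n' (\<lambda>x. f (e x)) \<omega>) < \<epsilon>"
        using N[of n n'] close[of n] close[of n'] unfolding dist_real_def by linarith
    qed
  qed
  then show ?thesis by (simp add: Cauchy_convergent_iff)
qed

text \<open>Again for one outcome. With vanishing limiting mass \<open>w\<close> the limit is the
  null measure; otherwise the normalised configurations are probability laws on the cube,
  compactness applies to them, and \<open>w\<close> returns as a density.\<close>

lemma ex_limit_measure:
  fixes e :: "'s \<Rightarrow> 'i::countable \<Rightarrow> real"
  assumes e: "\<And>x i. 0 \<le> e x i \<and> e x i < 1"
    and K: "compact K" "\<And>x. e x \<in> K"
    and conv: "\<And>f. continuous_on UNIV f \<Longrightarrow> bounded (range f) \<Longrightarrow> convergent (\<lambda>n. Z n (\<lambda>x. f (e x)) \<omega>)"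
  shows "\<exists>\<nu>. finite_measure \<nu> \<and> sets \<nu> = sets borel \<and> emeasure \<nu> (- K) = 0 \<and>
    (\<forall>f. continuous_on UNIV f \<longrightarrow> bounded (range f) \<longrightarrow> (\<lambda>n. Z n (\<lambda>x. f (e x)) \<omega>) \<longlonglongrightarrow> (\<integral>z. f z \<partial>\<nu>))"
proof -
  have c1: "convergent (\<lambda>n. Z n (\<lambda>_. 1) \<omega>)" using conv[of "\<lambda>_. 1"] by simp
  then obtain w where w: "(\<lambda>n. Z n (\<lambda>_. 1) \<omega>) \<longlonglongrightarrow> w" by (auto simp: convergent_def)
  have w0: "0 \<le> w" by (rule LIMSEQ_le_const[OF w]) (auto intro!: exI[of _ 0] Z_nonneg)
  show ?thesis
  proof (cases "w = 0")
    case True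
    show ?thesis
    proof (intro exI[of _ "null_measure borel"] conjI allI impI)
      show "finite_measure (null_measure borel :: ('i \<Rightarrow> real) measure)" by (rule finite_measureI) simp
      fix f :: "('i \<Rightarrow> real) \<Rightarrow> real" assume f: "continuous_on UNIV f" "bounded (range f)"
      obtain C where C: "\<And>z. \<bar>f z\<bar> \<le> C" using f(2) by (auto simp: bounded_iff)
      have "(\<lambda>n. Z n (\<lambda>x. f (e x)) \<omega>) \<longlonglongrightarrow> 0"
      proof (rule tendsto_rabs_zero_cancel, rule tendsto_sandwich[of "\<lambda>_. 0" _ _ "\<lambda>n. C * Z n (\<lambda>_. 1) \<omega>"])
        show "(\<lambda>n. C * Z n (\<lambda>_. 1) \<omega>) \<longlonglongrightarrow> 0" using tendsto_mult_left[OF w, of C] True by simp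
      qed (auto intro!: always_eventually Z_abs_le C)
      then show "(\<lambda>n. Z n (\<lambda>x. f (e x)) \<omega>) \<longlonglongrightarrow> (\<integral>z. f z \<partial>null_measure borel)"
        by (simp add: integral_null_measure)
    qed auto
  next
    case False
    with w0 have w_pos: "0 < w" by simp
    \<comment> \<open>The law for an empty configuration is a placeholder inside the cube; as
      \<open>w\<close> is positive it occurs for finitely many \<open>n\<close> only.\<close>
    define p where "p n = (if B n \<omega> = {#} then return_pmf (e x\<^sub>0) else map_pmf e (pmf_of_multiset (B n \<omega>)))" for n
    have ev: "eventually (\<lambda>n. 0 < Z n (\<lambda>_. 1) \<omega>) sequentially" using order_tendstoD(1)[OF w w_pos] .
    have Ep: "eventually (\<lambda>n. measure_pmf.expectation (p n) f = Z n (\<lambda>x. f (e x)) \<omega> / Z n (\<lambda>_. 1) \<omega>) sequentially"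
      for f :: "('i \<Rightarrow> real) \<Rightarrow> real"
      using ev
    proof eventually_elim
      case (elim n)
      then have ne: "B n \<omega> \<noteq> {#}" by (auto simp: Z_def)
      then have "measure_pmf.expectation (p n) f = (\<Sum>x\<in>#B n \<omega>. f (e x)) / real (size (B n \<omega>))"
        by (simp add: p_def integral_pmf_of_multiset)
      then show ?case using m1 by (simp add: Z_def)
    qed
    have lim: "convergent (\<lambda>n. measure_pmf.expectation (p n) f)"
      if f: "continuous_on UNIV f" "bounded (range f)" for f :: "('i \<Rightarrow> real) \<Rightarrow> real"
    proof -
      obtain l where "(\<lambda>n. Z n (\<lambda>x. f (e x)) \<omega>) \<longlonglongrightarrow> l" using conv[OF f] by (auto simp: convergent_def)
      then have "(\<lambda>n. Z n (\<lambda>x. f (e x)) \<omega> / Z n (\<lambda>_. 1) \<omega>) \<longlonglongrightarrow> l / w" using False by (intro tendsto_divide w)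
      then have "(\<lambda>n. measure_pmf.expectation (p n) f) \<longlonglongrightarrow> l / w"
        using tendsto_cong[OF Ep[of f]] by simp
      then show ?thesis by (auto simp: convergent_def)
    qed
    have cube: "0 \<le> z i \<and> z i < 1" if "z \<in> set_pmf (p n)" for n z i
      using that e by (auto simp: p_def split: if_splits)
    obtain \<nu>\<^sub>0 where \<nu>\<^sub>0: "prob_space \<nu>\<^sub>0" "sets \<nu>\<^sub>0 = sets borel"
      "\<And>f. continuous_on UNIV f \<Longrightarrow> bounded (range f) \<Longrightarrow> (\<lambda>n. measure_pmf.expectation (p n) f) \<longlonglongrightarrow> (\<integral>z. f z \<partial>\<nu>\<^sub>0 :: real)"
      by (rule convergent_laws_have_limit[of p]) (use cube lim in blast)+
    interpret \<nu>\<^sub>0: prob_space \<nu>\<^sub>0 by fact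
    define \<nu> where "\<nu> = density \<nu>\<^sub>0 (\<lambda>_. ennreal w)"
    have sets_\<nu>: "sets \<nu> = sets borel" by (simp add: \<nu>_def \<nu>\<^sub>0)
    have fin: "finite_measure \<nu>"
      by (rule finite_measureI) (simp add: \<nu>_def emeasure_density_const ennreal_mult_eq_top_iff)
    have tend: "(\<lambda>n. Z n (\<lambda>x. f (e x)) \<omega>) \<longlonglongrightarrow> (\<integral>z. f z \<partial>\<nu>)"
      if f: "continuous_on UNIV f" "bounded (range f)" for f :: "('i \<Rightarrow> real) \<Rightarrow> real"
    proof -
      have "(\<lambda>n. measure_pmf.expectation (p n) f * Z n (\<lambda>_. 1) \<omega>) \<longlonglongrightarrow> (\<integral>z. f z \<partial>\<nu>\<^sub>0) * w"
        by (intro tendsto_mult \<nu>\<^sub>0 f w)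
      moreover have "eventually (\<lambda>n. measure_pmf.expectation (p n) f * Z n (\<lambda>_. 1) \<omega> = Z n (\<lambda>x. f (e x)) \<omega>) sequentially"
        using Ep[of f] ev by eventually_elim simp
      ultimately have "(\<lambda>n. Z n (\<lambda>x. f (e x)) \<omega>) \<longlonglongrightarrow> (\<integral>z. f z \<partial>\<nu>\<^sub>0) * w"
        using tendsto_cong by fast
      moreover have "(\<integral>z. f z \<partial>\<nu>) = (\<integral>z. f z \<partial>\<nu>\<^sub>0) * w"
        unfolding \<nu>_def using w0 borel_measurable_continuous_onI[OF f(1)]
        by (subst integral_density) (auto simp: measurable_cong_sets[OF \<nu>\<^sub>0(2) refl])
      ultimately show ?thesis by simp
    qed
    \<comment> \<open>The approximants of \<open>- K\<close> vanish at every particle, hence so do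
      their limiting integrals.\<close>
    have "emeasure \<nu> (- K) = 0"
    proof -
      have "open (- K)" using compact_imp_closed[OF K(1)] by auto
      moreover have "(\<integral>z. open_approx (- K) k z \<partial>\<nu>) = 0" for k
      proof -
        have ne: "- K \<noteq> UNIV" using K(2)[of x\<^sub>0] by blast
        have b: "bounded (range (open_approx (- K) k))"
          by (auto simp: bounded_iff open_approx_bounds intro!: exI[of _ 1])
        have "open_approx (- K) k (e x) = 0" for x
          using ne K(2)[of x] by (simp add: open_approx_def)
        then have "(\<lambda>n. 0) \<longlonglongrightarrow> (\<integral>z. open_approx (- K) k z \<partial>\<nu>)"
          using tend[OF continuous_open_approx b] by (simp add: Z_def)
        then show ?thesis using LIMSEQ_unique tendsto_const by blast
      qed
      ultimately show ?thesis using emeasure_open_SUP[OF fin sets_\<nu>, of "- K"] by simp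
    qed
    with sets_\<nu> fin tend show ?thesis by blast
  qed
qed

end

context brw_chain
begin

lemma nn_integral_lim_Z_le:
  assumes f: "\<And>x. 0 \<le> f x" "\<And>x. f x \<le> 1"
    and Zc: "AE \<omega> in M. convergent (\<lambda>n. Z n f \<omega>)"
    and fc: "AE \<omega> in N. (\<lambda>n. f (X n \<omega>)) \<longlonglongrightarrow> F \<omega>"
    and [measurable]: "F \<in> borel_measurable N"
  shows "(\<integral>\<^sup>+\<omega>. ennreal (lim (\<lambda>n. Z n f \<omega>)) \<partial>M) \<le> (\<integral>\<^sup>+\<omega>. ennreal (F \<omega>) \<partial>N)"
proof -
  have "(\<integral>\<^sup>+\<omega>. ennreal (lim (\<lambda>n. Z n f \<omega>)) \<partial>M) = (\<integral>\<^sup>+\<omega>. liminf (\<lambda>n. ennreal (Z n f \<omega>)) \<partial>M)"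
  proof (rule nn_integral_cong_AE)
    show "AE \<omega> in M. ennreal (lim (\<lambda>n. Z n f \<omega>)) = liminf (\<lambda>n. ennreal (Z n f \<omega>))"
      using Zc
    proof eventually_elim
      case (elim \<omega>)
      then have "(\<lambda>n. Z n f \<omega>) \<longlonglongrightarrow> lim (\<lambda>n. Z n f \<omega>)" by (simp add: convergent_LIMSEQ_iff)
      then show ?case by (intro lim_imp_Liminf[symmetric] tendsto_ennrealI) auto
    qed
  qed
  also have "\<dots> \<le> liminf (\<lambda>n. \<integral>\<^sup>+\<omega>. ennreal (Z n f \<omega>) \<partial>M)"
    by (rule nn_integral_liminf) measurable
  also have "\<dots> = liminf (\<lambda>n. \<integral>\<^sup>+\<omega>. ennreal (f (X n \<omega>)) \<partial>N)"
    unfolding ennreal_Z[OF f(1)] nn_integral_Z X.nn_integral_X[where f = "\<lambda>x. ennreal (f x)"] ..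
  also have "\<dots> = (\<integral>\<^sup>+\<omega>. ennreal (F \<omega>) \<partial>N)"
  proof (rule lim_imp_Liminf)
    show "(\<lambda>n. \<integral>\<^sup>+\<omega>. ennreal (f (X n \<omega>)) \<partial>N) \<longlonglongrightarrow> (\<integral>\<^sup>+\<omega>. ennreal (F \<omega>) \<partial>N)"
    proof (rule nn_integral_dominated_convergence[where w = "\<lambda>_. 1"])
      show "(\<lambda>\<omega>. ennreal (f (X n \<omega>))) \<in> borel_measurable N" for n
        by (rule X.measurable_X_comp) simp
      show "AE \<omega> in N. (\<lambda>n. ennreal (f (X n \<omega>))) \<longlonglongrightarrow> ennreal (F \<omega>)"
        using fc by eventually_elim (rule tendsto_ennrealI)
    qed (use f in \<open>auto simp: X.emeasure_space_1 ennreal_le_1\<close>)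
  qed simp
  finally show ?thesis .
qed

text \<open>Fatou's lemma may lose mass, but for \<open>f\<close> and \<open>1 - f\<close> together
  it gives two upper bounds with sum 1. The left sides also sum to 1 by the Kesten-Stigum theorem,
  so both bounds are equalities.\<close>

lemma nn_integral_lim_Z:
  assumes log: "summable (\<lambda>n. pmf \<mu> n * (real n * ln (real n)))"
    and f: "\<And>x. 0 \<le> f x" "\<And>x. f x \<le> 1"
    and fc: "AE \<omega> in N. (\<lambda>n. f (X n \<omega>)) \<longlonglongrightarrow> F \<omega>"
    and F: "F \<in> borel_measurable N"
  shows "(\<integral>\<^sup>+\<omega>. ennreal (lim (\<lambda>n. Z n f \<omega>)) \<partial>M) = (\<integral>\<^sup>+\<omega>. ennreal (F \<omega>) \<partial>N)"
proof -
  note F [measurable]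
  let ?g = "\<lambda>x. 1 + (- 1) * f x"
  have Zf: "AE \<omega> in M. convergent (\<lambda>n. Z n f \<omega>)"
  proof (rule Z_converges)
    show "\<bar>f y\<bar> \<le> 1" for y using f[of y] by simp
    show "AE \<omega> in N. convergent (\<lambda>n. f (X n \<omega>))" using fc by eventually_elim (auto simp: convergent_def)
  qed
  have gc: "AE \<omega> in N. (\<lambda>n. ?g (X n \<omega>)) \<longlonglongrightarrow> 1 + (- 1) * F \<omega>"
    using fc by eventually_elim (intro tendsto_intros)
  have Zg: "AE \<omega> in M. convergent (\<lambda>n. Z n ?g \<omega>)"
    using Zf Z_one_converges
    by eventually_elim (unfold Z_add Z_cmult, intro convergent_add convergent_mult convergent_const)
  have 1: "(\<integral>\<^sup>+\<omega>. ennreal (lim (\<lambda>n. Z n f \<omega>)) \<partial>M) \<le> (\<integral>\<^sup>+\<omega>. ennreal (F \<omega>) \<partial>N)"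
    by (rule nn_integral_lim_Z_le[OF f Zf fc F])
  have 2: "(\<integral>\<^sup>+\<omega>. ennreal (lim (\<lambda>n. Z n ?g \<omega>)) \<partial>M) \<le> (\<integral>\<^sup>+\<omega>. ennreal (1 + (- 1) * F \<omega>) \<partial>N)"
  proof (rule nn_integral_lim_Z_le[OF _ _ Zg gc])
    show "0 \<le> ?g x" "?g x \<le> 1" for x using f[of x] by auto
  qed measurable
  have F01: "AE \<omega> in N. 0 \<le> F \<omega> \<and> F \<omega> \<le> 1"
    using fc
  proof eventually_elim
    case (elim \<omega>)
    then show ?case using f LIMSEQ_le_const[OF elim, of 0] LIMSEQ_le_const2[OF elim, of 1] by auto
  qed
  have sumN: "(\<integral>\<^sup>+\<omega>. ennreal (F \<omega>) \<partial>N) + (\<integral>\<^sup>+\<omega>. ennreal (1 + (- 1) * F \<omega>) \<partial>N) = 1"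
  proof -
    have "(\<integral>\<^sup>+\<omega>. ennreal (F \<omega>) \<partial>N) + (\<integral>\<^sup>+\<omega>. ennreal (1 + (- 1) * F \<omega>) \<partial>N) = (\<integral>\<^sup>+\<omega>. ennreal (F \<omega>) + ennreal (1 + (- 1) * F \<omega>) \<partial>N)"
      by (rule nn_integral_add[symmetric]) measurable
    also have "\<dots> = (\<integral>\<^sup>+\<omega>. 1 \<partial>N)"
      using F01 by (intro nn_integral_cong_AE) (auto simp flip: ennreal_plus)
    finally show ?thesis by (simp add: X.emeasure_space_1)
  qed
  have sumM: "(\<integral>\<^sup>+\<omega>. ennreal (lim (\<lambda>n. Z n f \<omega>)) \<partial>M) + (\<integral>\<^sup>+\<omega>. ennreal (lim (\<lambda>n. Z n ?g \<omega>)) \<partial>M) = 1"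
  proof -
    have "(\<integral>\<^sup>+\<omega>. ennreal (lim (\<lambda>n. Z n f \<omega>)) \<partial>M) + (\<integral>\<^sup>+\<omega>. ennreal (lim (\<lambda>n. Z n ?g \<omega>)) \<partial>M) =
      (\<integral>\<^sup>+\<omega>. ennreal (lim (\<lambda>n. Z n f \<omega>)) + ennreal (lim (\<lambda>n. Z n ?g \<omega>)) \<partial>M)"
      by (rule nn_integral_add[symmetric]) measurable
    also have "\<dots> = (\<integral>\<^sup>+\<omega>. ennreal (lim (\<lambda>n. Z n (\<lambda>_. 1) \<omega>)) \<partial>M)"
    proof (rule nn_integral_cong_AE)
      show "AE \<omega> in M. ennreal (lim (\<lambda>n. Z n f \<omega>)) + ennreal (lim (\<lambda>n. Z n ?g \<omega>)) = ennreal (lim (\<lambda>n. Z n (\<lambda>_. 1) \<omega>))"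
        using Zf Zg
      proof eventually_elim
        case (elim \<omega>)
        obtain a b where ab: "(\<lambda>n. Z n f \<omega>) \<longlonglongrightarrow> a" "(\<lambda>n. Z n ?g \<omega>) \<longlonglongrightarrow> b"
          using elim by (auto simp: convergent_def)
        have "0 \<le> a" by (rule LIMSEQ_le_const[OF ab(1)]) (auto intro!: exI[of _ 0] Z_nonneg f)
        moreover have "0 \<le> b" by (rule LIMSEQ_le_const[OF ab(2)]) (auto intro!: exI[of _ 0] Z_nonneg simp: f)
        moreover have "(\<lambda>n. Z n f \<omega> + Z n ?g \<omega>) \<longlonglongrightarrow> a + b" by (intro tendsto_add ab)
        then have "(\<lambda>n. Z n (\<lambda>_. 1) \<omega>) \<longlonglongrightarrow> a + b" unfolding Z_add Z_cmult by simp
        ultimately show ?case using ab by (simp add: limI)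
      qed
    qed
    also have "\<dots> = 1" by (rule nn_integral_lim_Z_one[OF log])
    finally show ?thesis .
  qed
  have cancel: "a = c" if "a \<le> c" "b \<le> d" "c + d = 1" "a + b = 1" for a b c d :: ennreal
  proof (rule antisym[OF that(1)])
    have "c + d \<le> a + d" using that by (metis add_left_mono)
    moreover have "d \<noteq> \<top>" using that by auto
    ultimately show "c \<le> a" by (simp add: add.commute[of _ d] ennreal_add_left_cancel_le)
  qed
  show ?thesis by (rule cancel[OF 1 2 sumN sumM])
qed

end

section \<open>The limit as a random measure\<close>

lemma tendsto_fun_iff:
  fixes f :: "'a \<Rightarrow> 'i \<Rightarrow> 'b::topological_space"
  shows "(f \<longlongrightarrow> l) F \<longleftrightarrow> (\<forall>i. ((\<lambda>x. f x i) \<longlongrightarrow> l i) F)"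
proof -
  have "(f \<longlongrightarrow> l) F \<longleftrightarrow> limitin (product_topology (\<lambda>i. euclidean) UNIV) f l F"
    unfolding euclidean_product_topology by simp
  also have "\<dots> \<longleftrightarrow> (\<forall>i. ((\<lambda>x. f x i) \<longlongrightarrow> l i) F)"
    by (subst limitin_componentwise) simp
  finally show ?thesis .
qed

lemma convergent_fun_iff:
  fixes f :: "nat \<Rightarrow> 'i \<Rightarrow> 'b::topological_space"
  shows "convergent f \<longleftrightarrow> (\<forall>i. convergent (\<lambda>n. f n i))"
  unfolding convergent_def tendsto_fun_iff by metis

text \<open>Defined for every sequence, convergent or not, so that it gives a total random variable
  whose measurability is checked coordinate by coordinate.\<close>

definition coordinate_lim :: "(nat \<Rightarrow> 'i \<Rightarrow> real) \<Rightarrow> 'i \<Rightarrow> real" where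
  "coordinate_lim s i = lim (\<lambda>n. s n i)"

lemma tendsto_coordinate_lim: "convergent s \<Longrightarrow> s \<longlonglongrightarrow> coordinate_lim s"
  unfolding convergent_fun_iff tendsto_fun_iff coordinate_lim_def by (simp add: convergent_LIMSEQ_iff)

context brw_chain
begin

lemma measurable_coordinate_lim:
  fixes e :: "'s \<Rightarrow> 'i::countable \<Rightarrow> real"
  shows "(\<lambda>\<omega>. coordinate_lim (\<lambda>n. e (X n \<omega>))) \<in> borel_measurable N"
proof (rule measurable_coordinatewise_then_product)
  fix i
  have [measurable]: "(\<lambda>\<omega>. e (X n \<omega>) i) \<in> borel_measurable N" for n
    by (rule X.measurable_X_comp) simp
  show "(\<lambda>\<omega>. coordinate_lim (\<lambda>n. e (X n \<omega>)) i) \<in> borel_measurable N"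
    unfolding coordinate_lim_def by measurable
qed

text \<open>The limit measure is chosen separately for each outcome, so its dependence on
  \<open>\<omega>\<close> is uncontrolled at first. Masses of open sets are suprema of limits of
  measurable \<open>Z\<close>; a Dynkin argument then reaches all Borel sets.\<close>

lemma ex_random_limit:
  fixes e :: "'s \<Rightarrow> 'i::countable \<Rightarrow> real"
  assumes log: "summable (\<lambda>n. pmf \<mu> n * (real n * ln (real n)))"
    and e: "\<And>x i. 0 \<le> e x i \<and> e x i < 1"
    and K: "compact K" "\<And>x. e x \<in> K"
    and conv: "AE \<omega> in N. convergent (\<lambda>n. e (X n \<omega>))"
  obtains W :: "'w \<Rightarrow> ('i \<Rightarrow> real) measure" where
    "\<And>\<omega>. finite_measure (W \<omega>)" "\<And>\<omega>. sets (W \<omega>) = sets borel" "\<And>\<omega>. emeasure (W \<omega>) (- K) = 0"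
    "AE \<omega> in M. \<forall>f. continuous_on UNIV f \<longrightarrow> bounded (range f) \<longrightarrow> (\<lambda>n. Z n (\<lambda>x. f (e x)) \<omega>) \<longlonglongrightarrow> (\<integral>z. f z \<partial>W \<omega>)"
    "\<And>A. A \<in> sets borel \<Longrightarrow> (\<lambda>\<omega>. emeasure (W \<omega>) A) \<in> borel_measurable M"
    "\<And>A. A \<in> sets borel \<Longrightarrow>
      (\<integral>\<^sup>+\<omega>. emeasure (W \<omega>) A \<partial>M) = emeasure (distr N borel (\<lambda>\<omega>. coordinate_lim (\<lambda>n. e (X n \<omega>)))) A"
proof -
  define Y where "Y \<omega> = coordinate_lim (\<lambda>n. e (X n \<omega>))" for \<omega>
  have Y [measurable]: "Y \<in> borel_measurable N"
    unfolding Y_def by (rule measurable_coordinate_lim)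
  have eY: "AE \<omega> in N. (\<lambda>n. e (X n \<omega>)) \<longlonglongrightarrow> Y \<omega>"
    using conv unfolding Y_def by eventually_elim (rule tendsto_coordinate_lim)
  have lim_cont: "AE \<omega> in N. (\<lambda>n. f (e (X n \<omega>))) \<longlonglongrightarrow> f (Y \<omega>)" if "continuous_on UNIV f" for f :: "('i \<Rightarrow> real) \<Rightarrow> real"
    using eY by eventually_elim (rule continuous_on_tendsto_compose[OF that]; simp)
  have mono: "AE \<omega> in M. convergent (\<lambda>n. Z n (\<lambda>x. prod_list (map (e x) l)) \<omega>)" for l
  proof (rule Z_converges)
    show "\<bar>prod_list (map (e y) l)\<bar> \<le> 1" for y
    proof (induction l)
      case (Cons i l)
      have "\<bar>e y i\<bar> \<le> 1" using e[of y i] by auto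
      with Cons show ?case by (simp add: abs_mult mult_le_one)
    qed simp
    show "AE \<omega> in N. convergent (\<lambda>n. prod_list (map (e (X n \<omega>)) l))"
      using lim_cont[OF continuous_on_monomial[of UNIV l]] by eventually_elim (auto simp: convergent_def)
  qed
  have "AE \<omega> in M. \<forall>l. convergent (\<lambda>n. Z n (\<lambda>x. prod_list (map (e x) l)) \<omega>)"
    unfolding AE_all_countable using mono by blast
  then obtain S where S: "S \<in> null_sets M"
    "\<And>\<omega>. \<omega> \<in> space M \<Longrightarrow> \<omega> \<notin> S \<Longrightarrow> (\<forall>l. convergent (\<lambda>n. Z n (\<lambda>x. prod_list (map (e x) l)) \<omega>))"
    by (elim AE_E) (auto simp: null_sets_def)
  \<comment> \<open>A measurable set of probability 1 on which all monomials converge. Elsewhere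
    \<open>W\<close> is the null measure, so it is finite for every outcome.\<close>
  define G where "G = space M - S"
  have G_sets [measurable]: "G \<in> sets M" using S(1) by (auto simp: G_def null_sets_def)
  have AE_G: "AE \<omega> in M. \<omega> \<in> G" using AE_not_in[OF S(1)] by (auto simp: G_def)
  have Zc: "convergent (\<lambda>n. Z n (\<lambda>x. f (e x)) \<omega>)" if "\<omega> \<in> G" "continuous_on UNIV f" for \<omega> and f :: "('i \<Rightarrow> real) \<Rightarrow> real"
  proof (rule Z_converges_continuous[OF K])
    show "continuous_on K f" using that(2) by (rule continuous_on_subset) simp
  qed (use that S in \<open>auto simp: G_def\<close>)
  define Q where "Q \<omega> \<nu> \<longleftrightarrow> finite_measure \<nu> \<and> sets \<nu> = sets borel \<and> emeasure \<nu> (- K) = 0 \<and>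
    (\<forall>f. continuous_on UNIV f \<longrightarrow> bounded (range f) \<longrightarrow> (\<lambda>n. Z n (\<lambda>x. f (e x)) \<omega>) \<longlonglongrightarrow> (\<integral>z. f z \<partial>\<nu>))" for \<omega> \<nu>
  define W where "W \<omega> = (if \<omega> \<in> G then SOME \<nu>. Q \<omega> \<nu> else null_measure borel)" for \<omega>
  have QW: "Q \<omega> (W \<omega>)" if "\<omega> \<in> G" for \<omega>
  proof -
    have "\<exists>\<nu>. Q \<omega> \<nu>" unfolding Q_def using that by (intro ex_limit_measure e K Zc)
    then show ?thesis using that by (simp add: W_def someI_ex)
  qed
  have fin: "finite_measure (W \<omega>)" and sets_W: "sets (W \<omega>) = sets borel" and WK: "emeasure (W \<omega>) (- K) = 0" for \<omega>
    by (cases "\<omega> \<in> G"; use QW[of \<omega>] in \<open>auto simp: Q_def W_def intro: finite_measureI\<close>)+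
  have tend: "AE \<omega> in M. \<forall>f. continuous_on UNIV f \<longrightarrow> bounded (range f) \<longrightarrow> (\<lambda>n. Z n (\<lambda>x. f (e x)) \<omega>) \<longlonglongrightarrow> (\<integral>z. f z \<partial>W \<omega>)"
    using AE_G by eventually_elim (use QW in \<open>auto simp: Q_def\<close>)
  have open_case: "(\<lambda>\<omega>. emeasure (W \<omega>) U) \<in> borel_measurable M \<and> (\<integral>\<^sup>+\<omega>. emeasure (W \<omega>) U \<partial>M) = emeasure (distr N borel Y) U"
    if U: "open U" for U
  proof -
    let ?f = "open_approx U"
    have b: "bounded (range (?f k))" for k
      by (auto simp: bounded_iff open_approx_bounds intro!: exI[of _ 1])
    have eq: "emeasure (W \<omega>) U = indicator G \<omega> * (SUP k. ennreal (lim (\<lambda>n. Z n (\<lambda>x. ?f k (e x)) \<omega>)))" if "\<omega> \<in> space M" for \<omega>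
    proof (cases "\<omega> \<in> G")
      case True
      have "(\<integral>z. ?f k z \<partial>W \<omega>) = lim (\<lambda>n. Z n (\<lambda>x. ?f k (e x)) \<omega>)" for k
        using QW[OF True] b[of k] continuous_open_approx[of UNIV U k] unfolding Q_def by (metis limI)
      then show ?thesis using emeasure_open_SUP[OF fin sets_W U] True by simp
    qed (simp add: W_def)
    have m: "(\<lambda>\<omega>. emeasure (W \<omega>) U) \<in> borel_measurable M"
      by (subst measurable_cong[OF eq]) measurable
    have "(\<integral>\<^sup>+\<omega>. emeasure (W \<omega>) U \<partial>M) = (\<integral>\<^sup>+\<omega>. (SUP k. indicator G \<omega> * ennreal (lim (\<lambda>n. Z n (\<lambda>x. ?f k (e x)) \<omega>))) \<partial>M)"
      by (intro nn_integral_cong) (simp add: eq SUP_mult_left_ennreal)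
    also have "\<dots> = (SUP k. \<integral>\<^sup>+\<omega>. indicator G \<omega> * ennreal (lim (\<lambda>n. Z n (\<lambda>x. ?f k (e x)) \<omega>)) \<partial>M)"
    proof (rule nn_integral_monotone_convergence_SUP)
      show "incseq (\<lambda>k \<omega>. indicator G \<omega> * ennreal (lim (\<lambda>n. Z n (\<lambda>x. ?f k (e x)) \<omega>)))"
        unfolding incseq_def le_fun_def
      proof (intro allI impI)
        fix i j :: nat and \<omega> assume ij: "i \<le> j"
        show "indicator G \<omega> * ennreal (lim (\<lambda>n. Z n (\<lambda>x. ?f i (e x)) \<omega>)) \<le> indicator G \<omega> * ennreal (lim (\<lambda>n. Z n (\<lambda>x. ?f j (e x)) \<omega>))"
        proof (cases "\<omega> \<in> G")
          case True
          have lim: "(\<lambda>n. Z n (\<lambda>x. ?f k (e x)) \<omega>) \<longlonglongrightarrow> lim (\<lambda>n. Z n (\<lambda>x. ?f k (e x)) \<omega>)" for k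
            using Zc[OF True continuous_open_approx] by (simp add: convergent_LIMSEQ_iff)
          have "Z n (\<lambda>x. ?f i (e x)) \<omega> \<le> Z n (\<lambda>x. ?f j (e x)) \<omega>" for n
            by (intro Z_mono open_approx_mono[OF ij])
          then have "lim (\<lambda>n. Z n (\<lambda>x. ?f i (e x)) \<omega>) \<le> lim (\<lambda>n. Z n (\<lambda>x. ?f j (e x)) \<omega>)"
            using LIMSEQ_le[OF lim lim] by blast
          then show ?thesis by (intro mult_left_mono ennreal_leI) auto
        qed simp
      qed
    qed measurable
    also have "\<dots> = (SUP k. \<integral>\<^sup>+\<omega>. ennreal (lim (\<lambda>n. Z n (\<lambda>x. ?f k (e x)) \<omega>)) \<partial>M)"
    proof (intro SUP_cong refl nn_integral_cong_AE)
      show "AE \<omega> in M. indicator G \<omega> * ennreal (lim (\<lambda>n. Z n (\<lambda>x. ?f k (e x)) \<omega>)) = ennreal (lim (\<lambda>n. Z n (\<lambda>x. ?f k (e x)) \<omega>))" for k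
        using AE_G by eventually_elim simp
    qed
    \<comment> \<open>The \<open>L log L\<close> condition enters here, through
      \<open>nn_integral_lim_Z\<close>.\<close>
    also have "\<dots> = (SUP k. \<integral>\<^sup>+\<omega>. ennreal (?f k (Y \<omega>)) \<partial>N)"
    proof (intro SUP_cong refl nn_integral_lim_Z[OF log])
      fix k
      have [measurable]: "?f k \<in> borel_measurable borel"
        by (rule borel_measurable_continuous_onI[OF continuous_open_approx])
      show "(\<lambda>\<omega>. ?f k (Y \<omega>)) \<in> borel_measurable N" by measurable
      show "AE \<omega> in N. (\<lambda>n. ?f k (e (X n \<omega>))) \<longlonglongrightarrow> ?f k (Y \<omega>)" by (rule lim_cont[OF continuous_open_approx])
    qed (simp_all add: open_approx_bounds)
    also have "\<dots> = emeasure (distr N borel Y) U"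
    proof -
      interpret D: prob_space "distr N borel Y" by (rule X.prob_space_distr) (rule Y)
      have "(\<integral>\<^sup>+\<omega>. ennreal (?f k (Y \<omega>)) \<partial>N) = ennreal (\<integral>z. ?f k z \<partial>distr N borel Y)" for k
      proof -
        have [measurable]: "?f k \<in> borel_measurable borel"
          by (rule borel_measurable_continuous_onI[OF continuous_open_approx])
        have "(\<integral>\<^sup>+\<omega>. ennreal (?f k (Y \<omega>)) \<partial>N) = (\<integral>\<^sup>+z. ennreal (?f k z) \<partial>distr N borel Y)"
          by (subst nn_integral_distr) auto
        also have "\<dots> = ennreal (\<integral>z. ?f k z \<partial>distr N borel Y)"
          by (rule nn_integral_eq_integral[OF bounded_continuous_integrable])
             (auto simp: D.finite_measure_axioms continuous_open_approx b open_approx_bounds)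
        finally show ?thesis .
      qed
      then show ?thesis
        using emeasure_open_SUP[OF D.finite_measure_axioms _ U] by simp
    qed
    finally show ?thesis using m by blast
  qed
  have all: "(\<lambda>\<omega>. emeasure (W \<omega>) A) \<in> borel_measurable M \<and> (\<integral>\<^sup>+\<omega>. emeasure (W \<omega>) A \<partial>M) = emeasure (distr N borel Y) A"
    if A: "A \<in> sets borel" for A
  proof -
    interpret D: prob_space "distr N borel Y" by (rule X.prob_space_distr) (rule Y)
    have borel: "sets (borel :: ('i \<Rightarrow> real) measure) = sigma_sets UNIV {S. open S}"
      unfolding borel_def by (rule sets_measure_of) simp
    have "Int_stable {S :: ('i \<Rightarrow> real) set. open S}" by (auto simp: Int_stable_def)
    moreover have "{S :: ('i \<Rightarrow> real) set. open S} \<subseteq> Pow UNIV" by simp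
    moreover have "A \<in> sigma_sets UNIV {S. open S}" using A borel by simp
    \<comment> \<open>Measurability and intensity share one induction because the integral of a
      complement needs both; finiteness of \<open>W \<omega>\<close> permits the
      subtraction.\<close>
    ultimately show ?thesis
    proof (induction rule: sigma_sets_induct_disjoint)
      case (basic A)
      then show ?case using open_case by simp
    next
      case empty
      show ?case by simp
    next
      case (compl A)
      have A: "A \<in> sets borel" using compl borel by simp
      have le: "emeasure (W \<omega>) A \<le> emeasure (W \<omega>) UNIV" for \<omega>
        by (intro emeasure_mono) (auto simp: sets_W)
      have c: "emeasure (W \<omega>) (UNIV - A) = emeasure (W \<omega>) UNIV - emeasure (W \<omega>) A" for \<omega>
        using finite_measure.emeasure_finite[OF fin, of \<omega> A] A by (intro emeasure_Diff) (auto simp: sets_W)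
      have U: "(\<lambda>\<omega>. emeasure (W \<omega>) UNIV) \<in> borel_measurable M" "(\<integral>\<^sup>+\<omega>. emeasure (W \<omega>) UNIV \<partial>M) = emeasure (distr N borel Y) UNIV"
        using open_case[of UNIV] by auto
      have "(\<integral>\<^sup>+\<omega>. emeasure (W \<omega>) (UNIV - A) \<partial>M) = (\<integral>\<^sup>+\<omega>. emeasure (W \<omega>) UNIV \<partial>M) - (\<integral>\<^sup>+\<omega>. emeasure (W \<omega>) A \<partial>M)"
        unfolding c using compl.IH U le by (intro nn_integral_diff) auto
      also have "\<dots> = emeasure (distr N borel Y) (UNIV - A)"
        using compl.IH U A by (subst emeasure_Diff) auto
      finally have int: "(\<integral>\<^sup>+\<omega>. emeasure (W \<omega>) (UNIV - A) \<partial>M) = emeasure (distr N borel Y) (UNIV - A)" .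
      have [measurable]: "(\<lambda>\<omega>. emeasure (W \<omega>) A) \<in> borel_measurable M" using compl.IH by blast
      note U(1) [measurable]
      have "(\<lambda>\<omega>. emeasure (W \<omega>) (UNIV - A)) \<in> borel_measurable M" unfolding c by measurable
      with int show ?case by blast
    next
      case (union A)
      have A: "A i \<in> sets borel" for i using union borel by auto
      have s: "emeasure (W \<omega>) (\<Union>i. A i) = (\<Sum>i. emeasure (W \<omega>) (A i))" for \<omega>
        using union A by (intro suminf_emeasure[symmetric]) (auto simp: sets_W)
      have [measurable]: "(\<lambda>\<omega>. emeasure (W \<omega>) (A i)) \<in> borel_measurable M" for i using union by auto
      have "(\<integral>\<^sup>+\<omega>. emeasure (W \<omega>) (\<Union>i. A i) \<partial>M) = (\<Sum>i. \<integral>\<^sup>+\<omega>. emeasure (W \<omega>) (A i) \<partial>M)"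
        unfolding s by (rule nn_integral_suminf) measurable
      also have "\<dots> = (\<Sum>i. emeasure (distr N borel Y) (A i))" using union by simp
      also have "\<dots> = emeasure (distr N borel Y) (\<Union>i. A i)"
        using union A by (intro suminf_emeasure) auto
      finally show ?case unfolding s by auto
    qed
  qed
  show ?thesis
    by (rule that[of W]) (use fin sets_W WK tend all in \<open>auto simp: Y_def[abs_def]\<close>)
qed

end

section \<open>The Martin compactification as a compact set of functions\<close>

text \<open>The real \<open>suminf\<close> in \<open>offspring_mean\<close> is a genuine mean only
  for a summable series. Summability follows from the \<open>L log L\<close> condition, since
  \<open>ln n\<close> is at least 1 for \<open>n \<ge> 3\<close>.\<close>

lemma offspring_mean_nn_integral:
  assumes "offspring_mean \<mu> > 1" "summable (\<lambda>n. pmf \<mu> n * (real n * ln (real n)))"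
  shows "(\<integral>\<^sup>+n. of_nat n \<partial>\<mu>) = ennreal (offspring_mean \<mu>)"
proof -
  have "summable (\<lambda>n. real n * pmf \<mu> n)"
  proof (rule summable_comparison_test'[OF assms(2), of 3])
    fix n :: nat assume n: "3 \<le> n"
    have "exp 1 \<le> real n" using exp_le n by linarith
    then have "1 \<le> ln (real n)" using n by (subst ln_ge_iff) auto
    then have "real n * pmf \<mu> n * 1 \<le> real n * pmf \<mu> n * ln (real n)" by (intro mult_left_mono) auto
    then show "norm (real n * pmf \<mu> n) \<le> pmf \<mu> n * (real n * ln (real n))" by (simp add: ac_simps)
  qed
  then have "(\<Sum>n. ennreal (real n * pmf \<mu> n)) = ennreal (offspring_mean \<mu>)"
    unfolding offspring_mean_def by (intro suminf_ennreal2) auto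
  then show ?thesis
    by (simp add: nn_integral_measure_pmf nn_integral_count_space_nat ennreal_mult ennreal_of_nat_eq_real_of_nat mult.commute)
qed

lemma integral_scale_measure:
  fixes f :: "'a \<Rightarrow> real"
  assumes "0 \<le> c" "f \<in> borel_measurable M"
  shows "integral\<^sup>L (scale_measure (ennreal c) M) f = c * integral\<^sup>L M f"
proof -
  have "scale_measure (ennreal c) M = density M (\<lambda>_. ennreal c)"
    by (rule measure_eqI) (auto simp: emeasure_density_const)
  then show ?thesis using assms by (simp add: integral_density)
qed

lemma space_borel_of [simp]: "space (borel_of T) = topspace T"
  unfolding borel_of_def by (rule space_measure_of) (auto dest: openin_subset)

lemma sets_borel_of: "sets (borel_of T) = sigma_sets (topspace T) {U. openin T U}"
  unfolding borel_of_def by (rule sets_measure_of) (auto dest: openin_subset)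

lemma openin_sets_borel_of: "openin T U \<Longrightarrow> U \<in> sets (borel_of T)"
  unfolding sets_borel_of by (rule sigma_sets.Basic) simp

lemma measurable_borel_ofI:
  assumes "f \<in> space M \<rightarrow> topspace T" "\<And>U. openin T U \<Longrightarrow> f -` U \<inter> space M \<in> sets M"
  shows "f \<in> measurable M (borel_of T)"
  unfolding borel_of_def using assms by (intro measurable_measure_of) (auto dest: openin_subset)

lemma continuous_map_borel_measurable:
  assumes "continuous_map T euclideanreal f"
  shows "f \<in> borel_measurable (borel_of T)"
proof (rule borel_measurableI)
  fix S :: "real set" assume "open S"
  then have "openin T {x \<in> topspace T. f x \<in> S}"
    using assms by (auto intro: openin_continuous_map_preimage)
  moreover have "f -` S \<inter> space (borel_of T) = {x \<in> topspace T. f x \<in> S}" by auto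
  ultimately show "f -` S \<inter> space (borel_of T) \<in> sets (borel_of T)"
    by (simp add: openin_sets_borel_of)
qed

lemma integral_configuration_measure:
  fixes f :: "'m \<Rightarrow> real"
  assumes "range \<iota> \<subseteq> topspace T" "f \<in> borel_measurable (borel_of T)"
  shows "integral\<^sup>L (configuration_measure T \<iota> B) f = (\<Sum>x\<in>#B. f (\<iota> x))"
proof -
  have m: "\<iota> \<in> measurable (density (count_space UNIV) (\<lambda>x. of_nat (count B x))) (borel_of T)"
    using assms(1) by auto
  have "integral\<^sup>L (configuration_measure T \<iota> B) f =
    (\<integral>x. f (\<iota> x) \<partial>density (count_space UNIV) (\<lambda>x. ennreal (real (count B x))))"
    unfolding configuration_measure_def using m assms(2)
    by (subst integral_distr) (auto simp: ennreal_of_nat_eq_real_of_nat)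
  also have "\<dots> = (\<integral>x. real (count B x) * f (\<iota> x) \<partial>count_space UNIV)"
    by (subst integral_density) auto
  also have "\<dots> = (\<Sum>x\<in>set_mset B. real (count B x) * f (\<iota> x))"
  proof -
    have fin: "finite {x. real (count B x) * f (\<iota> x) \<noteq> 0}"
      by (rule finite_subset[of _ "set_mset B"]) (auto simp: not_in_iff[symmetric])
    have "(\<integral>x. real (count B x) * f (\<iota> x) \<partial>count_space UNIV) = (\<Sum>x | real (count B x) * f (\<iota> x) \<noteq> 0. real (count B x) * f (\<iota> x))"
      using lebesgue_integral_count_space_finite_support[of UNIV "\<lambda>x. real (count B x) * f (\<iota> x)"] fin by simp
    also have "\<dots> = (\<Sum>x\<in>set_mset B. real (count B x) * f (\<iota> x))"
      by (rule sum.mono_neutral_left) (auto simp: not_in_iff[symmetric])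
    finally show ?thesis .
  qed
  also have "\<dots> = (\<Sum>x\<in>#B. f (\<iota> x))"
    by (simp add: sum_mset_eq_sum_count)
  finally show ?thesis .
qed

text \<open>For openness: an open \<open>U\<close> that meets the states only in
  \<open>\<iota> y\<close> has no further points, because the rest of \<open>U\<close> is open and
  misses the dense range.\<close>

lemma compactification_singleton_open:
  assumes "compactification T \<iota>"
  shows "openin T {\<iota> y}" "closedin T {\<iota> y}" "inj \<iota>"
proof -
  have haus: "Hausdorff_space T" and emb: "homeomorphic_map (discrete_topology UNIV) (subtopology T (range \<iota>)) \<iota>"
    and dense: "T closure_of (range \<iota>) = topspace T"
    using assms by (auto simp: compactification_def embedding_map_def)
  have sub: "range \<iota> \<subseteq> topspace T" by (rule compactification_range[OF assms])
  show cl: "closedin T {\<iota> y}" using closedin_Hausdorff_singleton[OF haus] sub by auto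
  show "inj \<iota>" using homeomorphic_imp_injective_map[OF emb] by simp
  have "openin (subtopology T (range \<iota>)) (\<iota> ` {y})"
    using homeomorphic_imp_open_map[OF emb] unfolding open_map_def by (metis openin_discrete_topology subset_UNIV)
  then obtain U where U: "openin T U" "{\<iota> y} = U \<inter> range \<iota>" unfolding openin_subtopology by auto
  have "U - {\<iota> y} = {}"
  proof (rule ccontr)
    assume "U - {\<iota> y} \<noteq> {}"
    then obtain p where p: "p \<in> U - {\<iota> y}" by blast
    have "openin T (U - {\<iota> y})" using U(1) cl by (rule openin_diff)
    moreover have "p \<in> T closure_of (range \<iota>)" using dense p U(1) openin_subset by fastforce
    then have "\<forall>V. p \<in> V \<and> openin T V \<longrightarrow> (\<exists>w. w \<in> range \<iota> \<and> w \<in> V)"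
      unfolding in_closure_of by (rule conjunct2)
    ultimately obtain w where "w \<in> range \<iota>" "w \<in> U - {\<iota> y}" using p by meson
    then show False using U(2) by blast
  qed
  then have "U = {\<iota> y}" using U(2) by blast
  then show "openin T {\<iota> y}" using U(1) by simp
qed

text \<open>Minimality of the Martin compactification is what makes \<open>\<Phi>\<close> injective.\<close>

lemma martin_embedding:
  fixes P :: "'s::countable \<Rightarrow> 's pmf" and T :: "'m topology"
  assumes tr: "transient_chain P" and ir: "irreducible_chain P"
    and martin: "martin_compactification P x\<^sub>0 T \<iota>"
  obtains \<Phi> :: "'m \<Rightarrow> 's + 's \<Rightarrow> real" and \<Psi> :: "('s + 's \<Rightarrow> real) \<Rightarrow> 'm" and c :: "'s \<Rightarrow> real" where
    "continuous_map T euclidean \<Phi>" "continuous_map (top_of_set (\<Phi> ` topspace T)) T \<Psi>"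
    "\<And>p. p \<in> topspace T \<Longrightarrow> \<Psi> (\<Phi> p) = p"
    "\<And>x y. \<Phi> (\<iota> y) (Inl x) = c x * martin_kernel P x\<^sub>0 x y"
    "\<And>p y. \<Phi> p (Inr y) = (if p = \<iota> y then 1 / 2 else 0)"
    "\<And>y i. 0 \<le> \<Phi> (\<iota> y) i \<and> \<Phi> (\<iota> y) i < 1"
proof -
  have comp: "compactification T \<iota>" and ext: "martin_kernel_extends P x\<^sub>0 T \<iota>"
    using martin by (auto simp: martin_compactification_def)
  have cpt: "compact_space T" and haus: "Hausdorff_space T"
    and dense: "T closure_of (range \<iota>) = topspace T"
    using comp by (auto simp: compactification_def)
  have sub: "\<iota> y \<in> topspace T" for y using compactification_range[OF comp] by blast
  obtain g where g: "\<And>x. continuous_map T euclideanreal (g x)" "\<And>x y. g x (\<iota> y) = martin_kernel P x\<^sub>0 x y"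
    using ext unfolding martin_kernel_extends_def by metis
  have "\<forall>x. \<exists>c. 0 < c \<and> (\<forall>y. 0 \<le> c * martin_kernel P x\<^sub>0 x y \<and> c * martin_kernel P x\<^sub>0 x y \<le> 1)"
    using martin_kernel_bound[OF tr ir] by metis
  then obtain c' where c': "\<And>x. 0 < c' x" "\<And>x y. 0 \<le> c' x * martin_kernel P x\<^sub>0 x y" "\<And>x y. c' x * martin_kernel P x\<^sub>0 x y \<le> 1"
    by metis
  \<comment> \<open>The kernels alone need not keep a state apart from boundary points, so every
    state gets an indicator coordinate. All values are halved to stay below 1, as the space-filling
    curve requires.\<close>
  define \<Phi> :: "'m \<Rightarrow> 's + 's \<Rightarrow> real" where
    "\<Phi> p i = (case i of Inl x \<Rightarrow> c' x / 2 * g x p | Inr y \<Rightarrow> (if p = \<iota> y then 1 / 2 else 0))" for p i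
  have cont: "continuous_map T euclidean \<Phi>"
    unfolding euclidean_product_topology[symmetric] continuous_map_componentwise_UNIV
  proof
    fix i :: "'s + 's"
    show "continuous_map T euclideanreal (\<lambda>p. \<Phi> p i)"
    proof (cases i)
      case (Inl x)
      have "continuous_map T euclideanreal (\<lambda>p. c' x / 2 * g x p)"
        by (intro continuous_map_real_mult g(1)) simp
      then show ?thesis by (simp add: \<Phi>_def Inl)
    next
      case (Inr y)
      have "continuous_map T euclideanreal (\<lambda>p. if p = \<iota> y then 1 / 2 else 0)"
        unfolding continuous_map_def
      proof (intro conjI allI impI)
        fix U :: "real set" assume "openin euclideanreal U"
        have o: "openin T {\<iota> y}" "openin T (topspace T - {\<iota> y})"
          using compactification_singleton_open(1,2)[OF comp, of y] by (auto intro: openin_diff)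
        have "{p \<in> topspace T. (if p = \<iota> y then 1 / 2 else 0) \<in> U} =
          (if 1 / 2 \<in> U then {\<iota> y} else {}) \<union> (if 0 \<in> U then topspace T - {\<iota> y} else {})"
          using sub by auto
        moreover have "openin T \<dots>" using o by (intro openin_Un) auto
        ultimately show "openin T {p \<in> topspace T. (if p = \<iota> y then 1 / 2 else 0) \<in> U}" by simp
      qed simp
      then show ?thesis by (simp add: \<Phi>_def Inr)
    qed
  qed
  define K where "K = \<Phi> ` topspace T"
  have cK: "compact K"
    using image_compactin[OF _ cont, of "topspace T"] cpt by (simp add: K_def compact_space_def)
  have eK: "\<Phi> (\<iota> y) \<in> K" for y using sub by (auto simp: K_def)
  have contK: "continuous_map T (top_of_set K) \<Phi>"
    using cont by (auto simp: continuous_map_in_subtopology K_def)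
  let ?e = "\<Phi> \<circ> \<iota>"
  have inr: "\<Phi> (\<iota> y) (Inr z) = (if y = z then 1 / 2 else 0)" for y z
    using compactification_singleton_open(3)[OF comp] by (auto simp: \<Phi>_def inj_eq)
  \<comment> \<open>The image \<open>K\<close> is itself a compactification to which the kernels
    extend, so minimality of \<open>T\<close> supplies the map back.\<close>
  have "compactification (top_of_set K) ?e"
    unfolding compactification_def
  proof (intro conjI)
    show "compact_space (top_of_set K)" using cK by (intro compact_space_subtopology) simp
    show "Hausdorff_space (top_of_set K)" by (simp add: Hausdorff_space_subtopology)
    show "embedding_map (discrete_topology UNIV) (top_of_set K) ?e"
      unfolding embedding_map_def topspace_discrete_topology
    proof (rule bijective_open_imp_homeomorphic_map)
      have r: "range ?e \<subseteq> K" using eK by auto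
      have st: "subtopology (top_of_set K) (range ?e) = top_of_set (range ?e)"
        using r by (simp add: subtopology_subtopology inf_absorb2)
      show "continuous_map (discrete_topology UNIV) (subtopology (top_of_set K) (range ?e)) ?e"
        unfolding st by simp
      show "open_map (discrete_topology UNIV) (subtopology (top_of_set K) (range ?e)) ?e"
        unfolding st open_map_def
      proof (intro allI impI)
        fix A :: "'s set"
        \<comment> \<open>The threshold separates the two values 0 and \<open>1 / 2\<close> of the
          indicator coordinate.\<close>
        define O' where "O' = (\<Union>y\<in>A. {z :: 's + 's \<Rightarrow> real. z (Inr y) > 1 / 4})"
        have "open {z :: 's + 's \<Rightarrow> real. z (Inr y) > 1 / 4}" for y
          by (intro open_Collect_less continuous_on_product_coordinates continuous_on_const)
        then have "open O'" unfolding O'_def by blast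
        moreover have "?e ` A = range ?e \<inter> O'" by (auto simp: O'_def inr split: if_splits)
        ultimately show "openin (top_of_set (range ?e)) (?e ` A)" by (auto simp: openin_open)
      qed
      show "?e ` topspace (discrete_topology UNIV) = topspace (subtopology (top_of_set K) (range ?e))"
        unfolding st by simp
      show "inj_on ?e (topspace (discrete_topology UNIV))"
      proof (rule inj_onI)
        fix y z assume "?e y = ?e z"
        then have "\<Phi> (\<iota> y) (Inr z) = \<Phi> (\<iota> z) (Inr z)" by simp
        then show "y = z" by (simp add: inr split: if_splits)
      qed
    qed
    show "top_of_set K closure_of range ?e = topspace (top_of_set K)"
    proof
      have "\<Phi> ` (T closure_of range \<iota>) \<subseteq> top_of_set K closure_of \<Phi> ` range \<iota>"
        by (rule continuous_map_image_closure_subset[OF contK])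
      then show "topspace (top_of_set K) \<subseteq> top_of_set K closure_of range ?e"
        by (simp add: dense K_def image_comp)
    qed (rule closure_of_subset_topspace)
  qed
  moreover have "martin_kernel_extends P x\<^sub>0 (top_of_set K) ?e"
    unfolding martin_kernel_extends_def
  proof
    fix x
    have "continuous_map (top_of_set K) euclideanreal (\<lambda>z. 2 / c' x * z (Inl x))"
      using c'(1)[of x]
      by (auto intro!: continuous_intros continuous_on_subset[OF continuous_on_product_coordinates])
    moreover have "2 / c' x * (?e y) (Inl x) = martin_kernel P x\<^sub>0 x y" for y
      using c'(1)[of x] by (simp add: \<Phi>_def g)
    ultimately show "\<exists>g. continuous_map (top_of_set K) euclideanreal g \<and> (\<forall>y. g (?e y) = martin_kernel P x\<^sub>0 x y)"
      by blast
  qed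
  ultimately obtain \<Psi> where \<Psi>: "continuous_map (top_of_set K) T \<Psi>" "\<And>y. \<Psi> (?e y) = \<iota> y"
    using martin_compactification_least[OF martin] by metis
  \<comment> \<open>The identity holds on the dense set of states and extends because
    \<open>T\<close> is Hausdorff.\<close>
  have inv: "\<Psi> (\<Phi> p) = p" if "p \<in> topspace T" for p
  proof -
    have "(\<Psi> \<circ> \<Phi>) p = id p"
    proof (rule forall_in_closure_of_eq[of p T "range \<iota>" T])
      show "continuous_map T T (\<Psi> \<circ> \<Phi>)" by (rule continuous_map_compose[OF contK \<Psi>(1)])
    qed (use that dense haus \<Psi>(2) in auto)
    then show ?thesis by simp
  qed
  show ?thesis
  proof (rule that[of \<Phi> \<Psi> "\<lambda>x. c' x / 2"])
    show "0 \<le> \<Phi> (\<iota> y) i \<and> \<Phi> (\<iota> y) i < 1" for y i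
    proof (cases i)
      case (Inl x)
      then show ?thesis using c'(2,3)[of x y] by (simp add: \<Phi>_def g)
    next
      case (Inr z)
      then show ?thesis by (simp add: inr)
    qed
  qed (use cont \<Psi> inv in \<open>auto simp: K_def \<Phi>_def g\<close>)
qed

section \<open>The limit theorem\<close>

theorem theorem1p1:
  fixes P :: "'s::countable \<Rightarrow> 's pmf"
    and x\<^sub>0 :: 's
    and \<mu> :: "nat pmf"
    and T :: "'m topology" and \<iota> :: "'s \<Rightarrow> 'm"
    and M :: "'w measure" and B :: "nat \<Rightarrow> 'w \<Rightarrow> 's multiset"
    and N :: "'v measure" and X :: "nat \<Rightarrow> 'v \<Rightarrow> 's"
  assumes "irreducible_chain P"
    and "transient_chain P"
    and "offspring_mean \<mu> > 1"
    and "summable (\<lambda>n. pmf \<mu> n * (real n * ln (real n)))"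
    and "martin_compactification P x\<^sub>0 T \<iota>"
    and "branching_random_walk M B \<mu> P x\<^sub>0"
    and "markov_chain N X P x\<^sub>0"
  shows "\<exists>W. random_measure M (borel_of T) W \<and>
    (AE \<omega> in M. weakly_converges T
       (\<lambda>n. scale_measure (ennreal (1 / offspring_mean \<mu> ^ n)) (configuration_measure T \<iota> (B n \<omega>)))
       (W \<omega>)) \<and>
    (AE \<omega> in M. emeasure (W \<omega>) (topspace T - harmonic_boundary T \<iota> N X) = 0) \<and>
    (\<forall>A\<in>sets (borel_of T).
       (\<integral>\<^sup>+\<omega>. emeasure (W \<omega>) A \<partial>M) = emeasure N {\<omega> \<in> space N. limit_point T \<iota> X \<omega> \<in> A})"
proof -
  note ir = assms(1) and tr = assms(2) and mean1 = assms(3) and log = assms(4)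
    and martin = assms(5) and walk = assms(6) and chain = assms(7)
  have comp: "compactification T \<iota>" using martin by (simp add: martin_compactification_def)
  have cpt: "compact_space T" and haus: "Hausdorff_space T" using comp by (auto simp: compactification_def)
  have sub: "\<iota> y \<in> topspace T" for y using compactification_range[OF comp] by blast
  interpret brw_chain M B \<mu> P x\<^sub>0 "offspring_mean \<mu>" N X
    by unfold_locales
      (use walk chain mean1 ir offspring_mean_nn_integral[OF mean1 log] in \<open>auto simp: irreducible_chain_def\<close>)

  \<comment> \<open>Realisation of the compactification in a countable cube\<close>
  obtain \<Phi> :: "'m \<Rightarrow> 's + 's \<Rightarrow> real" and \<Psi>\<^sub>0 and c :: "'s \<Rightarrow> real" where
    \<Phi>: "continuous_map T euclidean \<Phi>" and \<Psi>\<^sub>0: "continuous_map (top_of_set (\<Phi> ` topspace T)) T \<Psi>\<^sub>0"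
    and \<Psi>\<Phi>\<^sub>0: "\<And>p. p \<in> topspace T \<Longrightarrow> \<Psi>\<^sub>0 (\<Phi> p) = p"
    and \<Phi>_Inl: "\<And>x y. \<Phi> (\<iota> y) (Inl x) = c x * martin_kernel P x\<^sub>0 x y"
    and \<Phi>_Inr: "\<And>p y. \<Phi> p (Inr y) = (if p = \<iota> y then 1 / 2 else 0)"
    and cube: "\<And>y i. 0 \<le> \<Phi> (\<iota> y) i \<and> \<Phi> (\<iota> y) i < 1"
    by (rule martin_embedding[OF tr ir martin]) blast
  define K where "K = \<Phi> ` topspace T"
  have cK: "compact K"
    using image_compactin[OF _ \<Phi>, of "topspace T"] cpt by (simp add: K_def compact_space_def)
  then have closedK: "closed K" by (rule compact_imp_closed)
  have eK: "\<Phi> (\<iota> y) \<in> K" for y using sub by (auto simp: K_def)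
  \<comment> \<open>A constant value outside \<open>K\<close> makes the inverse a total Borel map;
    the limit measures give no mass to \<open>- K\<close>.\<close>
  define \<Psi> where "\<Psi> z = (if z \<in> K then \<Psi>\<^sub>0 z else \<iota> x\<^sub>0)" for z
  have \<Psi>\<Phi>: "\<Psi> (\<Phi> p) = p" if "p \<in> topspace T" for p using that \<Psi>\<Phi>\<^sub>0 by (simp add: \<Psi>_def K_def)
  have \<Psi>_cont: "continuous_map (top_of_set K) T \<Psi>"
    by (rule continuous_map_eq[OF \<Psi>\<^sub>0[folded K_def]]) (simp add: \<Psi>_def)
  have \<Psi>_top: "\<Psi> z \<in> topspace T" for z
    using \<Psi>\<Phi>\<^sub>0 sub by (auto simp: \<Psi>_def K_def)
  have closed_image: "closed (\<Phi> ` F)" if "closedin T F" for F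
  proof -
    have "compactin T F" using closedin_compact_space[OF cpt that] .
    then have "compact (\<Phi> ` F)" using image_compactin[OF _ \<Phi>] by simp
    then show ?thesis by (rule compact_imp_closed)
  qed
  have vimage: "\<Psi> -` A = \<Phi> ` A \<union> (if \<iota> x\<^sub>0 \<in> A then - K else {})" if "A \<subseteq> topspace T" for A
  proof (intro equalityI subsetI)
    fix z assume z: "z \<in> \<Psi> -` A"
    show "z \<in> \<Phi> ` A \<union> (if \<iota> x\<^sub>0 \<in> A then - K else {})"
    proof (cases "z \<in> K")
      case True
      then obtain p where "p \<in> topspace T" "z = \<Phi> p" by (auto simp: K_def)
      with z \<Psi>\<Phi> show ?thesis by auto
    next
      case False
      with z show ?thesis by (simp add: \<Psi>_def)
    qed
  next
    fix z assume "z \<in> \<Phi> ` A \<union> (if \<iota> x\<^sub>0 \<in> A then - K else {})"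
    then consider p where "p \<in> A" "z = \<Phi> p" | "\<iota> x\<^sub>0 \<in> A" "z \<notin> K" by (auto split: if_splits)
    then show "z \<in> \<Psi> -` A"
    proof cases
      case 1
      then show ?thesis using \<Psi>\<Phi> that by auto
    next
      case 2
      then show ?thesis by (simp add: \<Psi>_def)
    qed
  qed
  have inj: "inj_on \<Phi> (topspace T)" by (metis inj_onI \<Psi>\<Phi>)
  have \<Psi>_meas [measurable]: "\<Psi> \<in> measurable borel (borel_of T)"
  proof (rule measurable_borel_ofI)
    fix U assume U: "openin T U"
    have "closedin T (topspace T - U)"
      using U openin_subset[OF U] by (simp add: closedin_def double_diff)
    then have "closed (\<Phi> ` (topspace T - U))" by (rule closed_image)
    \<comment> \<open>Injectivity makes the image of an open set a difference of two compact sets,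
      hence Borel.\<close>
    moreover have "\<Phi> ` U = K - \<Phi> ` (topspace T - U)"
      using openin_subset[OF U] inj unfolding K_def inj_on_def by blast
    ultimately have "\<Phi> ` U \<in> sets borel" using closedK by auto
    moreover have "- K \<in> sets borel" using closedK by auto
    ultimately show "\<Psi> -` U \<inter> space borel \<in> sets borel"
      using vimage[OF openin_subset[OF U]] by auto
  qed (use \<Psi>_top in auto)

  \<comment> \<open>Convergence of the chain in the compactification\<close>
  let ?e = "\<lambda>y. \<Phi> (\<iota> y)"
  \<comment> \<open>Kernel coordinates converge by Hunt's argument, indicator coordinates because
    every state is eventually left for good.\<close>
  have conv: "AE \<omega> in N. convergent (\<lambda>n. ?e (X n \<omega>))" and
    leave: "AE \<omega> in N. \<forall>y. eventually (\<lambda>n. X n \<omega> \<noteq> y) sequentially"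
  proof -
    show leave: "AE \<omega> in N. \<forall>y. eventually (\<lambda>n. X n \<omega> \<noteq> y) sequentially"
      by (rule X.AE_eventually_neq) (simp add: egreen_eq_green[OF tr])
    have "AE \<omega> in N. \<forall>x. convergent (\<lambda>n. martin_kernel P x\<^sub>0 x (X n \<omega>))"
      unfolding AE_all_countable using X.martin_kernel_converges[OF tr ir] by blast
    with leave show "AE \<omega> in N. convergent (\<lambda>n. ?e (X n \<omega>))"
    proof eventually_elim
      case (elim \<omega>)
      show ?case unfolding convergent_fun_iff
      proof
        fix i :: "'s + 's"
        show "convergent (\<lambda>n. ?e (X n \<omega>) i)"
        proof (cases i)
          case (Inl x)
          then show ?thesis using elim by (simp add: \<Phi>_Inl convergent_mult convergent_const)
        next
          case (Inr y)
          have "eventually (\<lambda>n. ?e (X n \<omega>) i = 0) sequentially"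
            using elim(1)[rule_format, of y]
            by eventually_elim (use compactification_singleton_open(3)[OF comp] in \<open>auto simp: Inr \<Phi>_Inr inj_eq\<close>)
          then have "(\<lambda>n. ?e (X n \<omega>) i) \<longlonglongrightarrow> 0" by (rule tendsto_eventually)
          then show ?thesis by (auto simp: convergent_def)
        qed
      qed
    qed
  qed
  define Y where "Y \<omega> = coordinate_lim (\<lambda>n. ?e (X n \<omega>))" for \<omega>
  have Y [measurable]: "Y \<in> borel_measurable N" unfolding Y_def by (rule measurable_coordinate_lim)
  have YK: "Y \<omega> \<in> K" if "convergent (\<lambda>n. ?e (X n \<omega>))" for \<omega>
    using closed_sequentially[OF closedK _ tendsto_coordinate_lim[OF that]] eK unfolding Y_def by blast
  \<comment> \<open>\<open>\<Psi>\<close> carries limits in \<open>K\<close> to \<open>T\<close> and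
    \<open>\<Phi>\<close> carries limits in \<open>T\<close> back, so the default value of
    \<open>limit_point\<close> is taken exactly when the image path diverges.\<close>
  have lp: "limit_point T \<iota> X \<omega> = (if convergent (\<lambda>n. ?e (X n \<omega>)) then \<Psi> (Y \<omega>) else \<iota> (X 0 \<omega>))" for \<omega>
  proof (cases "convergent (\<lambda>n. ?e (X n \<omega>))")
    case True
    have "limitin (top_of_set K) (\<lambda>n. ?e (X n \<omega>)) (Y \<omega>) sequentially"
      using tendsto_coordinate_lim[OF True] YK[OF True] eK by (simp add: limitin_subtopology Y_def)
    then have "limitin T (\<Psi> \<circ> (\<lambda>n. ?e (X n \<omega>))) (\<Psi> (Y \<omega>)) sequentially"
      by (rule continuous_map_limit[OF \<Psi>_cont])
    then have lim: "limitin T (\<lambda>n. \<iota> (X n \<omega>)) (\<Psi> (Y \<omega>)) sequentially"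
      using \<Psi>\<Phi> sub by (simp add: comp_def)
    moreover have "(THE l. limitin T (\<lambda>n. \<iota> (X n \<omega>)) l sequentially) = \<Psi> (Y \<omega>)"
    proof (rule the_equality[of _ "\<Psi> (Y \<omega>)"])
      fix l assume "limitin T (\<lambda>n. \<iota> (X n \<omega>)) l sequentially"
      then show "l = \<Psi> (Y \<omega>)"
        by (rule limitin_Hausdorff_unique[OF _ lim trivial_limit_sequentially haus])
    qed (rule lim)
    ultimately show ?thesis using True by (auto simp: limit_point_def)
  next
    case False
    have "\<not> limitin T (\<lambda>n. \<iota> (X n \<omega>)) l sequentially" for l
    proof
      assume "limitin T (\<lambda>n. \<iota> (X n \<omega>)) l sequentially"
      then have "limitin euclidean (\<Phi> \<circ> (\<lambda>n. \<iota> (X n \<omega>))) (\<Phi> l) sequentially"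
        by (rule continuous_map_limit[OF \<Phi>])
      then show False using False by (auto simp: comp_def convergent_def)
    qed
    then show ?thesis using False by (simp add: limit_point_def)
  qed
  have lp_meas: "{\<omega> \<in> space N. limit_point T \<iota> X \<omega> \<in> A} \<in> sets N" if A: "A \<in> sets (borel_of T)" for A
  proof -
    have [measurable]: "(\<lambda>\<omega>. ?e (X n \<omega>) i) \<in> borel_measurable N" for n i
      by (rule X.measurable_X_comp) simp
    \<comment> \<open>In each real coordinate convergence is the Cauchy property, which is a
      measurable event.\<close>
    have [measurable]: "Measurable.pred N (\<lambda>\<omega>. convergent (\<lambda>n. ?e (X n \<omega>)))"
    proof -
      have "Measurable.pred N (\<lambda>\<omega>. Cauchy (\<lambda>n. ?e (X n \<omega>) i))" for i
        unfolding pred_def by (rule sets_Collect_Cauchy) measurable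
      then have "Measurable.pred N (\<lambda>\<omega>. \<forall>i. Cauchy (\<lambda>n. ?e (X n \<omega>) i))"
        by (rule pred_intros_countable(1))
      then show ?thesis unfolding convergent_fun_iff Cauchy_convergent_iff[symmetric] .
    qed
    have [measurable]: "(\<lambda>\<omega>. \<iota> (X 0 \<omega>)) \<in> measurable N (borel_of T)"
      by (rule X.measurable_X_comp) (use sub in auto)
    have "limit_point T \<iota> X \<in> measurable N (borel_of T)"
      unfolding lp[abs_def] by measurable
    then have "limit_point T \<iota> X -` A \<inter> space N \<in> sets N" using A by (rule measurable_sets)
    moreover have "limit_point T \<iota> X -` A \<inter> space N = {\<omega> \<in> space N. limit_point T \<iota> X \<omega> \<in> A}" by auto
    ultimately show ?thesis by simp
  qed

  \<comment> \<open>The random limit measure and its intensity\<close>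
  obtain V where V: "\<And>\<omega>. finite_measure (V \<omega>)" "\<And>\<omega>. sets (V \<omega>) = sets borel" "\<And>\<omega>. emeasure (V \<omega>) (- K) = 0"
    "AE \<omega> in M. \<forall>f. continuous_on UNIV f \<longrightarrow> bounded (range f) \<longrightarrow> (\<lambda>n. Z n (\<lambda>x. f (?e x)) \<omega>) \<longlonglongrightarrow> (\<integral>z. f z \<partial>V \<omega>)"
    "\<And>A. A \<in> sets borel \<Longrightarrow> (\<lambda>\<omega>. emeasure (V \<omega>) A) \<in> borel_measurable M"
    "\<And>A. A \<in> sets borel \<Longrightarrow> (\<integral>\<^sup>+\<omega>. emeasure (V \<omega>) A \<partial>M) = emeasure (distr N borel Y) A"
    by (rule ex_random_limit[where e = ?e, OF log cube cK eK conv, folded Y_def]) (rule that, assumption+)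
  define W where "W \<omega> = distr (V \<omega>) (borel_of T) \<Psi>" for \<omega>
  have \<Psi>_V [measurable]: "\<Psi> \<in> measurable (V \<omega>) (borel_of T)" for \<omega>
    using \<Psi>_meas by (simp add: measurable_cong_sets[OF V(2) refl])
  have space_V: "space (V \<omega>) = UNIV" for \<omega> using sets_eq_imp_space_eq[OF V(2)] by simp
  have pre: "\<Psi> -` A \<in> sets borel" if "A \<in> sets (borel_of T)" for A
    using measurable_sets[OF \<Psi>_meas that] by simp
  have W_emeasure: "emeasure (W \<omega>) A = emeasure (V \<omega>) (\<Psi> -` A)" if "A \<in> sets (borel_of T)" for A \<omega>
    unfolding W_def using that by (simp add: emeasure_distr space_V)
  have W_meas: "(\<lambda>\<omega>. emeasure (W \<omega>) A) \<in> borel_measurable M" if "A \<in> sets (borel_of T)" for A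
    using V(5)[OF pre[OF that]] by (simp add: W_emeasure[OF that])
  have rm: "random_measure M (borel_of T) W"
    unfolding random_measure_def
  proof (intro conjI ballI)
    fix \<omega>
    show "finite_measure (W \<omega>)"
      unfolding W_def by (rule finite_measure.finite_measure_distr[OF V(1) \<Psi>_V])
    show "sets (W \<omega>) = sets (borel_of T)" by (simp add: W_def)
  qed (rule W_meas)
  have intensity: "(\<integral>\<^sup>+\<omega>. emeasure (W \<omega>) A \<partial>M) = emeasure N {\<omega> \<in> space N. limit_point T \<iota> X \<omega> \<in> A}"
    if A: "A \<in> sets (borel_of T)" for A
  proof -
    have "(\<integral>\<^sup>+\<omega>. emeasure (W \<omega>) A \<partial>M) = emeasure (distr N borel Y) (\<Psi> -` A)"
      unfolding W_emeasure[OF A] by (rule V(6)[OF pre[OF A]])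
    also have "\<dots> = emeasure N (Y -` (\<Psi> -` A) \<inter> space N)"
      by (rule emeasure_distr[OF Y pre[OF A]])
    also have "\<dots> = emeasure N {\<omega> \<in> space N. limit_point T \<iota> X \<omega> \<in> A}"
    proof (rule emeasure_eq_AE)
      show "AE \<omega> in N. \<omega> \<in> Y -` (\<Psi> -` A) \<inter> space N \<longleftrightarrow> \<omega> \<in> {\<omega> \<in> space N. limit_point T \<iota> X \<omega> \<in> A}"
        using conv by eventually_elim (auto simp: lp)
      show "Y -` (\<Psi> -` A) \<inter> space N \<in> sets N" by (rule measurable_sets[OF Y pre[OF A]])
    qed (rule lp_meas[OF A])
    finally show ?thesis .
  qed
  have weak: "AE \<omega> in M. weakly_converges T
       (\<lambda>n. scale_measure (ennreal (1 / offspring_mean \<mu> ^ n)) (configuration_measure T \<iota> (B n \<omega>))) (W \<omega>)"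
    using V(4)
  proof eventually_elim
    case (elim \<omega>)
    show ?case unfolding weakly_converges_def
    proof (intro allI impI)
      fix f assume f: "continuous_map T euclideanreal f"
      have fm: "f \<in> borel_measurable (borel_of T)" by (rule continuous_map_borel_measurable[OF f])
      \<comment> \<open>\<open>V \<omega>\<close> lives on the whole function space, while the
        pulled-back test function is continuous on \<open>K\<close> only. Tietze's theorem extends
        it, and the values off \<open>K\<close> are not charged.\<close>
      have "continuous_map (top_of_set K) euclideanreal (f \<circ> \<Psi>)"
        by (rule continuous_map_compose[OF \<Psi>_cont f])
      then have fK: "continuous_on K (f \<circ> \<Psi>)" by simp
      then have "bounded ((f \<circ> \<Psi>) ` K)" using cK compact_continuous_image compact_imp_bounded by blast
      then obtain C where C: "\<And>z. z \<in> K \<Longrightarrow> norm ((f \<circ> \<Psi>) z) \<le> C" by (auto simp: bounded_iff)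
      have "0 \<le> C" using C[OF eK[of x\<^sub>0]] norm_ge_zero order_trans by blast
      then obtain F where F: "continuous_on UNIV F" "\<And>z. z \<in> K \<Longrightarrow> F z = (f \<circ> \<Psi>) z" "\<And>z. norm (F z) \<le> C"
        using Tietze[OF fK, of UNIV C] closedK C by auto
      have "bounded (range F)" using F(3) by (auto simp: bounded_iff)
      then have "(\<lambda>n. Z n (\<lambda>x. F (?e x)) \<omega>) \<longlonglongrightarrow> (\<integral>z. F z \<partial>V \<omega>)" using elim F(1) by blast
      moreover have "F (?e x) = f (\<iota> x)" for x using F(2)[OF eK] \<Psi>\<Phi>[OF sub] by simp
      moreover have "integral\<^sup>L (scale_measure (ennreal (1 / offspring_mean \<mu> ^ n)) (configuration_measure T \<iota> (B n \<omega>))) f =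
          Z n (\<lambda>x. f (\<iota> x)) \<omega>" for n
      proof -
        have "f \<in> borel_measurable (configuration_measure T \<iota> (B n \<omega>))"
          using fm by (simp add: configuration_measure_def)
        then show ?thesis
          using mean1 compactification_range[OF comp] fm
          by (simp add: integral_scale_measure integral_configuration_measure Z_def)
      qed
      moreover have "integral\<^sup>L (W \<omega>) f = (\<integral>z. F z \<partial>V \<omega>)"
      proof -
        have "integral\<^sup>L (W \<omega>) f = (\<integral>z. f (\<Psi> z) \<partial>V \<omega>)"
          unfolding W_def by (rule integral_distr[OF \<Psi>_V fm])
        also have "\<dots> = (\<integral>z. F z \<partial>V \<omega>)"
        proof (rule integral_cong_AE)
          show "(\<lambda>z. f (\<Psi> z)) \<in> borel_measurable (V \<omega>)" using measurable_compose[OF \<Psi>_V fm] .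
          show "F \<in> borel_measurable (V \<omega>)"
            using borel_measurable_continuous_onI[OF F(1)] by (simp add: measurable_cong_sets[OF V(2) refl])
          have "- K \<in> null_sets (V \<omega>)" using V(2,3) closedK by (auto simp: null_sets_def)
          then have "AE z in V \<omega>. z \<notin> - K" by (rule AE_not_in)
          then show "AE z in V \<omega>. f (\<Psi> z) = F z" by eventually_elim (simp add: F(2))
        qed
        finally show ?thesis .
      qed
      ultimately show "(\<lambda>n. integral\<^sup>L (scale_measure (ennreal (1 / offspring_mean \<mu> ^ n)) (configuration_measure T \<iota> (B n \<omega>))) f)
          \<longlonglongrightarrow> integral\<^sup>L (W \<omega>) f" by simp
    qed
  qed

  \<comment> \<open>Support on the harmonic boundary\<close>
  have supp: "AE \<omega> in M. emeasure (W \<omega>) (topspace T - harmonic_boundary T \<iota> N X) = 0"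
  proof -
    \<comment> \<open>The harmonic boundary is an intersection of possibly uncountably many closed
      sets of full measure. Lindelof's theorem in the cube leaves countably many of them.\<close>
    define \<F> where "\<F> = {F. closedin T F \<and> F \<subseteq> martin_boundary T \<iota> \<and>
         measure N {\<omega> \<in> space N. limit_point T \<iota> X \<omega> \<in> F} = 1}"
    have cl: "open (- \<Phi> ` F)" if "F \<in> \<F>" for F
      using closed_image[of F] that by (auto simp: \<F>_def)
    obtain \<G>' where \<G>': "\<G>' \<subseteq> (\<lambda>F. - \<Phi> ` F) ` \<F>" "countable \<G>'" "\<Union>\<G>' = \<Union>((\<lambda>F. - \<Phi> ` F) ` \<F>)"
      using Lindelof[of "(\<lambda>F. - \<Phi> ` F) ` \<F>"] cl by (metis (no_types, lifting) imageE)
    obtain \<G> where \<G>: "\<G> \<subseteq> \<F>" "countable \<G>" "\<G>' = (\<lambda>F. - \<Phi> ` F) ` \<G>"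
      using \<G>'(1,2) countable_subset_image by (metis (no_types, lifting))
    \<comment> \<open>The states appear because the harmonic boundary is cut down to the Martin
      boundary, which matters when \<open>\<G>\<close> is empty.\<close>
    have eq: "topspace T - harmonic_boundary T \<iota> N X = range \<iota> \<union> (\<Union>F\<in>\<G>. topspace T - F)"
    proof (intro equalityI subsetI)
      fix p assume p: "p \<in> topspace T - harmonic_boundary T \<iota> N X"
      show "p \<in> range \<iota> \<union> (\<Union>F\<in>\<G>. topspace T - F)"
      proof (cases "p \<in> range \<iota>")
        case False
        with p obtain F where F: "F \<in> \<F>" "p \<notin> F"
          by (auto simp: harmonic_boundary_def martin_boundary_def \<F>_def)
        have "F \<subseteq> topspace T" using F(1) closedin_subset by (auto simp: \<F>_def)
        then have "\<Phi> p \<notin> \<Phi> ` F" using F(2) p inj by (auto simp: inj_on_def)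
        then have "\<Phi> p \<in> \<Union>\<G>'" using \<G>'(3) F(1) by auto
        then obtain F' where "F' \<in> \<G>" "\<Phi> p \<notin> \<Phi> ` F'" using \<G>(3) by auto
        then show ?thesis using p by auto
      qed simp
    next
      fix p assume "p \<in> range \<iota> \<union> (\<Union>F\<in>\<G>. topspace T - F)"
      then show "p \<in> topspace T - harmonic_boundary T \<iota> N X"
        using \<G>(1) sub by (auto simp: harmonic_boundary_def martin_boundary_def \<F>_def)
    qed
    have "openin T (range \<iota> \<union> (\<Union>F\<in>\<G>. topspace T - F))"
    proof (rule openin_Un)
      have "range \<iota> = (\<Union>y. {\<iota> y})" by auto
      then show "openin T (range \<iota>)"
        using compactification_singleton_open(1)[OF comp] by (metis (no_types, lifting) imageE openin_Union)
      show "openin T (\<Union>F\<in>\<G>. topspace T - F)"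
        using \<G>(1) by (intro openin_Union) (auto simp: \<F>_def closedin_def)
    qed
    then have meas: "topspace T - harmonic_boundary T \<iota> N X \<in> sets (borel_of T)"
      unfolding eq by (rule openin_sets_borel_of)
    \<comment> \<open>A limit at a state would have indicator coordinate \<open>1 / 2\<close>, but
      along the path this coordinate is eventually 0.\<close>
    have "AE \<omega> in N. limit_point T \<iota> X \<omega> \<notin> range \<iota>"
      using conv leave
    proof eventually_elim
      case (elim \<omega>)
      have "limit_point T \<iota> X \<omega> \<noteq> \<iota> y" for y
      proof
        assume y: "limit_point T \<iota> X \<omega> = \<iota> y"
        obtain p where p: "p \<in> topspace T" "Y \<omega> = \<Phi> p" using YK[OF elim(1)] by (auto simp: K_def)
        have "p = \<iota> y" using y elim(1) p \<Psi>\<Phi> by (simp add: lp)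
        then have half: "Y \<omega> (Inr y) = 1 / 2" using p \<Phi>_Inr by simp
        have "(\<lambda>n. ?e (X n \<omega>)) \<longlonglongrightarrow> Y \<omega>" unfolding Y_def by (rule tendsto_coordinate_lim[OF elim(1)])
        then have "(\<lambda>n. ?e (X n \<omega>) (Inr y)) \<longlonglongrightarrow> Y \<omega> (Inr y)" unfolding tendsto_fun_iff by blast
        moreover have "eventually (\<lambda>n. ?e (X n \<omega>) (Inr y) = 0) sequentially"
          using elim(2)[rule_format, of y]
          by eventually_elim (use compactification_singleton_open(3)[OF comp] in \<open>auto simp: \<Phi>_Inr inj_eq\<close>)
        then have "(\<lambda>n. ?e (X n \<omega>) (Inr y)) \<longlonglongrightarrow> 0" by (rule tendsto_eventually)
        ultimately have "Y \<omega> (Inr y) = 0" using LIMSEQ_unique by blast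
        with half show False by simp
      qed
      then show ?case by auto
    qed
    moreover have "AE \<omega> in N. \<forall>F\<in>\<G>. limit_point T \<iota> X \<omega> \<in> F"
    proof (subst AE_ball_countable[OF \<G>(2)], intro ballI)
      fix F assume "F \<in> \<G>"
      then have F: "closedin T F" "measure N {\<omega> \<in> space N. limit_point T \<iota> X \<omega> \<in> F} = 1"
        using \<G>(1) by (auto simp: \<F>_def)
      have "openin T (topspace T - F)" using F(1) by (simp add: closedin_def)
      then have "topspace T - (topspace T - F) \<in> sets (borel_of T)"
        using sets.compl_sets[OF openin_sets_borel_of] by fastforce
      then have "F \<in> sets (borel_of T)" using closedin_subset[OF F(1)] by (simp add: double_diff)
      then have "{\<omega> \<in> space N. limit_point T \<iota> X \<omega> \<in> F} \<in> sets N" by (rule lp_meas)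
      then have "AE \<omega> in N. \<omega> \<in> {\<omega> \<in> space N. limit_point T \<iota> X \<omega> \<in> F}"
        using F(2) X.prob_eq_1 by blast
      then show "AE \<omega> in N. limit_point T \<iota> X \<omega> \<in> F" by eventually_elim simp
    qed
    ultimately have "AE \<omega> in N. limit_point T \<iota> X \<omega> \<notin> topspace T - harmonic_boundary T \<iota> N X"
      unfolding eq by eventually_elim auto
    \<comment> \<open>The limit point avoids the complement almost surely; by the intensity formula
      its \<open>W\<close> mass has mean 0, and a nonnegative variable of mean 0 vanishes almost
      surely.\<close>
    then have "emeasure N {\<omega> \<in> space N. limit_point T \<iota> X \<omega> \<in> topspace T - harmonic_boundary T \<iota> N X} = 0"
      using lp_meas[OF meas] by (subst (asm) AE_iff_measurable[OF _ refl]) auto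
    then have "(\<integral>\<^sup>+\<omega>. emeasure (W \<omega>) (topspace T - harmonic_boundary T \<iota> N X) \<partial>M) = 0"
      using intensity[OF meas] by simp
    then show ?thesis
      using W_meas[OF meas] by (subst (asm) nn_integral_0_iff_AE) auto
  qed
  show ?thesis using rm weak supp intensity by blast
qed

end
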